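(* Let $K$ be a field and $K\subset L$ a finite field extension whose degree $n=[L:K]$ is even. Let $H\subset L$ be a $K$-subspace containing $K$ with $\dim_K H=n-1$. Let $W$ be a $K$-linear subspace of $H$ such that $K\subsetneq W$, $\dim_K W=\frac n2$, and $W^2\subseteq H$. Let $t$ be an indeterminate and let $R$ be the graded $K$-subalgebra $$R = K\oplus Wt\oplus Ht^2\oplus\bigoplus_{i\ge 3}Lt^i$$ of the polynomial ring $L[t]$ (graded with $|t|=1$). Then $R$ is a graded Gorenstein (in particular, noetherian) domain of Krull dimension one. As a $K$-algebra, $R$ is generated by its elements of degrees one and two; if moreover $W^2=H$, then $R$ is standard graded.
   Context: For $K$-subspaces $U,U'$ of $L$, the product $UU'$ denotes the $K$-linear span of all products $uu'$ with $u\in U$, $u'\in U'$, and $U^2=UU$. The condition $W^2\subseteq H$ (together with $K\subset W\subset H$) guarantees that $R$ is a $K$-subalgebra of $L[t]$. A graded $K$-algebra $R=\bigoplus_{i\ge0}R_i$ with $R_0=K$ is standard graded if it is generated as a $K$-algebra by finitely many elements of degree one. *)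

theory Defs
  imports
    "HOL-Library.Extended_Nat"
    "HOL-Algebra.Embedded_Algebras"
    "HOL-Algebra.Generated_Rings"
    "HOL-Algebra.Ring_Divisibility"
    "HOL-Algebra.UnivPoly"
begin

text \<open>
  Throughout, a \<open>K\<close>-subspace of a ring \<open>R\<close> containing the field \<open>K\<close> is a set \<open>V\<close> with
  \<open>subalgebra K V R\<close>: despite its name this library locale only asks for an additive subgroup
  that is closed under multiplication by elements of \<open>K\<close>.
\<close>

section \<open>Products of subspaces, graded algebras\<close>

definition subspace_prod :: "('a, 'b) ring_scheme \<Rightarrow> 'a set \<Rightarrow> 'a set \<Rightarrow> 'a set \<Rightarrow> 'a set" where
  "subspace_prod L K U V =
     \<Union> {ring.Span L K us | us. set us \<subseteq> {u \<otimes>\<^bsub>L\<^esub> v | u v. u \<in> U \<and> v \<in> V}}"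

definition graded_algebra :: "'a set \<Rightarrow> ('a, 'b) ring_scheme \<Rightarrow> (nat \<Rightarrow> 'a set) \<Rightarrow> bool" where
  "graded_algebra K R A \<longleftrightarrow>
     cring R \<and> subfield K R \<and>
     (\<forall>i. subalgebra K (A i) R) \<and>
     (\<forall>i j. \<forall>x\<in>A i. \<forall>y\<in>A j. x \<otimes>\<^bsub>R\<^esub> y \<in> A (i + j)) \<and>
     (\<forall>x\<in>carrier R. \<exists>!f. (\<forall>i. f i \<in> A i) \<and> finite {i. f i \<noteq> \<zero>\<^bsub>R\<^esub>} \<and>
        x = finsum R f {i. f i \<noteq> \<zero>\<^bsub>R\<^esub>})"

definition standard_graded :: "'a set \<Rightarrow> ('a, 'b) ring_scheme \<Rightarrow> (nat \<Rightarrow> 'a set) \<Rightarrow> bool" where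
  "standard_graded K R A \<longleftrightarrow>
     graded_algebra K R A \<and> A 0 = K \<and>
     (\<exists>S\<subseteq>A 1. finite S \<and> generate_ring R (K \<union> S) = carrier R)"


section \<open>Krull dimension\<close>

text \<open>The supremum of the lengths of chains of prime ideals; the zero ring gets the value 0.\<close>

definition krull_dim :: "('r, 'b) ring_scheme \<Rightarrow> enat" where
  "krull_dim R = Sup {enat n | n. \<exists>P :: nat \<Rightarrow> 'r set.
     (\<forall>i\<le>n. primeideal (P i) R) \<and> (\<forall>i<n. P i \<subset> P (Suc i))}"


section \<open>Localization\<close>

definition loc_rel :: "('r, 'b) ring_scheme \<Rightarrow> 'r set \<Rightarrow> (('r \<times> 'r) \<times> ('r \<times> 'r)) set" where
  "loc_rel R S = {((r, s), (r', s')). r \<in> carrier R \<and> s \<in> S \<and> r' \<in> carrier R \<and> s' \<in> S \<and>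
     (\<exists>u\<in>S. u \<otimes>\<^bsub>R\<^esub> (r \<otimes>\<^bsub>R\<^esub> s' \<ominus>\<^bsub>R\<^esub> r' \<otimes>\<^bsub>R\<^esub> s) = \<zero>\<^bsub>R\<^esub>)}"

definition loc_frac :: "('r, 'b) ring_scheme \<Rightarrow> 'r set \<Rightarrow> 'r \<Rightarrow> 'r \<Rightarrow> ('r \<times> 'r) set" where
  "loc_frac R S r s = loc_rel R S `` {(r, s)}"

definition localization :: "('r, 'b) ring_scheme \<Rightarrow> 'r set \<Rightarrow> ('r \<times> 'r) set ring" where
  "localization R S =
     \<lparr>carrier = (carrier R \<times> S) // loc_rel R S,
      monoid.mult = (\<lambda>F G. \<Union>x\<in>F. \<Union>y\<in>G. loc_frac R S (fst x \<otimes>\<^bsub>R\<^esub> fst y) (snd x \<otimes>\<^bsub>R\<^esub> snd y)),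
      one = loc_frac R S \<one>\<^bsub>R\<^esub> \<one>\<^bsub>R\<^esub>,
      zero = loc_frac R S \<zero>\<^bsub>R\<^esub> \<one>\<^bsub>R\<^esub>,
      add = (\<lambda>F G. \<Union>x\<in>F. \<Union>y\<in>G.
        loc_frac R S (fst x \<otimes>\<^bsub>R\<^esub> snd y \<oplus>\<^bsub>R\<^esub> fst y \<otimes>\<^bsub>R\<^esub> snd x) (snd x \<otimes>\<^bsub>R\<^esub> snd y))\<rparr>"


section \<open>Injective dimension and Gorenstein rings\<close>

definition self_module :: "('r, 'b) ring_scheme \<Rightarrow> ('r, 'r) module" where
  "self_module R =
     \<lparr>carrier = carrier R, monoid.mult = monoid.mult R, one = one R, zero = zero R, add = add R,
      smult = monoid.mult R\<rparr>"

definition linear_maps ::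
  "('r, 'b) ring_scheme \<Rightarrow> ('r, 'm, 'c) module_scheme \<Rightarrow> ('r, 'n, 'd) module_scheme \<Rightarrow> ('m \<Rightarrow> 'n) set"
  where
  "linear_maps R M N = {f \<in> carrier M \<rightarrow> carrier N.
     (\<forall>x\<in>carrier M. \<forall>y\<in>carrier M. f (x \<oplus>\<^bsub>M\<^esub> y) = f x \<oplus>\<^bsub>N\<^esub> f y) \<and>
     (\<forall>a\<in>carrier R. \<forall>x\<in>carrier M. f (a \<odot>\<^bsub>M\<^esub> x) = a \<odot>\<^bsub>N\<^esub> f x)}"

text \<open>
  HOL cannot quantify over all modules inside a definition, so the type \<open>'m\<close> carrying the test
  modules \<open>M\<close> and \<open>N\<close> is a parameter. A theorem in which \<open>'m\<close> is a free type variable asserts the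
  lifting property for test modules on every type. (By Baer's criterion a single type into
  which the carrier of \<open>R\<close> embeds is already enough.)
\<close>

definition injective_module ::
  "'m itself \<Rightarrow> ('r, 'b) ring_scheme \<Rightarrow> ('r, 'e, 'c) module_scheme \<Rightarrow> bool" where
  "injective_module T R E \<longleftrightarrow>
     Module.module R E \<and>
     (\<forall>(M :: ('r, 'm) module) (N :: ('r, 'm) module). \<forall>\<iota>\<in>linear_maps R M N. \<forall>f\<in>linear_maps R M E.
        Module.module R M \<longrightarrow> Module.module R N \<longrightarrow> inj_on \<iota> (carrier M) \<longrightarrow>
        (\<exists>g\<in>linear_maps R N E. \<forall>x\<in>carrier M. g (\<iota> x) = f x))"

text \<open>An exact sequence \<open>0 \<rightarrow> M \<rightarrow> I 0 \<rightarrow> I 1 \<rightarrow> \<dots>\<close> with injective modules \<open>I i\<close>.\<close>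

definition injective_resolution ::
  "'m itself \<Rightarrow> ('r, 'b) ring_scheme \<Rightarrow> ('r, 'k, 'c) module_scheme \<Rightarrow>
   (nat \<Rightarrow> ('r, 'e) module) \<Rightarrow> ('k \<Rightarrow> 'e) \<Rightarrow> (nat \<Rightarrow> 'e \<Rightarrow> 'e) \<Rightarrow> bool" where
  "injective_resolution T R M I \<epsilon> d \<longleftrightarrow>
     (\<forall>i. injective_module T R (I i)) \<and>
     \<epsilon> \<in> linear_maps R M (I 0) \<and> inj_on \<epsilon> (carrier M) \<and>
     (\<forall>i. d i \<in> linear_maps R (I i) (I (Suc i))) \<and>
     \<epsilon> ` carrier M = a_kernel (I 0) (I 1) (d 0) \<and>
     (\<forall>i. d i ` carrier (I i) = a_kernel (I (Suc i)) (I (Suc (Suc i))) (d (Suc i)))"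

text \<open>
  Likewise the carrier type of the resolution has to be fixed. For noetherian \<open>R\<close> the terms of
  a minimal injective resolution of \<open>R\<close> have at most as many elements as \<open>R\<close> if \<open>R\<close> is infinite;
  if \<open>R\<close> is finite, it has finite injective dimension only if it is itself injective. So the type
  below is large enough for \<open>R\<close>; it directly accommodates quotients of modules of fractions.
\<close>

definition finite_self_injective_dimension :: "'m itself \<Rightarrow> ('r, 'b) ring_scheme \<Rightarrow> bool" where
  "finite_self_injective_dimension T R \<longleftrightarrow>
     (\<exists>(I :: nat \<Rightarrow> ('r, ('r \<times> 'r) set set) module) \<epsilon> d n.
        injective_resolution T R (self_module R) I \<epsilon> d \<and>
        (\<forall>i>n. carrier (I i) = {\<zero>\<^bsub>I i\<^esub>}))"

definition gorenstein_ring :: "'m itself \<Rightarrow> ('r, 'b) ring_scheme \<Rightarrow> bool" where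
  "gorenstein_ring T R \<longleftrightarrow>
     cring R \<and> noetherian_ring R \<and>
     (\<forall>\<mm>. maximalideal \<mm> R \<longrightarrow>
        finite_self_injective_dimension T (localization R (carrier R - \<mm>)))"


section \<open>The algebra \<open>K \<oplus> W t \<oplus> H t\<^sup>2 \<oplus> L t\<^sup>3 \<oplus> \<dots>\<close>\<close>

definition coeff_space :: "('a, 'b) ring_scheme \<Rightarrow> 'a set \<Rightarrow> 'a set \<Rightarrow> 'a set \<Rightarrow> nat \<Rightarrow> 'a set" where
  "coeff_space L K W H i =
     (if i = 0 then K else if i = 1 then W else if i = 2 then H else carrier L)"

definition KWH_algebra ::
  "('a, 'b) ring_scheme \<Rightarrow> 'a set \<Rightarrow> 'a set \<Rightarrow> 'a set \<Rightarrow> ('a, nat \<Rightarrow> 'a) up_ring" where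
  "KWH_algebra L K W H =
     (UP L)\<lparr>carrier := {p \<in> carrier (UP L). \<forall>i. coeff (UP L) p i \<in> coeff_space L K W H i}\<rparr>"

definition KWH_component ::
  "('a, 'b) ring_scheme \<Rightarrow> 'a set \<Rightarrow> 'a set \<Rightarrow> 'a set \<Rightarrow> nat \<Rightarrow> (nat \<Rightarrow> 'a) set" where
  "KWH_component L K W H i = (\<lambda>a. monom (UP L) a i) ` coeff_space L K W H i"

definition constants :: "('a, 'b) ring_scheme \<Rightarrow> 'a set \<Rightarrow> (nat \<Rightarrow> 'a) set" where
  "constants L K = (\<lambda>a. monom (UP L) a 0) ` K"

end

theory Submission
  imports Defs
begin

text \<open>
  Let \<open>\<phi>\<close> be a \<open>K\<close>-linear form on \<open>L\<close> with kernel \<open>H\<close>, and pair \<open>x\<close> and \<open>y\<close> through \<open>\<phi> (x y)\<close>. This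
  symmetric pairing is nondegenerate because \<open>L\<close> is a field. By choice of \<open>\<phi>\<close>, the orthogonal
  complement of \<open>K\<close> is \<open>H\<close>, so that of \<open>H\<close> is \<open>K\<close>; and \<open>W\<close>, being isotropic of dimension \<open>n/2\<close>, is its
  own complement. Thus the spaces \<open>K\<close>, \<open>W\<close>, \<open>H\<close> of coefficients in degrees 0, 1, 2 are exchanged by the
  duality that sends degree \<open>i\<close> to degree \<open>2 - i\<close>, while from degree 3 on all of \<open>L\<close> occurs, in accordance
  with the absence of negative degrees. This symmetry is what makes \<open>R\<close> Gorenstein.

  To exploit it, attach to each nonzero \<open>a\<close> in \<open>R\<close> the form that maps \<open>p\<close> to \<open>\<phi>\<close> of the coefficient of
  \<open>t\<^sup>2\<close> in the expansion of \<open>p/a\<close> in powers of \<open>1/t\<close>, which is also the coefficient of \<open>t\<^sup>2\<close> in the polynomial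
  quotient of \<open>p\<close> by \<open>a\<close>. It vanishes on \<open>aR\<close>, and by the symmetry it vanishes on \<open>Rp\<close> only
  if \<open>p\<close> lies in \<open>aR\<close> (\<open>residue_radical\<close>). So \<open>R/aR\<close>, which has finite dimension over \<open>K\<close>, is a Frobenius algebra and hence
  injective over itself (\<open>A_principal_quotients_self_injective\<close>). This property passes to
  localizations of a noetherian domain (\<open>localization_principal_quotients_self_injective\<close>). In a domain
  \<open>B\<close> with field of fractions \<open>Q\<close> it implies, by Baer's criterion, that \<open>Q/B\<close> is injective: a map from an
  ideal containing \<open>a\<close> to \<open>Q/B\<close> can be changed by a multiplication so that it kills \<open>a\<close>, and then it
  takes values in the copy of \<open>B/aB\<close> inside \<open>Q/B\<close>. As \<open>Q\<close> is injective as well, \<open>0 \<rightarrow> B \<rightarrow> Q \<rightarrow> Q/B \<rightarrow> 0\<close> is a finite injective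
  resolution (\<open>finite_self_injective_dimension_domain\<close>).

  The remaining assertions rest on division by \<open>a\<close>, which within \<open>R\<close> leaves remainders of
  degree less than \<open>deg a + 3\<close>. Every ideal containing \<open>a\<close> is therefore \<open>aR\<close> plus a space of finite
  dimension over \<open>K\<close>, so \<open>R\<close> is noetherian; and modulo \<open>a\<close> the powers of an element
  are linearly dependent, so nonzero primes are maximal. Finally, \<open>K\<close> being properly contained in \<open>W\<close>,
  some \<open>w\<close> in \<open>W\<close> is not orthogonal to \<open>H\<close>; hence \<open>W H\<close> spans \<open>L\<close>, the components of degree one and two generate
  \<open>L t\<^sup>3\<close>, and multiplication by \<open>t\<close> gives the rest.
\<close>

section \<open>Localization of a domain\<close>

text \<open>
  Over a domain, two fractions with denominators in S are equal as soon as they agree after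
  cross multiplication. So the localization embeds R, and its elements can be handled as honest
  fractions.
\<close>

locale domain_localization = domain R for R (structure) +
  fixes S
  assumes S_subset: "S \<subseteq> carrier R - {\<zero>}"
    and one_in_S: "\<one> \<in> S"
    and S_mult: "\<lbrakk>s \<in> S; u \<in> S\<rbrakk> \<Longrightarrow> s \<otimes> u \<in> S"
begin

abbreviation B where "B \<equiv> localization R S"
abbreviation times_B (infixl "*\<^sub>B" 70) where "x *\<^sub>B y \<equiv> x \<otimes>\<^bsub>B\<^esub> y"
abbreviation plus_B (infixl "+\<^sub>B" 65) where "x +\<^sub>B y \<equiv> x \<oplus>\<^bsub>B\<^esub> y"
abbreviation minus_B (infixl "-\<^sub>B" 65) where "x -\<^sub>B y \<equiv> x \<ominus>\<^bsub>B\<^esub> y"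
abbreviation frac where "frac \<equiv> loc_frac R S"
definition emb where "emb r = loc_frac R S r \<one>"

lemma S_carrier: "s \<in> S \<Longrightarrow> s \<in> carrier R"
  using S_subset by auto

lemma S_cancel:
  assumes "s \<in> S" "x \<in> carrier R" "y \<in> carrier R" "s \<otimes> x = s \<otimes> y"
  shows "x = y"
  using assms S_subset m_lcancel by auto

lemma loc_rel_iff:
  "((r, s), (r', s')) \<in> loc_rel R S \<longleftrightarrow>
     r \<in> carrier R \<and> s \<in> S \<and> r' \<in> carrier R \<and> s' \<in> S \<and> r \<otimes> s' = r' \<otimes> s"
proof -
  have "(\<exists>u\<in>S. u \<otimes> (r \<otimes> s' \<ominus> r' \<otimes> s) = \<zero>) \<longleftrightarrow> r \<otimes> s' = r' \<otimes> s"
    if c: "r \<in> carrier R" "s \<in> S" "r' \<in> carrier R" "s' \<in> S"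
  proof
    have m: "r \<otimes> s' \<in> carrier R" "r' \<otimes> s \<in> carrier R"
      using c S_carrier by auto
    assume "\<exists>u\<in>S. u \<otimes> (r \<otimes> s' \<ominus> r' \<otimes> s) = \<zero>"
    then obtain u where u: "u \<in> S" "u \<otimes> (r \<otimes> s' \<ominus> r' \<otimes> s) = \<zero>" by blast
    have "r \<otimes> s' \<ominus> r' \<otimes> s = \<zero>"
      using u m S_subset integral[of u "r \<otimes> s' \<ominus> r' \<otimes> s"] by auto
    then show "r \<otimes> s' = r' \<otimes> s"
      using m by simp
  next
    have m: "r \<otimes> s' \<in> carrier R" "r' \<otimes> s \<in> carrier R"
      using c S_carrier by auto
    assume "r \<otimes> s' = r' \<otimes> s"
    then have "\<one> \<otimes> (r \<otimes> s' \<ominus> r' \<otimes> s) = \<zero>" using m by (simp add: minus_eq r_neg)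
    then show "\<exists>u\<in>S. u \<otimes> (r \<otimes> s' \<ominus> r' \<otimes> s) = \<zero>" using one_in_S by blast
  qed
  then show ?thesis unfolding loc_rel_def by blast
qed

lemma equiv_loc_rel: "equiv (carrier R \<times> S) (loc_rel R S)"
proof (rule equivI)
  show "loc_rel R S \<subseteq> (carrier R \<times> S) \<times> (carrier R \<times> S)"
    unfolding loc_rel_def by auto
  show "refl_on (carrier R \<times> S) (loc_rel R S)"
    unfolding refl_on_def using loc_rel_iff by auto
  show "sym (loc_rel R S)"
    unfolding sym_def using loc_rel_iff by auto
  show "trans (loc_rel R S)"
  proof (rule transI, clarsimp simp: loc_rel_iff)
    fix a b c d e f
    assume a: "a \<in> carrier R" "b \<in> S" "c \<in> carrier R" "d \<in> S" "a \<otimes> d = c \<otimes> b"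
      "e \<in> carrier R" "f \<in> S" "c \<otimes> f = e \<otimes> d"
    have c: "b \<in> carrier R" "d \<in> carrier R" "f \<in> carrier R" using a S_carrier by auto
    have "d \<otimes> (a \<otimes> f) = (a \<otimes> d) \<otimes> f" using a(1-4,6,7) c by algebra
    also have "\<dots> = (c \<otimes> f) \<otimes> b" unfolding a(5) using a(1-4,6,7) c by algebra
    also have "\<dots> = d \<otimes> (e \<otimes> b)" unfolding a(8) using a(1-4,6,7) c by algebra
    finally show "a \<otimes> f = e \<otimes> b" 
      by (rule S_cancel[OF a(4), rotated -1]) (use a(1,6) c in simp_all)
  qed
qed

lemma mem_frac_iff:
  assumes "r \<in> carrier R" "s \<in> S"
  shows "(r', s') \<in> frac r s \<longleftrightarrow> r' \<in> carrier R \<and> s' \<in> S \<and> r \<otimes> s' = r' \<otimes> s"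
  unfolding loc_frac_def using loc_rel_iff assms by auto

lemma frac_eq_iff:
  assumes "r \<in> carrier R" "s \<in> S" "r' \<in> carrier R" "s' \<in> S"
  shows "frac r s = frac r' s' \<longleftrightarrow> r \<otimes> s' = r' \<otimes> s"
  unfolding loc_frac_def using eq_equiv_class_iff[OF equiv_loc_rel, of "(r,s)" "(r',s')"]
    loc_rel_iff assms by auto

lemma carrier_localization: "carrier B = {frac r s | r s. r \<in> carrier R \<and> s \<in> S}"
  unfolding localization_def loc_frac_def by (auto simp: quotient_def)

lemma frac_closed: "\<lbrakk>r \<in> carrier R; s \<in> S\<rbrakk> \<Longrightarrow> frac r s \<in> carrier B"
  using carrier_localization by auto

text \<open>
  The operations of the localization are unions over all representatives of the two classes.
  Once the expression does not depend on the representatives, such a union collapses to a single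
  value.
\<close>

lemma frac_const_Union:
  assumes "r \<in> carrier R" "s \<in> S" "r' \<in> carrier R" "s' \<in> S"
    and "\<And>a b a' b'. \<lbrakk>a \<in> carrier R; b \<in> S; a' \<in> carrier R; b' \<in> S;
      r \<otimes> b = a \<otimes> s; r' \<otimes> b' = a' \<otimes> s'\<rbrakk> \<Longrightarrow> F (a, b) (a', b') = C"
  shows "(\<Union>x\<in>frac r s. \<Union>y\<in>frac r' s'. F x y) = C"
proof -
  have "F x y = C" if "x \<in> frac r s" "y \<in> frac r' s'" for x y
  proof -
    obtain a b a' b' where "x = (a, b)" "y = (a', b')" by (metis surj_pair)
    then show ?thesis using that assms(5) mem_frac_iff assms(1-4) by simp
  qed
  moreover have "(r, s) \<in> frac r s" "(r', s') \<in> frac r' s'"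
    using mem_frac_iff assms by auto
  ultimately show ?thesis by blast
qed

lemma frac_mult:
  assumes "r \<in> carrier R" "s \<in> S" "r' \<in> carrier R" "s' \<in> S"
  shows "frac r s *\<^sub>B frac r' s' = frac (r \<otimes> r') (s \<otimes> s')"
  unfolding localization_def monoid.simps
proof (rule frac_const_Union[OF assms])
  fix a b a' b'
  assume h: "a \<in> carrier R" "b \<in> S" "a' \<in> carrier R" "b' \<in> S"
      "r \<otimes> b = a \<otimes> s" "r' \<otimes> b' = a' \<otimes> s'"
  have c: "b \<in> carrier R" "b' \<in> carrier R" "s \<in> carrier R" "s' \<in> carrier R"
    using h assms S_carrier by auto
  have "(a \<otimes> a') \<otimes> (s \<otimes> s') = (a \<otimes> s) \<otimes> (a' \<otimes> s')" using assms h(1-4) c by algebra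
  also have "\<dots> = (r \<otimes> r') \<otimes> (b \<otimes> b')" unfolding h(5,6)[symmetric] using assms h(1-4) c by algebra
  finally show "frac (fst (a, b) \<otimes> fst (a', b')) (snd (a, b) \<otimes> snd (a', b'))
      = frac (r \<otimes> r') (s \<otimes> s')"
    using frac_eq_iff h assms S_mult by auto
qed

lemma frac_add:
  assumes "r \<in> carrier R" "s \<in> S" "r' \<in> carrier R" "s' \<in> S"
  shows "frac r s +\<^sub>B frac r' s' = frac (r \<otimes> s' \<oplus> r' \<otimes> s) (s \<otimes> s')"
  unfolding localization_def ring.simps
proof (rule frac_const_Union[OF assms])
  fix a b a' b'
  assume h: "a \<in> carrier R" "b \<in> S" "a' \<in> carrier R" "b' \<in> S"
      "r \<otimes> b = a \<otimes> s" "r' \<otimes> b' = a' \<otimes> s'"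
  have c: "b \<in> carrier R" "b' \<in> carrier R" "s \<in> carrier R" "s' \<in> carrier R"
    using h assms S_carrier by auto
  have "(a \<otimes> b' \<oplus> a' \<otimes> b) \<otimes> (s \<otimes> s') = (a \<otimes> s) \<otimes> (b' \<otimes> s') \<oplus> (a' \<otimes> s') \<otimes> (b \<otimes> s)"
    using assms h(1-4) c by algebra
  also have "\<dots> = (r \<otimes> s' \<oplus> r' \<otimes> s) \<otimes> (b \<otimes> b')"
    unfolding h(5,6)[symmetric] using assms h(1-4) c by algebra
  finally show "frac (fst (a, b) \<otimes> snd (a', b') \<oplus> fst (a', b') \<otimes> snd (a, b)) (snd (a, b) \<otimes> snd (a', b'))
      = frac (r \<otimes> s' \<oplus> r' \<otimes> s) (s \<otimes> s')"
    using frac_eq_iff h assms S_mult S_carrier by auto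
qed

lemma one_localization: "\<one>\<^bsub>B\<^esub> = frac \<one> \<one>"
  and zero_localization: "\<zero>\<^bsub>B\<^esub> = frac \<zero> \<one>"
  unfolding localization_def by simp_all

lemma frac_eq_zero_iff:
  assumes "r \<in> carrier R" "s \<in> S"
  shows "frac r s = \<zero>\<^bsub>B\<^esub> \<longleftrightarrow> r = \<zero>"
  unfolding zero_localization using frac_eq_iff[OF assms zero_closed one_in_S] assms S_carrier by auto

lemma localization_cases:
  assumes "x \<in> carrier B"
  obtains r s where "r \<in> carrier R" "s \<in> S" "s \<in> carrier R" "x = frac r s"
  using assms carrier_localization S_carrier by auto

lemma localization_is_domain: "domain B"
proof (rule domainI)
  show "cring B"
  proof (rule cringI)
    show "abelian_group B"
    proof (rule abelian_groupI)
      fix x y assume xy: "x \<in> carrier B" "y \<in> carrier B"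
      from xy obtain r s where x: "r \<in> carrier R" "s \<in> S" "s \<in> carrier R" "x = frac r s"
        by (metis localization_cases)
      from xy obtain r' s' where y: "r' \<in> carrier R" "s' \<in> S" "s' \<in> carrier R" "y = frac r' s'"
        by (metis localization_cases)
      show "x +\<^sub>B y \<in> carrier B"
        using x y frac_add frac_closed S_mult by simp
      show "x +\<^sub>B y = y +\<^sub>B x"
        using x y frac_add by (simp add: m_comm a_comm)
      fix z assume "z \<in> carrier B"
      then obtain r'' s'' where z: "r'' \<in> carrier R" "s'' \<in> S" "s'' \<in> carrier R" "z = frac r'' s''"
        by (metis localization_cases)
      have "(r \<otimes> s' \<oplus> r' \<otimes> s) \<otimes> s'' \<oplus> r'' \<otimes> (s \<otimes> s') = r \<otimes> (s' \<otimes> s'') \<oplus> (r' \<otimes> s'' \<oplus> r'' \<otimes> s') \<otimes> s"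
        using x(1-3) y(1-3) z(1-3) by algebra
      then show "x +\<^sub>B y +\<^sub>B z = x +\<^sub>B (y +\<^sub>B z)"
        using x y z frac_add S_mult by (simp add: m_assoc)
    next
      show "\<zero>\<^bsub>B\<^esub> \<in> carrier B"
        using zero_localization frac_closed one_in_S by simp
      fix x assume "x \<in> carrier B"
      then obtain r s where x: "r \<in> carrier R" "s \<in> S" "s \<in> carrier R" "x = frac r s"
        by (metis localization_cases)
      show "\<zero>\<^bsub>B\<^esub> +\<^sub>B x = x"
        unfolding zero_localization x using x frac_add one_in_S by simp
      have "(\<ominus> r) \<otimes> s \<oplus> r \<otimes> s = \<zero>" using x(1-3) by algebra
      then have "frac (\<ominus> r) s +\<^sub>B x = \<zero>\<^bsub>B\<^esub>"
        using x frac_add frac_eq_zero_iff S_mult by simp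
      then show "\<exists>y\<in>carrier B. y +\<^sub>B x = \<zero>\<^bsub>B\<^esub>"
        by (rule bexI) (rule frac_closed, use x in simp_all)
    qed
    show "Group.comm_monoid B"
    proof (rule comm_monoidI)
      fix x y assume xy: "x \<in> carrier B" "y \<in> carrier B"
      from xy obtain r s where x: "r \<in> carrier R" "s \<in> S" "s \<in> carrier R" "x = frac r s"
        by (metis localization_cases)
      from xy obtain r' s' where y: "r' \<in> carrier R" "s' \<in> S" "s' \<in> carrier R" "y = frac r' s'"
        by (metis localization_cases)
      show "x *\<^sub>B y \<in> carrier B"
        using x y frac_mult frac_closed S_mult by simp
      show "x *\<^sub>B y = y *\<^sub>B x"
        using x y frac_mult by (simp add: m_comm)
      fix z assume "z \<in> carrier B"
      then obtain r'' s'' where z: "r'' \<in> carrier R" "s'' \<in> S" "s'' \<in> carrier R" "z = frac r'' s''"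
        by (metis localization_cases)
      show "x *\<^sub>B y *\<^sub>B z = x *\<^sub>B (y *\<^sub>B z)"
        using x y z frac_mult S_mult by (simp add: m_assoc)
    next
      show "\<one>\<^bsub>B\<^esub> \<in> carrier B"
        using one_localization frac_closed one_in_S by simp
      fix x assume "x \<in> carrier B"
      then obtain r s where x: "r \<in> carrier R" "s \<in> S" "s \<in> carrier R" "x = frac r s"
        by (metis localization_cases)
      then show "\<one>\<^bsub>B\<^esub> *\<^sub>B x = x"
        unfolding one_localization x using x frac_mult one_in_S by simp
    qed
    fix x y z assume xy: "x \<in> carrier B" "y \<in> carrier B" "z \<in> carrier B"
    from xy obtain r s where x: "r \<in> carrier R" "s \<in> S" "s \<in> carrier R" "x = frac r s"
      by (metis localization_cases)
    from xy obtain r' s' where y: "r' \<in> carrier R" "s' \<in> S" "s' \<in> carrier R" "y = frac r' s'"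
      by (metis localization_cases)
    from xy obtain r'' s'' where z: "r'' \<in> carrier R" "s'' \<in> S" "s'' \<in> carrier R" "z = frac r'' s''"
      by (metis localization_cases)
    have "(r \<otimes> s' \<oplus> r' \<otimes> s) \<otimes> r'' \<otimes> (s \<otimes> s'' \<otimes> (s' \<otimes> s''))
        = (r \<otimes> r'' \<otimes> (s' \<otimes> s'') \<oplus> r' \<otimes> r'' \<otimes> (s \<otimes> s'')) \<otimes> (s \<otimes> s' \<otimes> s'')"
      using x(1-3) y(1-3) z(1-3) by algebra
    then show "(x +\<^sub>B y) *\<^sub>B z = x *\<^sub>B z +\<^sub>B y *\<^sub>B z"
      using x y z frac_add frac_mult frac_eq_iff S_mult by simp
  qed
  show "\<one>\<^bsub>B\<^esub> \<noteq> \<zero>\<^bsub>B\<^esub>"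
    unfolding one_localization using frac_eq_zero_iff one_in_S by simp
  fix x y assume xy: "x *\<^sub>B y = \<zero>\<^bsub>B\<^esub>" "x \<in> carrier B" "y \<in> carrier B"
  from xy obtain r s where x: "r \<in> carrier R" "s \<in> S" "s \<in> carrier R" "x = frac r s"
    by (metis localization_cases)
  from xy obtain r' s' where y: "r' \<in> carrier R" "s' \<in> S" "s' \<in> carrier R" "y = frac r' s'"
    by (metis localization_cases)
  have "r \<otimes> r' = \<zero>"
    using xy(1) x y frac_mult frac_eq_zero_iff S_mult by simp
  then show "x = \<zero>\<^bsub>B\<^esub> \<or> y = \<zero>\<^bsub>B\<^esub>"
    using integral[of r r'] x y frac_eq_zero_iff by auto
qed

lemma emb_closed: "r \<in> carrier R \<Longrightarrow> emb r \<in> carrier B"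
  unfolding emb_def using frac_closed one_in_S by simp

lemma emb_hom: "emb \<in> ring_hom R B"
proof (rule ring_hom_memI)
  fix x y assume "x \<in> carrier R" "y \<in> carrier R"
  then show "emb (x \<otimes> y) = emb x *\<^sub>B emb y" "emb (x \<oplus> y) = emb x +\<^sub>B emb y"
    unfolding emb_def using frac_mult frac_add one_in_S by simp_all
qed (simp_all add: emb_closed, simp add: emb_def one_localization)

lemma emb_ring_hom_cring: "ring_hom_cring R B emb"
  using emb_hom localization_is_domain is_cring
  by (simp add: domain_def ring_hom_cringI)

lemma emb_eq_iff: "\<lbrakk>r \<in> carrier R; r' \<in> carrier R\<rbrakk> \<Longrightarrow> emb r = emb r' \<longleftrightarrow> r = r'"
  unfolding emb_def using frac_eq_iff one_in_S by simp

lemma emb_Units: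
  assumes "s \<in> S" shows "emb s \<in> Units B"
proof -
  interpret B: domain B by (rule localization_is_domain)
  have c: "emb s \<in> carrier B" "frac \<one> s \<in> carrier B"
    using assms S_carrier frac_closed emb_closed by auto
  have "frac (\<one> \<otimes> s) (s \<otimes> \<one>) = frac \<one> \<one>"
    by (subst frac_eq_iff) (use assms S_carrier one_in_S in auto)
  then have "frac \<one> s *\<^sub>B emb s = \<one>\<^bsub>B\<^esub>"
    unfolding emb_def one_localization
    using assms S_carrier frac_mult one_in_S by simp
  then show ?thesis
    using c B.m_comm[OF c] unfolding Units_def by blast
qed

text \<open>
  This is the form in which elements of the localization are used: every one becomes an
  element of R after multiplication by some s in S, and emb s is a unit.
\<close>

lemma clear_denominator:
  assumes "x \<in> carrier B"
  obtains s r where "s \<in> S" "r \<in> carrier R" "emb s *\<^sub>B x = emb r"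
proof -
  obtain r s where x: "r \<in> carrier R" "s \<in> S" "s \<in> carrier R" "x = frac r s"
    using assms by (metis localization_cases)
  have "emb s *\<^sub>B x = emb r"
    unfolding emb_def x(4) using x frac_mult frac_eq_iff one_in_S by (simp add: m_comm)
  then show thesis using that x by blast
qed

end

section \<open>Self-injectivity of principal quotients and its localization\<close>

text \<open>
  The map h lifts an R-linear map from I/aR to R/aR: it is additive and homogeneous only up to
  multiples of a, and it sends a to zero modulo a. The condition says that every such map is
  multiplication by an element c, that is, by Baer's criterion, that the ring R/aR is injective over
  itself for all nonzero a. It is phrased with representatives to avoid passing to quotient rings.
\<close>

definition principal_quotients_self_injective :: "('a, 'b) ring_scheme \<Rightarrow> bool" where
  "principal_quotients_self_injective R \<longleftrightarrow>
     (\<forall>I a h. ideal I R \<longrightarrow> a \<in> I \<longrightarrow> a \<noteq> \<zero>\<^bsub>R\<^esub> \<longrightarrow> h \<in> I \<rightarrow> carrier R \<longrightarrow>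
        (\<forall>x\<in>I. \<forall>y\<in>I. h (x \<oplus>\<^bsub>R\<^esub> y) \<ominus>\<^bsub>R\<^esub> (h x \<oplus>\<^bsub>R\<^esub> h y) \<in> PIdl\<^bsub>R\<^esub> a) \<longrightarrow>
        (\<forall>r\<in>carrier R. \<forall>x\<in>I. h (r \<otimes>\<^bsub>R\<^esub> x) \<ominus>\<^bsub>R\<^esub> r \<otimes>\<^bsub>R\<^esub> h x \<in> PIdl\<^bsub>R\<^esub> a) \<longrightarrow>
        h a \<in> PIdl\<^bsub>R\<^esub> a \<longrightarrow>
        (\<exists>c\<in>carrier R. \<forall>x\<in>I. h x \<ominus>\<^bsub>R\<^esub> c \<otimes>\<^bsub>R\<^esub> x \<in> PIdl\<^bsub>R\<^esub> a))"

context domain_localization begin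

lemma clear_denominators:
  assumes "finite X" "X \<subseteq> carrier B"
  shows "\<exists>s\<in>S. \<forall>x\<in>X. \<exists>r\<in>carrier R. emb s *\<^sub>B x = emb r"
  using assms
proof (induction X rule: finite_induct)
  case empty
  then show ?case using one_in_S by auto
next
  case (insert x X)
  interpret e: ring_hom_cring R B emb by (rule emb_ring_hom_cring)
  obtain s where s: "s \<in> S" "\<forall>x\<in>X. \<exists>r\<in>carrier R. emb s *\<^sub>B x = emb r"
    using insert by auto
  obtain t r where t: "t \<in> S" "r \<in> carrier R" "emb t *\<^sub>B x = emb r"
    using insert.prems clear_denominator by blast
  have c: "s \<in> carrier R" "t \<in> carrier R" using s t S_carrier by auto
  have "\<exists>r\<in>carrier R. emb (s \<otimes> t) *\<^sub>B y = emb r" if y: "y \<in> insert x X" for y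
  proof (cases "y = x")
    case True
    have "emb (s \<otimes> t) *\<^sub>B x = emb (s \<otimes> r)"
      using c t insert.prems by (simp add: e.S.m_assoc)
    then show ?thesis using True c t by blast
  next
    case False
    then obtain r' where r': "r' \<in> carrier R" "emb s *\<^sub>B y = emb r'" using s y by auto
    have "y \<in> carrier B" using y insert.prems by auto
    then have "emb (s \<otimes> t) *\<^sub>B y = emb t *\<^sub>B (emb s *\<^sub>B y)"
      using c by (simp add: e.S.m_ac)
    then have "emb (s \<otimes> t) *\<^sub>B y = emb (t \<otimes> r')"
      using c r' by simp
    then show ?thesis using c r' by blast
  qed
  then show ?case using S_mult[OF s(1) t(1)] by blast
qed

lemma cgenideal_Units_cancel:
  assumes "a \<in> carrier B" "u \<in> Units B" "x \<in> carrier B" "u *\<^sub>B x \<in> PIdl\<^bsub>B\<^esub> a"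
  shows "x \<in> PIdl\<^bsub>B\<^esub> a"
proof -
  interpret B: domain B by (rule localization_is_domain)
  interpret I: ideal "PIdl\<^bsub>B\<^esub> a" B by (rule B.cgenideal_ideal[OF assms(1)])
  have "inv\<^bsub>B\<^esub> u *\<^sub>B (u *\<^sub>B x) = x"
    using assms by (metis B.Units_closed B.Units_inv_closed B.Units_l_inv B.l_one B.m_assoc)
  then show ?thesis using I.I_l_closed[OF assms(4), of "inv\<^bsub>B\<^esub> u"] assms by simp
qed

lemma contraction_ideal:
  assumes "ideal J B"
  shows "ideal {x \<in> carrier R. emb x \<in> J} R"
proof -
  interpret e: ring_hom_cring R B emb by (rule emb_ring_hom_cring)
  interpret J: ideal J B by fact
  show ?thesis
  proof (rule idealI)
    show "subgroup {x \<in> carrier R. emb x \<in> J} (add_monoid R)"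
      by (rule add.subgroupI) (auto simp: a_inv_def[symmetric] intro!: exI[of _ \<zero>])
  qed (auto intro: J.I_l_closed J.I_r_closed ring_axioms)
qed

text \<open>
  The elements of R that become multiples of a in the localization form an ideal. Each one is
  moved into aR by an element of S; since the ideal is finitely generated, one element of S serves
  for all of them.
\<close>

lemma uniform_torsion:
  assumes "noetherian_ring R" "\<alpha> \<in> carrier R"
  shows "\<exists>s\<in>S. \<forall>r\<in>carrier R. emb r \<in> PIdl\<^bsub>B\<^esub> (emb \<alpha>) \<longrightarrow> s \<otimes> r \<in> PIdl \<alpha>"
proof -
  interpret e: ring_hom_cring R B emb by (rule emb_ring_hom_cring)
  interpret N: noetherian_ring R by fact
  interpret A: ideal "PIdl \<alpha>" R by (rule cgenideal_ideal[OF assms(2)])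
  define M where "M = {r \<in> carrier R. emb r \<in> PIdl\<^bsub>B\<^esub> (emb \<alpha>)}"
  have M: "ideal M R"
    unfolding M_def using contraction_ideal e.S.cgenideal_ideal emb_closed assms(2) by blast
  then obtain G where G: "G \<subseteq> carrier R" "finite G" "M = Idl G" using N.finetely_gen by blast
  have single: "\<exists>s\<in>S. s \<otimes> r \<in> PIdl \<alpha>" if r: "r \<in> M" for r
  proof -
    obtain b where b: "b \<in> carrier B" "emb r = b *\<^sub>B emb \<alpha>"
      using r unfolding M_def cgenideal_def by auto
    obtain s c where s: "s \<in> S" "c \<in> carrier R" "emb s *\<^sub>B b = emb c"
      using clear_denominator[OF b(1)] .
    have c: "s \<in> carrier R" "r \<in> carrier R" using s S_carrier r M_def by auto
    have "emb (s \<otimes> r) = (emb s *\<^sub>B b) *\<^sub>B emb \<alpha>"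
      using b c assms(2) by (simp add: e.S.m_assoc)
    then have "emb (s \<otimes> r) = emb (c \<otimes> \<alpha>)" using s assms(2) by simp
    then have "s \<otimes> r = c \<otimes> \<alpha>" using emb_eq_iff[of "s \<otimes> r" "c \<otimes> \<alpha>"] c s assms(2) by blast
    then show ?thesis using s unfolding cgenideal_def by auto
  qed
  have "\<exists>s\<in>S. \<forall>r\<in>F. s \<otimes> r \<in> PIdl \<alpha>" if "finite F" "F \<subseteq> M" for F
    using that
  proof (induction F rule: finite_induct)
    case empty
    then show ?case using one_in_S by auto
  next
    case (insert r F)
    obtain s where s: "s \<in> S" "\<forall>r\<in>F. s \<otimes> r \<in> PIdl \<alpha>" using insert by auto
    obtain t where t: "t \<in> S" "t \<otimes> r \<in> PIdl \<alpha>" using single[of r] insert.prems by auto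
    have c: "s \<in> carrier R" "t \<in> carrier R" using s t S_carrier by auto
    have "(s \<otimes> t) \<otimes> x \<in> PIdl \<alpha>" if x: "x \<in> insert r F" for x
    proof -
      have xc: "x \<in> carrier R" using x insert.prems M_def by auto
      show ?thesis
      proof (cases "x = r")
        case True
        then show ?thesis using A.I_l_closed[OF t(2) c(1)] c xc by (simp add: m_assoc)
      next
        case False
        then have "s \<otimes> x \<in> PIdl \<alpha>" using s x by auto
        then have "t \<otimes> (s \<otimes> x) \<in> PIdl \<alpha>" using A.I_l_closed c by blast
        then show ?thesis using c xc by (simp add: m_ac)
      qed
    qed
    then show ?case using S_mult[OF s(1) t(1)] by blast
  qed
  then obtain s where s: "s \<in> S" "\<forall>r\<in>G. s \<otimes> r \<in> PIdl \<alpha>"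
    using G genideal_self by blast
  have sc: "s \<in> carrier R" using s S_carrier by auto
  have "ideal {r \<in> carrier R. s \<otimes> r \<in> PIdl \<alpha>} R"
  proof (rule idealI)
    show "subgroup {r \<in> carrier R. s \<otimes> r \<in> PIdl \<alpha>} (add_monoid R)"
      by (rule add.subgroupI)
        (use sc in \<open>auto simp: a_inv_def[symmetric] r_minus r_distr intro!: exI[of _ \<zero>]\<close>)
  next
    fix a x assume "a \<in> {r \<in> carrier R. s \<otimes> r \<in> PIdl \<alpha>}" and x: "x \<in> carrier R"
    then have a: "a \<in> carrier R" "x \<otimes> (s \<otimes> a) \<in> PIdl \<alpha>" using A.I_l_closed by auto
    then show "x \<otimes> a \<in> {r \<in> carrier R. s \<otimes> r \<in> PIdl \<alpha>}" "a \<otimes> x \<in> {r \<in> carrier R. s \<otimes> r \<in> PIdl \<alpha>}"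
      using x sc by (simp_all add: m_ac)
  qed (rule ring_axioms)
  then have "M \<subseteq> {r \<in> carrier R. s \<otimes> r \<in> PIdl \<alpha>}"
    unfolding G(3) using genideal_minimal s(2) G(1) by blast
  then show ?thesis using s(1) M_def by blast
qed

text \<open>
  Localization of an injective module over a noetherian ring, made explicit. Given h on an ideal
  J of the localization, one may take a from R. As the contraction I of J is finitely generated, a
  common denominator t makes t h congruent to elements of R on all of I, and these elements are
  unique up to torsion, which a second element s of S removes. So s t h induces a map on I to which
  the hypothesis on R applies; the multiplier c found there is divided by s t.
\<close>

lemma localization_principal_quotients_self_injective:
  assumes noeth: "noetherian_ring R" and inj: "principal_quotients_self_injective R"
  shows "principal_quotients_self_injective B"
  unfolding principal_quotients_self_injective_def
proof (intro allI impI)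
  interpret B: domain B by (rule localization_is_domain)
  interpret e: ring_hom_cring R B emb by (rule emb_ring_hom_cring)
  interpret N: noetherian_ring R by fact
  fix J a h
  assume J: "ideal J B" and aJ: "a \<in> J" and a0: "a \<noteq> \<zero>\<^bsub>B\<^esub>" and h: "h \<in> J \<rightarrow> carrier B"
    and hadd: "\<forall>x\<in>J. \<forall>y\<in>J. h (x +\<^sub>B y) -\<^sub>B (h x +\<^sub>B h y) \<in> PIdl\<^bsub>B\<^esub> a"
    and hmult: "\<forall>r\<in>carrier B. \<forall>x\<in>J. h (r *\<^sub>B x) -\<^sub>B r *\<^sub>B h x \<in> PIdl\<^bsub>B\<^esub> a"
    and ha: "h a \<in> PIdl\<^bsub>B\<^esub> a"
  interpret J: ideal J B by (rule J)
  have ac: "a \<in> carrier B" using aJ J.a_subset by blast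
  interpret P: ideal "PIdl\<^bsub>B\<^esub> a" B by (rule B.cgenideal_ideal[OF ac])
  have hc: "h x \<in> carrier B" if "x \<in> J" for x using h that by auto
  have Jc: "x \<in> carrier B" if "x \<in> J" for x using J.a_subset that by blast
  \<comment> \<open>The generator a may be replaced by an associate that comes from R.\<close>
  obtain \<sigma> \<alpha> where \<sigma>: "\<sigma> \<in> S" "\<alpha> \<in> carrier R" "emb \<sigma> *\<^sub>B a = emb \<alpha>"
    using clear_denominator[OF ac] .
  have \<sigma>c: "\<sigma> \<in> carrier R" using \<sigma> S_carrier by auto
  have eu: "emb s \<in> Units B" "emb s \<in> carrier B" if "s \<in> S" for s
    using emb_Units[OF that] B.Units_closed by auto
  have \<alpha>0: "\<alpha> \<noteq> \<zero>"
  proof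
    assume "\<alpha> = \<zero>"
    then have "emb \<sigma> *\<^sub>B a = \<zero>\<^bsub>B\<^esub>" using \<sigma> by simp
    then have "emb \<sigma> = \<zero>\<^bsub>B\<^esub>" using a0 B.integral[of "emb \<sigma>" a] eu \<sigma> ac by blast
    then show False using frac_eq_zero_iff[of \<sigma> \<one>] \<sigma> \<sigma>c one_in_S S_subset unfolding emb_def by auto
  qed
  have Pa: "PIdl\<^bsub>B\<^esub> (emb \<alpha>) = PIdl\<^bsub>B\<^esub> a"
  proof
    show "PIdl\<^bsub>B\<^esub> (emb \<alpha>) \<subseteq> PIdl\<^bsub>B\<^esub> a"
      using B.cgenideal_minimal[OF P.ideal_axioms] P.I_l_closed[OF B.cgenideal_self[OF ac], of "emb \<sigma>"] \<sigma> \<sigma>c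
      by simp
    have "a \<in> PIdl\<^bsub>B\<^esub> (emb \<alpha>)"
      using cgenideal_Units_cancel[of "emb \<alpha>" "emb \<sigma>" a] eu \<sigma> ac B.cgenideal_self by simp
    then show "PIdl\<^bsub>B\<^esub> a \<subseteq> PIdl\<^bsub>B\<^esub> (emb \<alpha>)"
      using B.cgenideal_minimal B.cgenideal_ideal \<sigma>(2) emb_closed by blast
  qed
  define I where "I = {x \<in> carrier R. emb x \<in> J}"
  have I: "ideal I R" unfolding I_def by (rule contraction_ideal[OF J])
  interpret I: ideal I R by (rule I)
  obtain s where s: "s \<in> S" "\<forall>r\<in>carrier R. emb r \<in> PIdl\<^bsub>B\<^esub> a \<longrightarrow> s \<otimes> r \<in> PIdl \<alpha>"
    using uniform_torsion[OF noeth \<sigma>(2)] Pa by auto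
  have sc: "s \<in> carrier R" using s S_carrier by auto
  obtain G where G: "G \<subseteq> carrier R" "finite G" "I = Idl G" using N.finetely_gen[OF I] by blast
  have GI: "G \<subseteq> I" using G genideal_self by simp
  have "(\<lambda>x. h (emb x)) ` G \<subseteq> carrier B"
    using GI hc unfolding I_def by blast
  then obtain t where t: "t \<in> S"
    "\<forall>y\<in>(\<lambda>x. h (emb x)) ` G. \<exists>r\<in>carrier R. emb t *\<^sub>B y = emb r"
    using clear_denominators[OF finite_imageI[OF G(2)]] by blast
  have tc: "t \<in> carrier R" using t S_carrier by auto
  have et: "emb t \<in> carrier B" using tc by simp
  define et' where "et' = emb t"
  have et': "et' \<in> carrier B" using et et'_def by simp
  have Ic: "x \<in> carrier R" "emb x \<in> J" "emb x \<in> carrier B" if "x \<in> I" for x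
    using that Jc unfolding I_def by blast+
  define rel where
    "rel x r \<longleftrightarrow> x \<in> I \<and> r \<in> carrier R \<and> et' *\<^sub>B h (emb x) -\<^sub>B emb r \<in> PIdl\<^bsub>B\<^esub> a" for x r
  have rel_mult: "rel (u \<otimes> x) (u \<otimes> r)" if u: "u \<in> carrier R" and x: "rel x r" for u x r
  proof -
    have r: "x \<in> I" "r \<in> carrier R" "et' *\<^sub>B h (emb x) -\<^sub>B emb r \<in> PIdl\<^bsub>B\<^esub> a"
      using x unfolding rel_def by auto
    have uxI: "u \<otimes> x \<in> I" using I.I_l_closed r(1) u by blast
    obtain v er hx hux where d: "v = emb u" "er = emb r" "hx = h (emb x)" "hux = h (emb u *\<^sub>B emb x)"
      by blast
    have c: "v \<in> carrier B" "er \<in> carrier B" "hx \<in> carrier B" "hux \<in> carrier B"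
      unfolding d using u r hc Ic[OF r(1)] J.I_l_closed emb_closed by auto
    have e1: "hux -\<^sub>B v *\<^sub>B hx \<in> PIdl\<^bsub>B\<^esub> a"
      unfolding d using hmult u Ic(2)[OF r(1)] emb_closed by blast
    have e2: "et' *\<^sub>B hx -\<^sub>B er \<in> PIdl\<^bsub>B\<^esub> a"
      unfolding d by (rule r(3))
    have "et' *\<^sub>B (hux -\<^sub>B v *\<^sub>B hx) +\<^sub>B v *\<^sub>B (et' *\<^sub>B hx -\<^sub>B er) \<in> PIdl\<^bsub>B\<^esub> a"
      by (rule P.a_closed[OF P.I_l_closed[OF e1 et'] P.I_l_closed[OF e2 c(1)]])
    moreover have "et' *\<^sub>B (hux -\<^sub>B v *\<^sub>B hx) +\<^sub>B v *\<^sub>B (et' *\<^sub>B hx -\<^sub>B er) = et' *\<^sub>B hux -\<^sub>B v *\<^sub>B er"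
      using c et' by algebra
    ultimately have "et' *\<^sub>B h (emb (u \<otimes> x)) -\<^sub>B emb (u \<otimes> r) \<in> PIdl\<^bsub>B\<^esub> a"
      using u Ic[OF r(1)] r(2) unfolding d by simp
    then show ?thesis unfolding rel_def using uxI u r by blast
  qed
  have rel_add: "rel (x \<oplus> y) (r \<oplus> q)" if x: "rel x r" and y: "rel y q" for x y r q
  proof -
    have r: "x \<in> I" "r \<in> carrier R" "et' *\<^sub>B h (emb x) -\<^sub>B emb r \<in> PIdl\<^bsub>B\<^esub> a"
      using x unfolding rel_def by auto
    have q: "y \<in> I" "q \<in> carrier R" "et' *\<^sub>B h (emb y) -\<^sub>B emb q \<in> PIdl\<^bsub>B\<^esub> a"
      using y unfolding rel_def by auto
    obtain hx hy hxy er eq where d: "hx = h (emb x)" "hy = h (emb y)" "hxy = h (emb x +\<^sub>B emb y)"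
      "er = emb r" "eq = emb q" by blast
    have c: "hx \<in> carrier B" "hy \<in> carrier B" "hxy \<in> carrier B" "er \<in> carrier B" "eq \<in> carrier B"
      unfolding d using Ic r q hc J.a_closed emb_closed by auto
    have e0: "hxy -\<^sub>B (hx +\<^sub>B hy) \<in> PIdl\<^bsub>B\<^esub> a"
      unfolding d by (rule hadd[rule_format, OF Ic(2)[OF r(1)] Ic(2)[OF q(1)]])
    have "et' *\<^sub>B (hxy -\<^sub>B (hx +\<^sub>B hy)) +\<^sub>B ((et' *\<^sub>B hx -\<^sub>B er) +\<^sub>B (et' *\<^sub>B hy -\<^sub>B eq)) \<in> PIdl\<^bsub>B\<^esub> a"
      using P.a_closed[OF P.I_l_closed[OF e0 et'] P.a_closed[OF r(3) q(3)]] unfolding d .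
    moreover have "et' *\<^sub>B (hxy -\<^sub>B (hx +\<^sub>B hy)) +\<^sub>B ((et' *\<^sub>B hx -\<^sub>B er) +\<^sub>B (et' *\<^sub>B hy -\<^sub>B eq))
        = et' *\<^sub>B hxy -\<^sub>B (er +\<^sub>B eq)"
      using c et' by algebra
    ultimately have "et' *\<^sub>B h (emb (x \<oplus> y)) -\<^sub>B emb (r \<oplus> q) \<in> PIdl\<^bsub>B\<^esub> a"
      using Ic r q unfolding d by simp
    then show ?thesis unfolding rel_def using r q I.a_closed by blast
  qed
  have rel_unique: "s \<otimes> (r \<ominus> q) \<in> PIdl \<alpha>" if "rel x r" "rel x q" for x r q
  proof -
    have r: "x \<in> I" "r \<in> carrier R" "q \<in> carrier R" "et' *\<^sub>B h (emb x) -\<^sub>B emb r \<in> PIdl\<^bsub>B\<^esub> a"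
      "et' *\<^sub>B h (emb x) -\<^sub>B emb q \<in> PIdl\<^bsub>B\<^esub> a"
      using that unfolding rel_def by auto
    obtain hx er eq where d: "hx = et' *\<^sub>B h (emb x)" "er = emb r" "eq = emb q" by blast
    have c: "hx \<in> carrier B" "er \<in> carrier B" "eq \<in> carrier B"
      unfolding d using et' hc Ic[OF r(1)] r(2,3) by auto
    have "(hx -\<^sub>B eq) -\<^sub>B (hx -\<^sub>B er) \<in> PIdl\<^bsub>B\<^esub> a"
      using P.a_closed[OF r(5) P.a_inv_closed[OF r(4)]] unfolding d by (simp add: a_minus_def)
    moreover have "(hx -\<^sub>B eq) -\<^sub>B (hx -\<^sub>B er) = er -\<^sub>B eq" using c by algebra
    moreover have "emb (r \<ominus> q) = er -\<^sub>B eq"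
      unfolding d using r(2,3) by (simp add: minus_eq B.minus_eq)
    ultimately show ?thesis using s(2) r(2,3) by simp
  qed
  define D where "D = {x. \<exists>r. rel x r}"
  have DI: "x \<in> I" if "x \<in> D" for x
    using that unfolding D_def rel_def by blast
  have Dmult: "u \<otimes> x \<in> D" if "u \<in> carrier R" "x \<in> D" for u x
    using that rel_mult unfolding D_def by blast
  have "G \<subseteq> D"
  proof
    fix x assume x: "x \<in> G"
    then obtain r where r: "r \<in> carrier R" "et' *\<^sub>B h (emb x) = emb r"
      using t(2) unfolding et'_def by blast
    then have "et' *\<^sub>B h (emb x) -\<^sub>B emb r \<in> PIdl\<^bsub>B\<^esub> a"
      using emb_closed P.zero_closed by (simp add: B.minus_eq B.r_neg)
    then show "x \<in> D" unfolding D_def rel_def using x GI r by blast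
  qed
  moreover have "ideal D R"
  proof (rule idealI)
    show "subgroup D (add_monoid R)"
    proof (rule add.subgroupI)
      show "D \<subseteq> carrier R" using Ic(1) DI by blast
      have z: "et' *\<^sub>B h (emb \<zero>) -\<^sub>B emb \<zero> = et' *\<^sub>B (h (\<zero>\<^bsub>B\<^esub> *\<^sub>B a) -\<^sub>B \<zero>\<^bsub>B\<^esub> *\<^sub>B h a)"
        using ac aJ hc[OF J.zero_closed] hc[OF aJ] et' by (simp add: B.minus_eq)
      have "h (\<zero>\<^bsub>B\<^esub> *\<^sub>B a) -\<^sub>B \<zero>\<^bsub>B\<^esub> *\<^sub>B h a \<in> PIdl\<^bsub>B\<^esub> a"
        using hmult aJ by blast
      then have "et' *\<^sub>B h (emb \<zero>) -\<^sub>B emb \<zero> \<in> PIdl\<^bsub>B\<^esub> a"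
        unfolding z by (rule P.I_l_closed[OF _ et'])
      then have "\<zero> \<in> D" unfolding D_def rel_def using I.zero_closed zero_closed by blast
      then show "D \<noteq> {}" by blast
      fix x assume x: "x \<in> D"
      then show "\<ominus> x \<in> D" using Dmult[of "\<ominus> \<one>" x] Ic(1)[OF DI[OF x]] by (simp add: l_minus)
      fix y assume "y \<in> D"
      then show "x \<oplus> y \<in> D" using x rel_add unfolding D_def by blast
    qed
  next
    fix d x assume d: "d \<in> D" "x \<in> carrier R"
    then show "x \<otimes> d \<in> D" using Dmult by blast
    then show "d \<otimes> x \<in> D" using m_comm[OF Ic(1)[OF DI[OF d(1)]] d(2)] by simp
  qed (rule ring_axioms)
  ultimately have "I \<subseteq> D" unfolding G(3) using genideal_minimal by blast
  then have "\<forall>x\<in>I. \<exists>r. rel x r" unfolding D_def by blast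
  then obtain \<rho> where rel: "\<And>x. x \<in> I \<Longrightarrow> rel x (\<rho> x)" by metis
  have \<rho>: "\<rho> x \<in> carrier R" "et' *\<^sub>B h (emb x) -\<^sub>B emb (\<rho> x) \<in> PIdl\<^bsub>B\<^esub> a" if "x \<in> I" for x
    using rel[OF that] unfolding rel_def by auto
  have \<rho>_add: "s \<otimes> \<rho> (x \<oplus> y) \<ominus> (s \<otimes> \<rho> x \<oplus> s \<otimes> \<rho> y) \<in> PIdl \<alpha>" if xy: "x \<in> I" "y \<in> I" for x y
  proof -
    have c: "\<rho> x \<in> carrier R" "\<rho> y \<in> carrier R" "\<rho> (x \<oplus> y) \<in> carrier R"
      using \<rho>(1) xy I.a_closed by auto
    have "s \<otimes> (\<rho> (x \<oplus> y) \<ominus> (\<rho> x \<oplus> \<rho> y)) = s \<otimes> \<rho> (x \<oplus> y) \<ominus> (s \<otimes> \<rho> x \<oplus> s \<otimes> \<rho> y)"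
      using c sc by algebra
    then show ?thesis
      using rel_unique[OF rel[OF I.a_closed[OF xy]] rel_add[OF rel[OF xy(1)] rel[OF xy(2)]]] by simp
  qed
  have \<rho>_mult: "s \<otimes> \<rho> (u \<otimes> x) \<ominus> u \<otimes> (s \<otimes> \<rho> x) \<in> PIdl \<alpha>" if xu: "x \<in> I" "u \<in> carrier R" for u x
  proof -
    have c: "\<rho> x \<in> carrier R" "\<rho> (u \<otimes> x) \<in> carrier R" using \<rho>(1) xu I.I_l_closed by auto
    have "s \<otimes> (\<rho> (u \<otimes> x) \<ominus> u \<otimes> \<rho> x) = s \<otimes> \<rho> (u \<otimes> x) \<ominus> u \<otimes> (s \<otimes> \<rho> x)"
      using c sc xu(2) by algebra
    then show ?thesis
      using rel_unique[OF rel[OF I.I_l_closed[OF xu]] rel_mult[OF xu(2) rel[OF xu(1)]]] by simp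
  qed
  have \<alpha>I: "\<alpha> \<in> I" unfolding I_def using \<sigma> J.I_l_closed[OF aJ, of "emb \<sigma>"] \<sigma>c by simp
  have \<rho>_\<alpha>: "s \<otimes> \<rho> \<alpha> \<in> PIdl \<alpha>"
  proof -
    obtain hsa ha' v ea where d: "hsa = h (emb \<sigma> *\<^sub>B a)" "ha' = h a" "v = emb \<sigma>" "ea = emb (\<rho> \<alpha>)" by blast
    have c: "hsa \<in> carrier B" "ha' \<in> carrier B" "v \<in> carrier B" "ea \<in> carrier B"
      unfolding d using hc aJ J.I_l_closed \<sigma>c \<rho>(1)[OF \<alpha>I] by auto
    have "et' *\<^sub>B (hsa -\<^sub>B v *\<^sub>B ha') +\<^sub>B (et' *\<^sub>B v) *\<^sub>B ha'
        +\<^sub>B (\<ominus>\<^bsub>B\<^esub> (et' *\<^sub>B hsa -\<^sub>B ea)) \<in> PIdl\<^bsub>B\<^esub> a"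
      using hmult[rule_format, OF emb_closed[OF \<sigma>c] aJ] ha \<rho>(2)[OF \<alpha>I] et' emb_closed[OF \<sigma>c]
      unfolding d \<sigma>(3) by (intro P.a_closed P.I_l_closed P.a_inv_closed) simp_all
    moreover have "et' *\<^sub>B (hsa -\<^sub>B v *\<^sub>B ha') +\<^sub>B (et' *\<^sub>B v) *\<^sub>B ha'
        +\<^sub>B (\<ominus>\<^bsub>B\<^esub> (et' *\<^sub>B hsa -\<^sub>B ea)) = ea"
      using c et' by algebra
    ultimately show ?thesis using s(2) \<rho>(1)[OF \<alpha>I] unfolding d by simp
  qed
  have "(\<lambda>x. s \<otimes> \<rho> x) \<in> I \<rightarrow> carrier R" using \<rho>(1) sc by auto
  then obtain c where c: "c \<in> carrier R" "\<forall>x\<in>I. s \<otimes> \<rho> x \<ominus> c \<otimes> x \<in> PIdl \<alpha>"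
    using inj[unfolded principal_quotients_self_injective_def, rule_format,
        of I \<alpha> "\<lambda>x. s \<otimes> \<rho> x"] I \<alpha>I \<alpha>0 \<rho>_add \<rho>_mult \<rho>_\<alpha> by auto
  define w where "w = inv\<^bsub>B\<^esub> (emb s *\<^sub>B et') *\<^sub>B emb c"
  define es ec where d0: "es = emb s" "ec = emb c"
  have U: "es *\<^sub>B et' \<in> Units B" using eu s t unfolding et'_def d0 by simp
  have c0: "es \<in> carrier B" "ec \<in> carrier B" using sc c unfolding d0 by auto
  have w: "w \<in> carrier B" "(es *\<^sub>B et') *\<^sub>B w = ec"
  proof -
    have i: "inv\<^bsub>B\<^esub> (es *\<^sub>B et') \<in> carrier B" "es *\<^sub>B et' \<in> carrier B"
      using U c0 et' by simp_all
    then show "w \<in> carrier B" unfolding w_def d0[symmetric] using c0 by simp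
    have "(es *\<^sub>B et') *\<^sub>B w = ((es *\<^sub>B et') *\<^sub>B inv\<^bsub>B\<^esub> (es *\<^sub>B et')) *\<^sub>B ec"
      unfolding w_def d0[symmetric] by (rule B.m_assoc[symmetric, OF i(2,1) c0(2)])
    then show "(es *\<^sub>B et') *\<^sub>B w = ec" using B.Units_r_inv[OF U] c0 by simp
  qed
  show "\<exists>c\<in>carrier B. \<forall>x\<in>J. h x -\<^sub>B c *\<^sub>B x \<in> PIdl\<^bsub>B\<^esub> a"
  proof (intro bexI[OF _ w(1)] ballI)
    fix y assume y: "y \<in> J"
    have yc: "y \<in> carrier B" using Jc y by blast
    obtain \<tau> x where \<tau>: "\<tau> \<in> S" "x \<in> carrier R" "emb \<tau> *\<^sub>B y = emb x"
      using clear_denominator[OF yc] .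
    have \<tau>c: "\<tau> \<in> carrier R" using \<tau> S_carrier by auto
    have xI: "x \<in> I" unfolding I_def using \<tau> J.I_l_closed[OF y, of "emb \<tau>"] \<tau>c by simp
    obtain v ex hx hy px where d: "v = emb \<tau>" "ex = emb x" "hx = h (emb x)" "hy = h y" "px = emb (\<rho> x)" by blast
    have cc: "v \<in> carrier B" "ex \<in> carrier B" "hx \<in> carrier B" "hy \<in> carrier B" "px \<in> carrier B"
      unfolding d using hc y Ic[OF xI] \<tau>c \<rho>(1)[OF xI] by auto
    have vy: "v *\<^sub>B y = ex" unfolding d by (rule \<tau>(3))
    have "emb (s \<otimes> \<rho> x \<ominus> c \<otimes> x) \<in> PIdl\<^bsub>B\<^esub> a"
    proof -
      obtain z where z: "z \<in> carrier R" "s \<otimes> \<rho> x \<ominus> c \<otimes> x = z \<otimes> \<alpha>"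
        using c(2) xI unfolding cgenideal_def by auto
      then have "emb (s \<otimes> \<rho> x \<ominus> c \<otimes> x) = emb z *\<^sub>B emb \<alpha>" using \<sigma>(2) by simp
      then show ?thesis 
        using B.cgenideal_self[OF emb_closed[OF \<sigma>(2)]] P.I_l_closed[OF _ emb_closed[OF z(1)]]
        unfolding Pa by simp
    qed
    moreover have "emb (s \<otimes> \<rho> x \<ominus> c \<otimes> x) = es *\<^sub>B px -\<^sub>B ec *\<^sub>B ex"
      unfolding d d0 using \<rho>(1)[OF xI] sc c(1) \<tau>(2) by (simp add: minus_eq B.minus_eq)
    ultimately have e3: "es *\<^sub>B px -\<^sub>B ec *\<^sub>B ex \<in> PIdl\<^bsub>B\<^esub> a" by simp
    have e1: "hx -\<^sub>B v *\<^sub>B hy \<in> PIdl\<^bsub>B\<^esub> a"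
      using hmult[rule_format, OF emb_closed[OF \<tau>c] y] unfolding d \<tau>(3) .
    have e2: "et' *\<^sub>B hx -\<^sub>B px \<in> PIdl\<^bsub>B\<^esub> a"
      using \<rho>(2)[OF xI] unfolding d .
    have "(\<ominus>\<^bsub>B\<^esub> (es *\<^sub>B et')) *\<^sub>B (hx -\<^sub>B v *\<^sub>B hy) +\<^sub>B es *\<^sub>B (et' *\<^sub>B hx -\<^sub>B px)
        +\<^sub>B (es *\<^sub>B px -\<^sub>B ec *\<^sub>B ex) \<in> PIdl\<^bsub>B\<^esub> a"
      by (intro P.a_closed P.I_l_closed e1 e2 e3) (use c0 et' in auto)
    moreover have "(\<ominus>\<^bsub>B\<^esub> (es *\<^sub>B et')) *\<^sub>B (hx -\<^sub>B v *\<^sub>B hy) +\<^sub>B es *\<^sub>B (et' *\<^sub>B hx -\<^sub>B px)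
        +\<^sub>B (es *\<^sub>B px -\<^sub>B ec *\<^sub>B ex) = es *\<^sub>B et' *\<^sub>B v *\<^sub>B hy -\<^sub>B ec *\<^sub>B ex"
      using c0 et' cc by algebra
    moreover have "es *\<^sub>B et' *\<^sub>B v *\<^sub>B (hy -\<^sub>B w *\<^sub>B y)
        = es *\<^sub>B et' *\<^sub>B v *\<^sub>B hy -\<^sub>B ((es *\<^sub>B et') *\<^sub>B w) *\<^sub>B (v *\<^sub>B y)"
      using c0 et' cc yc w(1) by algebra
    ultimately have "es *\<^sub>B et' *\<^sub>B v *\<^sub>B (hy -\<^sub>B w *\<^sub>B y) \<in> PIdl\<^bsub>B\<^esub> a"
      unfolding w(2) vy by simp
    moreover have "es *\<^sub>B et' *\<^sub>B v \<in> Units B" using U eu(1)[OF \<tau>(1)] unfolding d by blast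
    ultimately have "hy -\<^sub>B w *\<^sub>B y \<in> PIdl\<^bsub>B\<^esub> a"
      using cgenideal_Units_cancel[OF ac, of "es *\<^sub>B et' *\<^sub>B v" "hy -\<^sub>B w *\<^sub>B y"] cc(4) yc w(1)
      by simp
    then show "h y -\<^sub>B w *\<^sub>B y \<in> PIdl\<^bsub>B\<^esub> a" unfolding d .
  qed
qed

end

section \<open>Baer's criterion and modules of cosets\<close>

text \<open>
  The usual argument: take a maximal extension of f to a submodule of N, whose existence is
  Zorn's lemma. If some n were missing, the elements r with r n in the domain form an ideal, and
  the hypothesis extends the map to n. Partial maps are represented by their graphs, so that the
  order is inclusion and the union of a chain is again a graph; since graphs are closed under
  addition, single-valuedness only has to be required over zero.
\<close>

lemma Baer_criterion:
  fixes R :: "('r, 'b) ring_scheme" and E :: "('r, 'e, 'c) module_scheme"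
  assumes E: "Module.module R E"
    and ext: "\<And>J f. \<lbrakk>ideal J R; f \<in> J \<rightarrow> carrier E;
        \<And>x y. \<lbrakk>x \<in> J; y \<in> J\<rbrakk> \<Longrightarrow> f (x \<oplus>\<^bsub>R\<^esub> y) = f x \<oplus>\<^bsub>E\<^esub> f y;
        \<And>r x. \<lbrakk>r \<in> carrier R; x \<in> J\<rbrakk> \<Longrightarrow> f (r \<otimes>\<^bsub>R\<^esub> x) = r \<odot>\<^bsub>E\<^esub> f x\<rbrakk>
      \<Longrightarrow> \<exists>e\<in>carrier E. \<forall>x\<in>J. f x = x \<odot>\<^bsub>E\<^esub> e"
  shows "injective_module T R E"
  unfolding injective_module_def
proof (intro conjI allI ballI impI)
  show "Module.module R E" by (rule E)
  fix M N :: "('r, 'm) module" and \<iota> f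
  assume \<iota>: "\<iota> \<in> linear_maps R M N" and f: "f \<in> linear_maps R M E"
    and M: "Module.module R M" and N: "Module.module R N" and inj: "inj_on \<iota> (carrier M)"
  interpret R: cring R using E by (simp add: Module.module_def)
  interpret E: Module.module R E by (rule E)
  interpret M: Module.module R M by (rule M)
  interpret N: Module.module R N by (rule N)
  have \<iota>c: "\<iota> x \<in> carrier N" if "x \<in> carrier M" for x
    using \<iota> that unfolding linear_maps_def by auto
  have fc: "f x \<in> carrier E" if "x \<in> carrier M" for x
    using f that unfolding linear_maps_def by auto
  have \<iota>l: "\<iota> (x \<oplus>\<^bsub>M\<^esub> y) = \<iota> x \<oplus>\<^bsub>N\<^esub> \<iota> y" "f (x \<oplus>\<^bsub>M\<^esub> y) = f x \<oplus>\<^bsub>E\<^esub> f y"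
    if "x \<in> carrier M" "y \<in> carrier M" for x y
    using \<iota> f that unfolding linear_maps_def by auto
  have \<iota>s: "\<iota> (r \<odot>\<^bsub>M\<^esub> x) = r \<odot>\<^bsub>N\<^esub> \<iota> x" "f (r \<odot>\<^bsub>M\<^esub> x) = r \<odot>\<^bsub>E\<^esub> f x"
    if "r \<in> carrier R" "x \<in> carrier M" for r x
    using \<iota> f that unfolding linear_maps_def by auto
  have zero: "\<iota> \<zero>\<^bsub>M\<^esub> = \<zero>\<^bsub>N\<^esub>" "f \<zero>\<^bsub>M\<^esub> = \<zero>\<^bsub>E\<^esub>"
    using \<iota>s[OF R.zero_closed M.M.zero_closed] \<iota>c fc by simp_all
  define G0 where "G0 = (\<lambda>x. (\<iota> x, f x)) ` carrier M"
  define \<A> where "\<A> = {G. G0 \<subseteq> G \<and> G \<subseteq> carrier N \<times> carrier E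
    \<and> (\<forall>n e n' e'. (n, e) \<in> G \<longrightarrow> (n', e') \<in> G \<longrightarrow> (n \<oplus>\<^bsub>N\<^esub> n', e \<oplus>\<^bsub>E\<^esub> e') \<in> G)
    \<and> (\<forall>r\<in>carrier R. \<forall>n e. (n, e) \<in> G \<longrightarrow> (r \<odot>\<^bsub>N\<^esub> n, r \<odot>\<^bsub>E\<^esub> e) \<in> G)
    \<and> (\<forall>e. (\<zero>\<^bsub>N\<^esub>, e) \<in> G \<longrightarrow> e = \<zero>\<^bsub>E\<^esub>)}"
  have "G0 \<in> \<A>"
    unfolding \<A>_def
  proof (intro CollectI conjI allI impI ballI)
    show "G0 \<subseteq> carrier N \<times> carrier E" unfolding G0_def using \<iota>c fc by auto
  next
    fix n e n' e' assume "(n, e) \<in> G0" "(n', e') \<in> G0"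
    then obtain x y where "x \<in> carrier M" "y \<in> carrier M" "n = \<iota> x" "e = f x" "n' = \<iota> y" "e' = f y"
      unfolding G0_def by auto
    then show "(n \<oplus>\<^bsub>N\<^esub> n', e \<oplus>\<^bsub>E\<^esub> e') \<in> G0"
      unfolding G0_def using \<iota>l[of x y] by (intro image_eqI[of _ _ "x \<oplus>\<^bsub>M\<^esub> y"]) simp_all
  next
    fix r n e assume r: "r \<in> carrier R" and "(n, e) \<in> G0"
    then obtain x where "x \<in> carrier M" "n = \<iota> x" "e = f x" unfolding G0_def by auto
    then show "(r \<odot>\<^bsub>N\<^esub> n, r \<odot>\<^bsub>E\<^esub> e) \<in> G0"
      unfolding G0_def using \<iota>s[OF r, of x] r by (intro image_eqI[of _ _ "r \<odot>\<^bsub>M\<^esub> x"]) simp_all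
  next
    fix e assume "(\<zero>\<^bsub>N\<^esub>, e) \<in> G0"
    then obtain x where x: "x \<in> carrier M" "\<iota> x = \<zero>\<^bsub>N\<^esub>" "e = f x" unfolding G0_def by auto
    then have "x = \<zero>\<^bsub>M\<^esub>" using inj_onD[OF inj, of x "\<zero>\<^bsub>M\<^esub>"] zero by simp
    then show "e = \<zero>\<^bsub>E\<^esub>" using x zero by simp
  qed simp
  moreover have "\<Union>\<C> \<in> \<A>" if \<C>: "\<C> \<noteq> {}" "subset.chain \<A> \<C>" for \<C>
  proof -
    have sub: "\<C> \<subseteq> \<A>" and lin: "\<And>X Y. \<lbrakk>X \<in> \<C>; Y \<in> \<C>\<rbrakk> \<Longrightarrow> X \<subseteq> Y \<or> Y \<subseteq> X"
      using \<C>(2) unfolding subset_chain_def by auto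
    show ?thesis
      unfolding \<A>_def
    proof (intro CollectI conjI allI impI ballI)
      have "G0 \<subseteq> G" "G \<subseteq> carrier N \<times> carrier E" if "G \<in> \<C>" for G
        using sub that unfolding \<A>_def by auto
      then show "G0 \<subseteq> \<Union>\<C>" "\<Union>\<C> \<subseteq> carrier N \<times> carrier E"
        using \<C>(1) by blast+
    next
      fix n e n' e' assume "(n, e) \<in> \<Union>\<C>" "(n', e') \<in> \<Union>\<C>"
      then obtain X Y where "X \<in> \<C>" "Y \<in> \<C>" "(n, e) \<in> X" "(n', e') \<in> Y" by auto
      then obtain Z where "Z \<in> \<C>" "(n, e) \<in> Z" "(n', e') \<in> Z" using lin by blast
      then show "(n \<oplus>\<^bsub>N\<^esub> n', e \<oplus>\<^bsub>E\<^esub> e') \<in> \<Union>\<C>" using sub unfolding \<A>_def by blast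
    qed (use sub in \<open>unfold \<A>_def, blast+\<close>)
  qed
  ultimately have "\<exists>G\<in>\<A>. \<forall>X\<in>\<A>. G \<subseteq> X \<longrightarrow> X = G"
    by (intro subset_Zorn_nonempty) auto
  then obtain G where G: "G \<in> \<A>" and max: "\<And>X. \<lbrakk>X \<in> \<A>; G \<subseteq> X\<rbrakk> \<Longrightarrow> X = G" by blast
  have G0: "G0 \<subseteq> G" and Gc: "\<And>n e. (n, e) \<in> G \<Longrightarrow> n \<in> carrier N \<and> e \<in> carrier E"
    and Ga: "\<And>n e n' e'. \<lbrakk>(n, e) \<in> G; (n', e') \<in> G\<rbrakk> \<Longrightarrow> (n \<oplus>\<^bsub>N\<^esub> n', e \<oplus>\<^bsub>E\<^esub> e') \<in> G"
    and Gs: "\<And>r n e. \<lbrakk>r \<in> carrier R; (n, e) \<in> G\<rbrakk> \<Longrightarrow> (r \<odot>\<^bsub>N\<^esub> n, r \<odot>\<^bsub>E\<^esub> e) \<in> G"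
    and Gz: "\<And>e. (\<zero>\<^bsub>N\<^esub>, e) \<in> G \<Longrightarrow> e = \<zero>\<^bsub>E\<^esub>"
    using G unfolding \<A>_def by auto
  have Gm: "(\<ominus>\<^bsub>N\<^esub> n, \<ominus>\<^bsub>E\<^esub> e) \<in> G" if "(n, e) \<in> G" for n e
  proof -
    have "(\<ominus>\<^bsub>R\<^esub> \<one>\<^bsub>R\<^esub>) \<odot>\<^bsub>N\<^esub> n = \<ominus>\<^bsub>N\<^esub> n" "(\<ominus>\<^bsub>R\<^esub> \<one>\<^bsub>R\<^esub>) \<odot>\<^bsub>E\<^esub> e = \<ominus>\<^bsub>E\<^esub> e"
      using Gc[OF that] N.smult_l_minus E.smult_l_minus by simp_all
    then show ?thesis using Gs[of "\<ominus>\<^bsub>R\<^esub> \<one>\<^bsub>R\<^esub>", OF _ that] by simp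
  qed
  have Gf: "e = e'" if "(n, e) \<in> G" "(n, e') \<in> G" for n e e'
  proof -
    have "e \<oplus>\<^bsub>E\<^esub> (\<ominus>\<^bsub>E\<^esub> e') = \<zero>\<^bsub>E\<^esub>"
      using Ga[OF that(1) Gm[OF that(2)]] Gz Gc[OF that(1)] by (simp add: N.r_neg)
    then show ?thesis using Gc[OF that(1)] Gc[OF that(2)] by (metis E.minus_equality E.minus_minus E.a_inv_closed)
  qed
  have total: "\<exists>e. (n, e) \<in> G" if n: "n \<in> carrier N" for n
  proof (rule ccontr)
    assume none: "\<nexists>e. (n, e) \<in> G"
    define J where "J = {r \<in> carrier R. \<exists>e. (r \<odot>\<^bsub>N\<^esub> n, e) \<in> G}"
    define \<phi> where "\<phi> r = (SOME e. (r \<odot>\<^bsub>N\<^esub> n, e) \<in> G)" for r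
    have \<phi>: "(r \<odot>\<^bsub>N\<^esub> n, \<phi> r) \<in> G" if "r \<in> J" for r
      using that someI_ex[of "\<lambda>e. (r \<odot>\<^bsub>N\<^esub> n, e) \<in> G"] unfolding J_def \<phi>_def by blast
    have J_add: "x \<oplus>\<^bsub>R\<^esub> y \<in> J \<and> \<phi> (x \<oplus>\<^bsub>R\<^esub> y) = \<phi> x \<oplus>\<^bsub>E\<^esub> \<phi> y" if xy: "x \<in> J" "y \<in> J" for x y
    proof -
      have c: "x \<in> carrier R" "y \<in> carrier R" using xy J_def by auto
      have g: "((x \<oplus>\<^bsub>R\<^esub> y) \<odot>\<^bsub>N\<^esub> n, \<phi> x \<oplus>\<^bsub>E\<^esub> \<phi> y) \<in> G"
        using Ga[OF \<phi>[OF xy(1)] \<phi>[OF xy(2)]] c n by (simp add: N.smult_l_distr)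
      then have m: "x \<oplus>\<^bsub>R\<^esub> y \<in> J" unfolding J_def using c by auto
      then show ?thesis using Gf[OF \<phi>[OF m] g] by simp
    qed
    have J_mult: "r \<otimes>\<^bsub>R\<^esub> x \<in> J \<and> \<phi> (r \<otimes>\<^bsub>R\<^esub> x) = r \<odot>\<^bsub>E\<^esub> \<phi> x" if r: "r \<in> carrier R" "x \<in> J" for r x
    proof -
      have c: "x \<in> carrier R" using r J_def by auto
      have g: "((r \<otimes>\<^bsub>R\<^esub> x) \<odot>\<^bsub>N\<^esub> n, r \<odot>\<^bsub>E\<^esub> \<phi> x) \<in> G"
        using Gs[OF r(1) \<phi>[OF r(2)]] c r n by (simp add: N.smult_assoc1)
      then have m: "r \<otimes>\<^bsub>R\<^esub> x \<in> J" unfolding J_def using c r by auto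
      then show ?thesis using Gf[OF \<phi>[OF m] g] by simp
    qed
    have G00: "(\<zero>\<^bsub>N\<^esub>, \<zero>\<^bsub>E\<^esub>) \<in> G"
      using G0 zero M.M.zero_closed unfolding G0_def by force
    have J: "ideal J R"
    proof (rule idealI)
      show "ring R" by (rule R.ring_axioms)
      show "subgroup J (add_monoid R)"
      proof (rule R.add.subgroupI)
        show "J \<subseteq> carrier R" unfolding J_def by auto
        have "\<zero>\<^bsub>R\<^esub> \<in> J" unfolding J_def using G00 n by auto
        then show "J \<noteq> {}" by auto
        fix x assume x: "x \<in> J"
        then have "(\<ominus>\<^bsub>R\<^esub> \<one>\<^bsub>R\<^esub>) \<otimes>\<^bsub>R\<^esub> x \<in> J" using J_mult by simp
        moreover have "x \<in> carrier R" using x J_def by auto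
        ultimately show "\<ominus>\<^bsub>R\<^esub> x \<in> J" by (simp add: R.l_minus)
      qed (use J_add in auto)
      fix a x assume a: "a \<in> J" "x \<in> carrier R"
      then show "x \<otimes>\<^bsub>R\<^esub> a \<in> J" using J_mult by blast
      then show "a \<otimes>\<^bsub>R\<^esub> x \<in> J" using a R.m_comm[of a x] unfolding J_def by simp
    qed
    have "\<phi> \<in> J \<rightarrow> carrier E" using Gc[OF \<phi>] by auto
    then obtain e where e: "e \<in> carrier E" "\<And>x. x \<in> J \<Longrightarrow> \<phi> x = x \<odot>\<^bsub>E\<^esub> e"
      using ext[OF J, of \<phi>] J_add J_mult by blast
    \<comment> \<open>The extension of G to the submodule generated by its domain and n, with value e at n.\<close>
    define G' where "G' = {(m \<oplus>\<^bsub>N\<^esub> r \<odot>\<^bsub>N\<^esub> n, g \<oplus>\<^bsub>E\<^esub> r \<odot>\<^bsub>E\<^esub> e) | m g r. (m, g) \<in> G \<and> r \<in> carrier R}"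
    have GG': "G \<subseteq> G'"
    proof
      fix p assume p: "p \<in> G"
      obtain m g where mg: "p = (m, g)" by (cases p)
      have c: "m \<in> carrier N" "g \<in> carrier E" using Gc p mg by auto
      have "p = (m \<oplus>\<^bsub>N\<^esub> \<zero>\<^bsub>R\<^esub> \<odot>\<^bsub>N\<^esub> n, g \<oplus>\<^bsub>E\<^esub> \<zero>\<^bsub>R\<^esub> \<odot>\<^bsub>E\<^esub> e)"
        using mg c n e(1) by simp
      then show "p \<in> G'" unfolding G'_def by (intro CollectI exI[of _ m] exI[of _ g] exI[of _ "\<zero>\<^bsub>R\<^esub>"]) (use p mg R.zero_closed in simp)
    qed
    have "G' \<in> \<A>"
      unfolding \<A>_def
    proof (intro CollectI conjI allI impI ballI)
      show "G0 \<subseteq> G'" using G0 GG' by simp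
      show "G' \<subseteq> carrier N \<times> carrier E" unfolding G'_def using Gc n e(1) by auto
    next
      fix p q p' q' assume "(p, q) \<in> G'" "(p', q') \<in> G'"
      then obtain m g r m' g' r' where h: "(m, g) \<in> G" "r \<in> carrier R" "(m', g') \<in> G" "r' \<in> carrier R"
        "p = m \<oplus>\<^bsub>N\<^esub> r \<odot>\<^bsub>N\<^esub> n" "q = g \<oplus>\<^bsub>E\<^esub> r \<odot>\<^bsub>E\<^esub> e" "p' = m' \<oplus>\<^bsub>N\<^esub> r' \<odot>\<^bsub>N\<^esub> n" "q' = g' \<oplus>\<^bsub>E\<^esub> r' \<odot>\<^bsub>E\<^esub> e"
        unfolding G'_def by blast
      have c: "m \<in> carrier N" "m' \<in> carrier N" "g \<in> carrier E" "g' \<in> carrier E"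
        using Gc h by blast+
      have "p \<oplus>\<^bsub>N\<^esub> p' = (m \<oplus>\<^bsub>N\<^esub> m') \<oplus>\<^bsub>N\<^esub> (r \<oplus>\<^bsub>R\<^esub> r') \<odot>\<^bsub>N\<^esub> n"
        "q \<oplus>\<^bsub>E\<^esub> q' = (g \<oplus>\<^bsub>E\<^esub> g') \<oplus>\<^bsub>E\<^esub> (r \<oplus>\<^bsub>R\<^esub> r') \<odot>\<^bsub>E\<^esub> e"
        using c h(2,4) n e(1) unfolding h(5-8)
        by (simp_all add: N.smult_l_distr E.smult_l_distr N.a_ac E.a_ac)
      then show "(p \<oplus>\<^bsub>N\<^esub> p', q \<oplus>\<^bsub>E\<^esub> q') \<in> G'"
        unfolding G'_def using Ga[OF h(1,3)] R.a_closed[OF h(2,4)] by blast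
    next
      fix r p q assume r: "r \<in> carrier R" and "(p, q) \<in> G'"
      then obtain m g r' where h: "(m, g) \<in> G" "r' \<in> carrier R"
        "p = m \<oplus>\<^bsub>N\<^esub> r' \<odot>\<^bsub>N\<^esub> n" "q = g \<oplus>\<^bsub>E\<^esub> r' \<odot>\<^bsub>E\<^esub> e"
        unfolding G'_def by blast
      have c: "m \<in> carrier N" "g \<in> carrier E"
        using Gc h by blast+
      have "r \<odot>\<^bsub>N\<^esub> p = r \<odot>\<^bsub>N\<^esub> m \<oplus>\<^bsub>N\<^esub> (r \<otimes>\<^bsub>R\<^esub> r') \<odot>\<^bsub>N\<^esub> n"
        "r \<odot>\<^bsub>E\<^esub> q = r \<odot>\<^bsub>E\<^esub> g \<oplus>\<^bsub>E\<^esub> (r \<otimes>\<^bsub>R\<^esub> r') \<odot>\<^bsub>E\<^esub> e"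
        using c h(2) r n e(1) unfolding h(3,4)
        by (simp_all add: N.smult_r_distr E.smult_r_distr N.smult_assoc1 E.smult_assoc1)
      then show "(r \<odot>\<^bsub>N\<^esub> p, r \<odot>\<^bsub>E\<^esub> q) \<in> G'"
        unfolding G'_def using Gs[OF r h(1)] R.m_closed[OF r h(2)] by blast
    next
      fix q assume "(\<zero>\<^bsub>N\<^esub>, q) \<in> G'"
      then obtain m g r where h: "(m, g) \<in> G" "r \<in> carrier R"
        "\<zero>\<^bsub>N\<^esub> = m \<oplus>\<^bsub>N\<^esub> r \<odot>\<^bsub>N\<^esub> n" "q = g \<oplus>\<^bsub>E\<^esub> r \<odot>\<^bsub>E\<^esub> e"
        unfolding G'_def by blast
      have c: "m \<in> carrier N" "g \<in> carrier E"
        using Gc h by blast+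
      have "r \<odot>\<^bsub>N\<^esub> n = \<ominus>\<^bsub>N\<^esub> m"
        using h(2,3) c n N.minus_equality[of "r \<odot>\<^bsub>N\<^esub> n" m] by (simp add: N.a_comm)
      then have rg: "(r \<odot>\<^bsub>N\<^esub> n, \<ominus>\<^bsub>E\<^esub> g) \<in> G" using Gm[OF h(1)] by simp
      then have rJ: "r \<in> J" unfolding J_def using h(2) by auto
      then have "r \<odot>\<^bsub>E\<^esub> e = \<ominus>\<^bsub>E\<^esub> g" using Gf[OF \<phi>[OF rJ] rg] e(2)[OF rJ] by simp
      then show "q = \<zero>\<^bsub>E\<^esub>" using h(4) c by (simp add: E.r_neg)
    qed
    then have "G' = G" using max GG' by blast
    moreover have "(n, e) \<in> G'"
    proof -
      have "(n, e) = (\<zero>\<^bsub>N\<^esub> \<oplus>\<^bsub>N\<^esub> \<one>\<^bsub>R\<^esub> \<odot>\<^bsub>N\<^esub> n, \<zero>\<^bsub>E\<^esub> \<oplus>\<^bsub>E\<^esub> \<one>\<^bsub>R\<^esub> \<odot>\<^bsub>E\<^esub> e)" using n e(1) by simp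
      then show ?thesis unfolding G'_def using G00 R.one_closed by blast
    qed
    ultimately show False using none by blast
  qed
  define g where "g n = (SOME e. (n, e) \<in> G)" for n
  have g: "(n, g n) \<in> G" if "n \<in> carrier N" for n
    using someI_ex[OF total[OF that]] unfolding g_def .
  have "g \<in> linear_maps R N E"
    unfolding linear_maps_def
  proof (intro CollectI conjI ballI)
    show "g \<in> carrier N \<rightarrow> carrier E" using g Gc by blast
    show "g (x \<oplus>\<^bsub>N\<^esub> y) = g x \<oplus>\<^bsub>E\<^esub> g y" if "x \<in> carrier N" "y \<in> carrier N" for x y
      by (rule Gf[OF g Ga[OF g g]]) (use that in auto)
    show "g (r \<odot>\<^bsub>N\<^esub> x) = r \<odot>\<^bsub>E\<^esub> g x" if "r \<in> carrier R" "x \<in> carrier N" for r x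
      by (rule Gf[OF g Gs[OF _ g]]) (use that in auto)
  qed
  moreover have "g (\<iota> x) = f x" if "x \<in> carrier M" for x
    by (rule Gf[OF g]) (use that \<iota>c G0 G0_def in auto)
  ultimately show "\<exists>g\<in>linear_maps R N E. \<forall>x\<in>carrier M. g (\<iota> x) = f x" by blast
qed

text \<open>
  The quotient S/N as a module over R, where R acts through a ring homomorphism h from R to S.
  Module records carry the fields of a ring; the ring multiplication and unit are filled with dummy
  values.
\<close>

definition coset_module ::
  "('s, 'b) ring_scheme \<Rightarrow> ('r \<Rightarrow> 's) \<Rightarrow> 's set \<Rightarrow> ('r, 's set) module" where
  "coset_module S h N =
     \<lparr>carrier = a_rcosets\<^bsub>S\<^esub> N, monoid.mult = (\<lambda>X Y. N), one = N, zero = N, add = set_add S,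
      smult = (\<lambda>r X. \<Union>x\<in>X. N +>\<^bsub>S\<^esub> (h r \<otimes>\<^bsub>S\<^esub> x))\<rparr>"

locale scalar_submodule = ring_hom_cring R S h + additive_subgroup N S
  for R (structure) and S (structure) and h N +
  assumes smult_mem: "\<lbrakk>r \<in> carrier R; x \<in> N\<rbrakk> \<Longrightarrow> h r \<otimes>\<^bsub>S\<^esub> x \<in> N"
begin

sublocale abelian_subgroup N S
  using additive_subgroup_axioms S.abelian_group_axioms by (intro abelian_subgroupI3) auto

abbreviation E where "E \<equiv> coset_module S h N"

lemma coset_eq_iff:
  assumes "x \<in> carrier S" "y \<in> carrier S"
  shows "N +>\<^bsub>S\<^esub> x = N +>\<^bsub>S\<^esub> y \<longleftrightarrow> x \<ominus>\<^bsub>S\<^esub> y \<in> N"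
proof
  assume "N +>\<^bsub>S\<^esub> x = N +>\<^bsub>S\<^esub> y"
  then have "x \<in> N +>\<^bsub>S\<^esub> y" using a_rcos_self[OF assms(1)] by simp
  then show "x \<ominus>\<^bsub>S\<^esub> y \<in> N" using a_rcos_module_imp[OF assms(2)] by (simp add: S.minus_eq)
next
  assume "x \<ominus>\<^bsub>S\<^esub> y \<in> N"
  then have "x \<in> N +>\<^bsub>S\<^esub> y" using a_rcos_module_rev[OF assms(2,1)] by (simp add: S.minus_eq)
  then show "N +>\<^bsub>S\<^esub> x = N +>\<^bsub>S\<^esub> y"
    using S.a_repr_independence[OF _ assms(2) a_subgroup] by simp
qed

lemma carrier_coset_module: "carrier E = {N +>\<^bsub>S\<^esub> x | x. x \<in> carrier S}"
  unfolding coset_module_def A_RCOSETS_def' by auto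

lemma coset_closed: "x \<in> carrier S \<Longrightarrow> N +>\<^bsub>S\<^esub> x \<in> carrier E"
  using carrier_coset_module by auto

lemma coset_zero: "\<zero>\<^bsub>E\<^esub> = N" "\<zero>\<^bsub>E\<^esub> = N +>\<^bsub>S\<^esub> \<zero>\<^bsub>S\<^esub>"
  using a_rcos_const[OF zero_closed] unfolding coset_module_def by simp_all

lemma coset_add:
  "\<lbrakk>x \<in> carrier S; y \<in> carrier S\<rbrakk> \<Longrightarrow> (N +>\<^bsub>S\<^esub> x) \<oplus>\<^bsub>E\<^esub> (N +>\<^bsub>S\<^esub> y) = N +>\<^bsub>S\<^esub> (x \<oplus>\<^bsub>S\<^esub> y)"
  using a_rcos_sum unfolding coset_module_def by simp

lemma coset_smult:
  assumes "r \<in> carrier R" "x \<in> carrier S"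
  shows "r \<odot>\<^bsub>E\<^esub> (N +>\<^bsub>S\<^esub> x) = N +>\<^bsub>S\<^esub> (h r \<otimes>\<^bsub>S\<^esub> x)"
proof -
  have "N +>\<^bsub>S\<^esub> (h r \<otimes>\<^bsub>S\<^esub> y) = N +>\<^bsub>S\<^esub> (h r \<otimes>\<^bsub>S\<^esub> x)" if y: "y \<in> N +>\<^bsub>S\<^esub> x" for y
  proof -
    have yc: "y \<in> carrier S" using a_elemrcos_carrier[OF assms(2) y] .
    have "h r \<otimes>\<^bsub>S\<^esub> (y \<ominus>\<^bsub>S\<^esub> x) \<in> N"
      using smult_mem[OF assms(1)] a_rcos_module_imp[OF assms(2) y] by (simp add: S.minus_eq)
    then have "h r \<otimes>\<^bsub>S\<^esub> y \<ominus>\<^bsub>S\<^esub> h r \<otimes>\<^bsub>S\<^esub> x \<in> N"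
      using assms yc by (simp add: S.minus_eq S.r_distr S.r_minus)
    then show ?thesis using coset_eq_iff assms yc by simp
  qed
  then have "(\<Union>y\<in>N +>\<^bsub>S\<^esub> x. N +>\<^bsub>S\<^esub> (h r \<otimes>\<^bsub>S\<^esub> y)) = N +>\<^bsub>S\<^esub> (h r \<otimes>\<^bsub>S\<^esub> x)"
    using a_rcos_self[OF assms(2)] by blast
  then show ?thesis unfolding coset_module_def by simp
qed

lemma coset_module_cases:
  assumes "X \<in> carrier E" obtains x where "x \<in> carrier S" "X = N +>\<^bsub>S\<^esub> x"
  using assms carrier_coset_module by auto

lemma coset_module_is_module: "Module.module R E"
proof (rule moduleI)
  show "cring R" by (rule R.is_cring)
  show "abelian_group E"
  proof (rule abelian_groupI)
    show "\<zero>\<^bsub>E\<^esub> \<in> carrier E" using coset_zero(2) coset_closed by simp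
    fix X assume "X \<in> carrier E"
    then obtain x where x: "x \<in> carrier S" "X = N +>\<^bsub>S\<^esub> x" by (rule coset_module_cases)
    show "\<zero>\<^bsub>E\<^esub> \<oplus>\<^bsub>E\<^esub> X = X" unfolding coset_zero(2) x using x coset_add by simp
    have "(N +>\<^bsub>S\<^esub> (\<ominus>\<^bsub>S\<^esub> x)) \<oplus>\<^bsub>E\<^esub> X = \<zero>\<^bsub>E\<^esub>"
      unfolding coset_zero(2) x using x coset_add by (simp add: S.l_neg)
    then show "\<exists>Y\<in>carrier E. Y \<oplus>\<^bsub>E\<^esub> X = \<zero>\<^bsub>E\<^esub>"
      by (rule bexI) (rule coset_closed, use x in simp)
    fix Y assume "Y \<in> carrier E"
    then obtain y where y: "y \<in> carrier S" "Y = N +>\<^bsub>S\<^esub> y" by (rule coset_module_cases)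
    show "X \<oplus>\<^bsub>E\<^esub> Y \<in> carrier E" "X \<oplus>\<^bsub>E\<^esub> Y = Y \<oplus>\<^bsub>E\<^esub> X"
      using x y coset_add coset_closed by (simp_all add: S.a_comm)
    fix Z assume "Z \<in> carrier E"
    then obtain z where z: "z \<in> carrier S" "Z = N +>\<^bsub>S\<^esub> z" by (rule coset_module_cases)
    show "X \<oplus>\<^bsub>E\<^esub> Y \<oplus>\<^bsub>E\<^esub> Z = X \<oplus>\<^bsub>E\<^esub> (Y \<oplus>\<^bsub>E\<^esub> Z)"
      using x y z coset_add by (simp add: S.a_assoc)
  qed
next
  fix a X assume a: "a \<in> carrier R" and "X \<in> carrier E"
  then obtain x where x: "x \<in> carrier S" "X = N +>\<^bsub>S\<^esub> x" by (metis coset_module_cases)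
  show "a \<odot>\<^bsub>E\<^esub> X \<in> carrier E" using a x coset_smult coset_closed by simp
  {
    fix b assume b: "b \<in> carrier R"
    show "(a \<oplus> b) \<odot>\<^bsub>E\<^esub> X = a \<odot>\<^bsub>E\<^esub> X \<oplus>\<^bsub>E\<^esub> b \<odot>\<^bsub>E\<^esub> X"
      "(a \<otimes> b) \<odot>\<^bsub>E\<^esub> X = a \<odot>\<^bsub>E\<^esub> (b \<odot>\<^bsub>E\<^esub> X)"
      using a b x coset_smult coset_add by (simp_all add: S.l_distr S.m_assoc)
  }
  fix Y assume "Y \<in> carrier E"
  then obtain y where y: "y \<in> carrier S" "Y = N +>\<^bsub>S\<^esub> y" by (rule coset_module_cases)
  show "a \<odot>\<^bsub>E\<^esub> (X \<oplus>\<^bsub>E\<^esub> Y) = a \<odot>\<^bsub>E\<^esub> X \<oplus>\<^bsub>E\<^esub> a \<odot>\<^bsub>E\<^esub> Y"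
    using a x y coset_smult coset_add by (simp add: S.r_distr)
next
  fix X assume "X \<in> carrier E"
  then obtain x where x: "x \<in> carrier S" "X = N +>\<^bsub>S\<^esub> x" by (rule coset_module_cases)
  show "\<one> \<odot>\<^bsub>E\<^esub> X = X" using x coset_smult by simp
qed

text \<open>
  Baer's criterion for S/N in terms of representatives in S.
\<close>

lemma injective_coset_module:
  assumes "\<And>J f. \<lbrakk>ideal J R; f \<in> J \<rightarrow> carrier S;
        \<And>x y. \<lbrakk>x \<in> J; y \<in> J\<rbrakk> \<Longrightarrow> f (x \<oplus> y) \<ominus>\<^bsub>S\<^esub> (f x \<oplus>\<^bsub>S\<^esub> f y) \<in> N;
        \<And>r x. \<lbrakk>r \<in> carrier R; x \<in> J\<rbrakk> \<Longrightarrow> f (r \<otimes> x) \<ominus>\<^bsub>S\<^esub> h r \<otimes>\<^bsub>S\<^esub> f x \<in> N\<rbrakk>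
      \<Longrightarrow> \<exists>q\<in>carrier S. \<forall>x\<in>J. f x \<ominus>\<^bsub>S\<^esub> h x \<otimes>\<^bsub>S\<^esub> q \<in> N"
  shows "injective_module T R E"
proof (rule Baer_criterion[OF coset_module_is_module])
  fix J f
  assume J: "ideal J R" and f: "f \<in> J \<rightarrow> carrier E"
    and fa: "\<And>x y. \<lbrakk>x \<in> J; y \<in> J\<rbrakk> \<Longrightarrow> f (x \<oplus> y) = f x \<oplus>\<^bsub>E\<^esub> f y"
    and fm: "\<And>r x. \<lbrakk>r \<in> carrier R; x \<in> J\<rbrakk> \<Longrightarrow> f (r \<otimes> x) = r \<odot>\<^bsub>E\<^esub> f x"
  interpret J: ideal J R by (rule J)
  have "\<forall>x\<in>J. \<exists>q. q \<in> carrier S \<and> f x = N +>\<^bsub>S\<^esub> q"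
    using f by (metis PiE coset_module_cases)
  then obtain g where gc: "\<And>x. x \<in> J \<Longrightarrow> g x \<in> carrier S" and fg: "\<And>x. x \<in> J \<Longrightarrow> f x = N +>\<^bsub>S\<^esub> g x"
    by metis
  have Jc: "x \<in> carrier R" if "x \<in> J" for x using that J.a_subset by blast
  have "\<exists>q\<in>carrier S. \<forall>x\<in>J. g x \<ominus>\<^bsub>S\<^esub> h x \<otimes>\<^bsub>S\<^esub> q \<in> N"
  proof (rule assms[OF J])
    show "g \<in> J \<rightarrow> carrier S" using gc by blast
    fix x assume x: "x \<in> J"
    {
      fix y assume y: "y \<in> J"
      have "N +>\<^bsub>S\<^esub> g (x \<oplus> y) = N +>\<^bsub>S\<^esub> (g x \<oplus>\<^bsub>S\<^esub> g y)"
        using fa[OF x y] fg[OF x] fg[OF y] fg[OF J.a_closed[OF x y]] coset_add gc x y by simp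
      then show "g (x \<oplus> y) \<ominus>\<^bsub>S\<^esub> (g x \<oplus>\<^bsub>S\<^esub> g y) \<in> N"
        using coset_eq_iff[OF gc[OF J.a_closed[OF x y]]] gc x y by simp
    }
    fix r assume r: "r \<in> carrier R"
    have "N +>\<^bsub>S\<^esub> g (r \<otimes> x) = N +>\<^bsub>S\<^esub> (h r \<otimes>\<^bsub>S\<^esub> g x)"
      using fm[OF r x] fg[OF x] fg[OF J.I_l_closed[OF x r]] coset_smult gc x r by simp
    then show "g (r \<otimes> x) \<ominus>\<^bsub>S\<^esub> h r \<otimes>\<^bsub>S\<^esub> g x \<in> N"
      using coset_eq_iff[OF gc[OF J.I_l_closed[OF x r]]] gc x r by simp
  qed
  then obtain q where q: "q \<in> carrier S" "\<And>x. x \<in> J \<Longrightarrow> g x \<ominus>\<^bsub>S\<^esub> h x \<otimes>\<^bsub>S\<^esub> q \<in> N" by blast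
  have "f x = x \<odot>\<^bsub>E\<^esub> (N +>\<^bsub>S\<^esub> q)" if x: "x \<in> J" for x
    using fg[OF x] coset_smult[OF Jc[OF x] q(1)] coset_eq_iff[OF gc[OF x], of "h x \<otimes>\<^bsub>S\<^esub> q"] q(2)[OF x] q(1) Jc[OF x]
    by simp
  then show "\<exists>e\<in>carrier E. \<forall>x\<in>J. f x = x \<odot>\<^bsub>E\<^esub> e" using coset_closed[OF q(1)] by blast
qed

end

section \<open>An injective resolution of length one\<close>

locale fraction_field = domain_localization R "carrier R - {\<zero>}" for R (structure)

lemma (in domain) fraction_field: "fraction_field R"
  unfolding fraction_field_def
  by (intro domain_localization.intro domain_axioms domain_localization_axioms.intro)
    (auto simp: integral_iff)

context fraction_field begin

abbreviation times_Q (infixl "*\<^sub>B" 70) where "x *\<^sub>B y \<equiv> x \<otimes>\<^bsub>B\<^esub> y"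
abbreviation plus_Q (infixl "+\<^sub>B" 65) where "x +\<^sub>B y \<equiv> x \<oplus>\<^bsub>B\<^esub> y"
abbreviation minus_Q (infixl "-\<^sub>B" 65) where "x -\<^sub>B y \<equiv> x \<ominus>\<^bsub>B\<^esub> y"

lemma division:
  assumes "a \<in> carrier R" "a \<noteq> \<zero>" "y \<in> carrier B"
  obtains q where "q \<in> carrier B" "emb a *\<^sub>B q = y"
proof -
  interpret B: domain B by (rule localization_is_domain)
  have u: "emb a \<in> Units B" using emb_Units assms by simp
  have "emb a *\<^sub>B (inv\<^bsub>B\<^esub> emb a *\<^sub>B y) = (emb a *\<^sub>B inv\<^bsub>B\<^esub> emb a) *\<^sub>B y"
    by (rule B.m_assoc[symmetric]) (use u assms emb_closed in auto)
  then have "emb a *\<^sub>B (inv\<^bsub>B\<^esub> emb a *\<^sub>B y) = y" using u assms by simp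
  moreover have "inv\<^bsub>B\<^esub> emb a *\<^sub>B y \<in> carrier B" using u assms by simp
  ultimately show thesis by (rule that[rotated])
qed

lemma emb_cancel:
  assumes "a \<in> carrier R" "a \<noteq> \<zero>" "x \<in> carrier B" "y \<in> carrier B"
    and "emb a *\<^sub>B x = emb a *\<^sub>B y"
  shows "x = y"
proof -
  interpret B: domain B by (rule localization_is_domain)
  show ?thesis
    by (rule B.Units_l_cancel[THEN iffD1, OF emb_Units]) (use assms in auto)
qed

lemma scalar_submodule_zero: "scalar_submodule R B emb {\<zero>\<^bsub>B\<^esub>}"
proof -
  interpret e: ring_hom_cring R B emb by (rule emb_ring_hom_cring)
  show ?thesis
    by (intro scalar_submodule.intro e.ring_hom_cring_axioms additive_subgroup.intro
        scalar_submodule_axioms.intro e.S.add.triv_subgroup) simp_all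
qed

lemma scalar_submodule_emb: "scalar_submodule R B emb (emb ` carrier R)"
proof -
  interpret e: ring_hom_cring R B emb by (rule emb_ring_hom_cring)
  show ?thesis
  proof (intro scalar_submodule.intro e.ring_hom_cring_axioms additive_subgroup.intro
        scalar_submodule_axioms.intro)
    show "subgroup (emb ` carrier R) (add_monoid B)"
    proof (rule e.S.add.subgroupI)
      fix x assume "x \<in> emb ` carrier R"
      then obtain r where r: "r \<in> carrier R" "x = emb r" by blast
      show "\<ominus>\<^bsub>B\<^esub> x \<in> emb ` carrier R"
        by (rule image_eqI[of _ _ "\<ominus> r"]) (use r in simp_all)
      fix y assume "y \<in> emb ` carrier R"
      then obtain s where s: "s \<in> carrier R" "y = emb s" by blast
      show "x +\<^sub>B y \<in> emb ` carrier R"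
        by (rule image_eqI[of _ _ "r \<oplus> s"]) (use r s in simp_all)
    qed auto
    fix r x assume "r \<in> carrier R" "x \<in> emb ` carrier R"
    then obtain s where s: "r \<in> carrier R" "s \<in> carrier R" "x = emb s" by blast
    show "emb r *\<^sub>B x \<in> emb ` carrier R"
      by (rule image_eqI[of _ _ "r \<otimes> s"]) (use s in simp_all)
  qed
qed

lemma scalar_submodule_carrier: "scalar_submodule R B emb (carrier B)"
proof -
  interpret e: ring_hom_cring R B emb by (rule emb_ring_hom_cring)
  show ?thesis
    by (intro scalar_submodule.intro e.ring_hom_cring_axioms additive_subgroup.intro
        scalar_submodule_axioms.intro e.S.add.subgroup_self) simp_all
qed

text \<open>
  A torsion-free divisible module over a domain is injective: on an ideal containing a nonzero
  a, a linear map is multiplication by f(a)/a. The field is written as the quotient by the zero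
  submodule, so that all terms of the resolution below have the same shape.
\<close>

lemma injective_fraction_field:
  "injective_module T R (coset_module B emb {\<zero>\<^bsub>B\<^esub>})"
proof -
  interpret Z: scalar_submodule R B emb "{\<zero>\<^bsub>B\<^esub>}" by (rule scalar_submodule_zero)
  show ?thesis
  proof (rule Z.injective_coset_module)
    fix J f
    assume "ideal J R" and f: "f \<in> J \<rightarrow> carrier B"
      and mult: "\<And>r x. \<lbrakk>r \<in> carrier R; x \<in> J\<rbrakk> \<Longrightarrow> f (r \<otimes> x) -\<^sub>B emb r *\<^sub>B f x \<in> {\<zero>\<^bsub>B\<^esub>}"
    interpret J: ideal J R by fact
    have Jc: "x \<in> carrier R" if "x \<in> J" for x using that J.a_subset by blast
    have fc: "f x \<in> carrier B" if "x \<in> J" for x using f that by blast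
    have m: "f (r \<otimes> x) = emb r *\<^sub>B f x" if "r \<in> carrier R" "x \<in> J" for r x
      using mult[OF that] fc[OF that(2)] fc[OF J.I_l_closed[OF that(2,1)]] that(1) by simp
    have f0: "f \<zero> = \<zero>\<^bsub>B\<^esub>"
      using m[OF zero_closed J.zero_closed] fc[OF J.zero_closed] by simp
    show "\<exists>q\<in>carrier B. \<forall>x\<in>J. f x -\<^sub>B emb x *\<^sub>B q \<in> {\<zero>\<^bsub>B\<^esub>}"
    proof (cases "J = {\<zero>}")
      case True
      then show ?thesis using f0 by (intro bexI[of _ "\<zero>\<^bsub>B\<^esub>"]) auto
    next
      case False
      then obtain a where a: "a \<in> J" "a \<noteq> \<zero>" using J.zero_closed by blast
      obtain q where q: "q \<in> carrier B" "emb a *\<^sub>B q = f a"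
        using division[OF Jc[OF a(1)] a(2) fc[OF a(1)]] .
      have "f x -\<^sub>B emb x *\<^sub>B q \<in> {\<zero>\<^bsub>B\<^esub>}" if x: "x \<in> J" for x
      proof -
        have "emb a *\<^sub>B f x = f (a \<otimes> x)" using m[OF Jc[OF a(1)] x] by simp
        also have "\<dots> = emb x *\<^sub>B (emb a *\<^sub>B q)"
          using m[OF Jc[OF x] a(1)] q(2) m_comm[OF Jc[OF x] Jc[OF a(1)]] by simp
        also have "\<dots> = emb a *\<^sub>B (emb x *\<^sub>B q)"
          using Jc[OF x] Jc[OF a(1)] q(1) by (simp add: Z.S.m_lcomm)
        finally have "f x = emb x *\<^sub>B q"
          by (rule emb_cancel[OF Jc[OF a(1)] a(2), rotated -1]) (use fc[OF x] Jc[OF x] q(1) in simp_all)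
        then show ?thesis using fc[OF x] by (simp add: Z.S.minus_eq Z.S.r_neg)
      qed
      then show ?thesis using q(1) by blast
    qed
  qed
qed

text \<open>
  Let f represent a linear map from an ideal J to Q/R and let a in J be nonzero. Subtracting
  multiplication by f(a)/a makes the map vanish at a; its values are then annihilated by a, so a f
  takes values in R modulo aR. The hypothesis on R/aR gives a multiplier c, and
  f is multiplication by f(a)/a + c/a.
\<close>

lemma injective_fraction_field_quotient:
  assumes "principal_quotients_self_injective R"
  shows "injective_module T R (coset_module B emb (emb ` carrier R))"
proof -
  interpret P: scalar_submodule R B emb "emb ` carrier R" by (rule scalar_submodule_emb)
  have embc: "emb r \<in> carrier B" if "r \<in> carrier R" for r using that by simp
  show ?thesis
  proof (rule P.injective_coset_module)
    fix J f
    assume J: "ideal J R" and f: "f \<in> J \<rightarrow> carrier B"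
      and add: "\<And>x y. \<lbrakk>x \<in> J; y \<in> J\<rbrakk> \<Longrightarrow> f (x \<oplus> y) -\<^sub>B (f x +\<^sub>B f y) \<in> emb ` carrier R"
      and mult: "\<And>r x. \<lbrakk>r \<in> carrier R; x \<in> J\<rbrakk> \<Longrightarrow> f (r \<otimes> x) -\<^sub>B emb r *\<^sub>B f x \<in> emb ` carrier R"
    interpret J: ideal J R by fact
    have Jc: "x \<in> carrier R" if "x \<in> J" for x using that J.a_subset by blast
    have fc: "f x \<in> carrier B" if "x \<in> J" for x using f that by blast
    show "\<exists>q\<in>carrier B. \<forall>x\<in>J. f x -\<^sub>B emb x *\<^sub>B q \<in> emb ` carrier R"
    proof (cases "J = {\<zero>}")
      case True
      have "f (\<zero> \<otimes> \<zero>) -\<^sub>B emb \<zero> *\<^sub>B f \<zero> \<in> emb ` carrier R"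
        by (rule mult) (use J.zero_closed in auto)
      then have "f \<zero> -\<^sub>B emb \<zero> *\<^sub>B \<zero>\<^bsub>B\<^esub> \<in> emb ` carrier R"
        using fc[OF J.zero_closed] by simp
      then show ?thesis using True by blast
    next
      case False
      then obtain a where a: "a \<in> J" "a \<noteq> \<zero>" using J.zero_closed by blast
      have ac: "a \<in> carrier R" using Jc a by blast
      interpret A: ideal "PIdl a" R by (rule cgenideal_ideal[OF ac])
      define ea where "ea = emb a"
      have eac: "ea \<in> carrier B" unfolding ea_def using ac by simp
      obtain q0 where q0: "q0 \<in> carrier B" "ea *\<^sub>B q0 = f a"
        using division[OF ac a(2) fc[OF a(1)]] unfolding ea_def .
      \<comment> \<open>g x is a times the value at x of f minus multiplication by f(a)/a. It lies in R because f is linear modulo R.\<close>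
      define g where "g x = ea *\<^sub>B f x -\<^sub>B emb x *\<^sub>B f a" for x
      have "\<exists>r. r \<in> carrier R \<and> emb r = g x" if x: "x \<in> J" for x
      proof -
        obtain u where u: "u \<in> carrier R" "f (a \<otimes> x) -\<^sub>B emb a *\<^sub>B f x = emb u"
          using mult[OF ac x] by blast
        obtain v where v: "v \<in> carrier R" "f (x \<otimes> a) -\<^sub>B emb x *\<^sub>B f a = emb v"
          using mult[OF Jc[OF x] a(1)] by blast
        obtain fax fx fa ex where d: "fax = f (a \<otimes> x)" "fx = f x" "fa = f a" "ex = emb x" by blast
        have c: "fax \<in> carrier B" "fx \<in> carrier B" "fa \<in> carrier B" "ex \<in> carrier B"
          unfolding d using fc[OF J.I_l_closed[OF x ac]] fc[OF x] fc[OF a(1)] Jc[OF x] by simp_all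
        have xa: "f (x \<otimes> a) = fax" using m_comm[OF Jc[OF x] ac] d(1) by simp
        have "emb (v \<ominus> u) = emb v -\<^sub>B emb u" using u v by (simp add: minus_eq P.S.minus_eq)
        also have "\<dots> = (fax -\<^sub>B ex *\<^sub>B fa) -\<^sub>B (fax -\<^sub>B ea *\<^sub>B fx)"
          using u(2) v(2) xa unfolding d ea_def by simp
        also have "\<dots> = ea *\<^sub>B fx -\<^sub>B ex *\<^sub>B fa"
          using c eac by algebra
        finally have "emb (v \<ominus> u) = g x" unfolding g_def d .
        then show ?thesis using u v by blast
      qed
      then obtain k where k: "\<And>x. x \<in> J \<Longrightarrow> k x \<in> carrier R" "\<And>x. x \<in> J \<Longrightarrow> emb (k x) = g x"
        by metis
      have PI: "r \<in> PIdl a" if r: "r \<in> carrier R" "emb r = ea *\<^sub>B y" "y \<in> emb ` carrier R" for r y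
      proof -
        obtain s where s: "s \<in> carrier R" "y = emb s" using r(3) by blast
        have "emb r = emb (a \<otimes> s)" using r(2) s ac unfolding ea_def by simp
        then have "r = a \<otimes> s" using emb_eq_iff r(1) s ac m_closed by blast
        then show ?thesis using s ac m_comm unfolding cgenideal_def by blast
      qed
      have "k \<in> J \<rightarrow> carrier R" using k by blast
      moreover have "k (x \<oplus> y) \<ominus> (k x \<oplus> k y) \<in> PIdl a" if xy: "x \<in> J" "y \<in> J" for x y
      proof (rule PI)
        have xyJ: "x \<oplus> y \<in> J" using J.a_closed xy by blast
        show "k (x \<oplus> y) \<ominus> (k x \<oplus> k y) \<in> carrier R" using k(1) xy xyJ by simp
        obtain fxy fx fy fa ex ey where d: "fxy = f (x \<oplus> y)" "fx = f x" "fy = f y" "fa = f a" "ex = emb x" "ey = emb y" by blast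
        have c: "fxy \<in> carrier B" "fx \<in> carrier B" "fy \<in> carrier B" "fa \<in> carrier B" "ex \<in> carrier B" "ey \<in> carrier B"
          unfolding d using fc[OF xyJ] fc[OF xy(1)] fc[OF xy(2)] fc[OF a(1)] Jc xy by simp_all
        have "emb (k (x \<oplus> y) \<ominus> (k x \<oplus> k y)) = g (x \<oplus> y) -\<^sub>B (g x +\<^sub>B g y)"
          using k xy xyJ by (simp add: minus_eq P.S.minus_eq)
        also have "\<dots> = (ea *\<^sub>B fxy -\<^sub>B (ex +\<^sub>B ey) *\<^sub>B fa)
            -\<^sub>B ((ea *\<^sub>B fx -\<^sub>B ex *\<^sub>B fa) +\<^sub>B (ea *\<^sub>B fy -\<^sub>B ey *\<^sub>B fa))"
          unfolding g_def d using Jc xy by simp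
        also have "\<dots> = ea *\<^sub>B (fxy -\<^sub>B (fx +\<^sub>B fy))"
          using c eac by algebra
        finally show "emb (k (x \<oplus> y) \<ominus> (k x \<oplus> k y)) = ea *\<^sub>B (f (x \<oplus> y) -\<^sub>B (f x +\<^sub>B f y))"
          unfolding d .
        show "f (x \<oplus> y) -\<^sub>B (f x +\<^sub>B f y) \<in> emb ` carrier R" by (rule add[OF xy])
      qed
      moreover have "k (r \<otimes> x) \<ominus> r \<otimes> k x \<in> PIdl a" if rx: "r \<in> carrier R" "x \<in> J" for r x
      proof (rule PI)
        have rxJ: "r \<otimes> x \<in> J" using J.I_l_closed rx by blast
        show "k (r \<otimes> x) \<ominus> r \<otimes> k x \<in> carrier R" using k(1) rx rxJ by simp
        obtain frx fx fa er ex where d: "frx = f (r \<otimes> x)" "fx = f x" "fa = f a" "er = emb r" "ex = emb x" by blast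
        have c: "frx \<in> carrier B" "fx \<in> carrier B" "fa \<in> carrier B" "er \<in> carrier B" "ex \<in> carrier B"
          unfolding d using fc[OF rxJ] fc[OF rx(2)] fc[OF a(1)] Jc rx by simp_all
        have "emb (k (r \<otimes> x) \<ominus> r \<otimes> k x) = g (r \<otimes> x) -\<^sub>B er *\<^sub>B g x"
          unfolding d using k rx rxJ by (simp add: minus_eq P.S.minus_eq)
        also have "\<dots> = (ea *\<^sub>B frx -\<^sub>B (er *\<^sub>B ex) *\<^sub>B fa) -\<^sub>B er *\<^sub>B (ea *\<^sub>B fx -\<^sub>B ex *\<^sub>B fa)"
          unfolding g_def d using Jc rx by simp
        also have "\<dots> = ea *\<^sub>B (frx -\<^sub>B er *\<^sub>B fx)"
          using c eac by algebra
        finally show "emb (k (r \<otimes> x) \<ominus> r \<otimes> k x) = ea *\<^sub>B (f (r \<otimes> x) -\<^sub>B emb r *\<^sub>B f x)"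
          unfolding d .
        show "f (r \<otimes> x) -\<^sub>B emb r *\<^sub>B f x \<in> emb ` carrier R" by (rule mult[OF rx])
      qed
      moreover have "k a \<in> PIdl a"
      proof -
        have "emb (k a) = \<zero>\<^bsub>B\<^esub>"
          using k(2)[OF a(1)] fc[OF a(1)] eac unfolding g_def ea_def by (simp add: P.S.minus_eq P.S.r_neg)
        then have "k a = \<zero>" using emb_eq_iff[OF k(1)[OF a(1)] zero_closed] by simp
        then show ?thesis using A.zero_closed by simp
      qed
      ultimately have "\<exists>c\<in>carrier R. \<forall>x\<in>J. k x \<ominus> c \<otimes> x \<in> PIdl a"
        using assms[unfolded principal_quotients_self_injective_def, rule_format, of J a k] J a by simp
      then obtain c where c: "c \<in> carrier R" "\<And>x. x \<in> J \<Longrightarrow> k x \<ominus> c \<otimes> x \<in> PIdl a" by blast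
      obtain q1 where q1: "q1 \<in> carrier B" "ea *\<^sub>B q1 = emb c"
        using division[OF ac a(2) embc[OF c(1)]] unfolding ea_def .
      have "f x -\<^sub>B emb x *\<^sub>B (q0 +\<^sub>B q1) \<in> emb ` carrier R" if x: "x \<in> J" for x
      proof -
        obtain z where z: "z \<in> carrier R" "k x \<ominus> c \<otimes> x = z \<otimes> a"
          using c(2)[OF x] unfolding cgenideal_def by blast
        obtain fx ex ez where d: "fx = f x" "ex = emb x" "ez = emb z" by blast
        have cc: "fx \<in> carrier B" "ex \<in> carrier B" "ez \<in> carrier B" "q0 \<in> carrier B" "q1 \<in> carrier B"
          unfolding d using fc[OF x] Jc[OF x] z(1) q0(1) q1(1) by simp_all
        have "ez *\<^sub>B ea = emb (k x \<ominus> c \<otimes> x)" unfolding z(2) d ea_def using z(1) ac by simp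
        also have "\<dots> = g x -\<^sub>B emb c *\<^sub>B ex"
          unfolding d using k[OF x] c(1) Jc[OF x] by (simp add: minus_eq P.S.minus_eq)
        also have "\<dots> = (ea *\<^sub>B fx -\<^sub>B ex *\<^sub>B (ea *\<^sub>B q0)) -\<^sub>B (ea *\<^sub>B q1) *\<^sub>B ex"
          unfolding g_def d q0(2) q1(2) ..
        also have "\<dots> = ea *\<^sub>B (fx -\<^sub>B ex *\<^sub>B (q0 +\<^sub>B q1))"
          using cc eac by algebra
        finally have "ea *\<^sub>B (fx -\<^sub>B ex *\<^sub>B (q0 +\<^sub>B q1)) = ea *\<^sub>B ez"
          using cc(3) eac by (simp add: P.S.m_comm)
        then have "fx -\<^sub>B ex *\<^sub>B (q0 +\<^sub>B q1) = ez"
          unfolding ea_def by (rule emb_cancel[OF ac a(2), rotated -1]) (use cc in simp_all)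
        then show ?thesis unfolding d using z(1) by blast
      qed
      then show ?thesis using q0(1) q1(1) by blast
    qed
  qed
qed

lemma injective_trivial_module:
  "injective_module T R (coset_module B emb (carrier B))"
proof -
  interpret C: scalar_submodule R B emb "carrier B" by (rule scalar_submodule_carrier)
  show ?thesis
  proof (rule C.injective_coset_module)
    fix J f assume "ideal J R" and f: "f \<in> J \<rightarrow> carrier B"
    interpret J: ideal J R by fact
    have "x \<in> carrier R" if "x \<in> J" for x using that J.a_subset by blast
    then show "\<exists>q\<in>carrier B. \<forall>x\<in>J. f x -\<^sub>B emb x *\<^sub>B q \<in> carrier B"
      using f by (intro bexI[OF _ C.zero_closed] ballI C.S.minus_closed) auto
  qed
qed

text \<open>
  The resolution is R, Q, Q/R, followed by zero modules, which appear as Q/Q.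
\<close>

theorem finite_self_injective_dimension_domain:
  assumes "principal_quotients_self_injective R"
  shows "finite_self_injective_dimension TYPE('m) R"
proof -
  interpret Z: scalar_submodule R B emb "{\<zero>\<^bsub>B\<^esub>}" by (rule scalar_submodule_zero)
  interpret P: scalar_submodule R B emb "emb ` carrier R" by (rule scalar_submodule_emb)
  interpret C: scalar_submodule R B emb "carrier B" by (rule scalar_submodule_carrier)
  define I where "I i = (if i = 0 then Z.E else if i = 1 then P.E else C.E)" for i :: nat
  define \<epsilon> where "\<epsilon> r = {\<zero>\<^bsub>B\<^esub>} +>\<^bsub>B\<^esub> emb r" for r
  define d where "d i X = (if i = 0 then \<Union>x\<in>X. (emb ` carrier R) +>\<^bsub>B\<^esub> x else carrier B)" for i :: nat and X
  have singleton: "{\<zero>\<^bsub>B\<^esub>} +>\<^bsub>B\<^esub> x = {x}" if "x \<in> carrier B" for x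
    using that unfolding a_r_coset_def' by simp
  have d0: "d 0 ({\<zero>\<^bsub>B\<^esub>} +>\<^bsub>B\<^esub> x) = (emb ` carrier R) +>\<^bsub>B\<^esub> x" if "x \<in> carrier B" for x
    unfolding d_def using singleton[OF that] by simp
  have Ccoset: "carrier B +>\<^bsub>B\<^esub> x = carrier B" if "x \<in> carrier B" for x
    using C.a_rcos_const[OF that] .
  have CE: "carrier C.E = {carrier B}"
    unfolding C.carrier_coset_module using Ccoset by auto
  have Csmult: "r \<odot>\<^bsub>C.E\<^esub> carrier B = carrier B" if "r \<in> carrier R" for r
    using C.coset_smult[OF that, of "\<zero>\<^bsub>B\<^esub>"] Ccoset that by simp
  have Cadd: "carrier B \<oplus>\<^bsub>C.E\<^esub> carrier B = carrier B"
    using C.coset_add[of "\<zero>\<^bsub>B\<^esub>" "\<zero>\<^bsub>B\<^esub>"] Ccoset by simp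
  have "injective_resolution TYPE('m) R (self_module R) I \<epsilon> d"
    unfolding injective_resolution_def
  proof (intro conjI allI)
    show "injective_module TYPE('m) R (I i)" for i
      unfolding I_def
      using injective_fraction_field[of "TYPE('m)"] injective_trivial_module[of "TYPE('m)"]
        injective_fraction_field_quotient[OF assms, of "TYPE('m)"] by simp
    show "\<epsilon> \<in> linear_maps R (self_module R) (I 0)"
      unfolding linear_maps_def self_module_def I_def \<epsilon>_def
      using Z.coset_closed[OF emb_closed] Z.coset_add[OF emb_closed emb_closed]
        Z.coset_smult[OF _ emb_closed] by auto
    show "inj_on \<epsilon> (carrier (self_module R))"
      unfolding self_module_def \<epsilon>_def inj_on_def using singleton emb_eq_iff by auto
    show "d i \<in> linear_maps R (I i) (I (Suc i))" for i
    proof (cases "i = 0")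
      case True
      have "d 0 \<in> linear_maps R Z.E P.E"
        unfolding linear_maps_def
      proof (intro CollectI conjI ballI funcsetI)
        fix X assume "X \<in> carrier Z.E"
        then obtain x where x: "x \<in> carrier B" "X = {\<zero>\<^bsub>B\<^esub>} +>\<^bsub>B\<^esub> x" by (rule Z.coset_module_cases)
        show "d 0 X \<in> carrier P.E" unfolding x(2) d0[OF x(1)] by (rule P.coset_closed[OF x(1)])
        fix Y assume "Y \<in> carrier Z.E"
        then obtain y where y: "y \<in> carrier B" "Y = {\<zero>\<^bsub>B\<^esub>} +>\<^bsub>B\<^esub> y" by (rule Z.coset_module_cases)
        show "d 0 (X \<oplus>\<^bsub>Z.E\<^esub> Y) = d 0 X \<oplus>\<^bsub>P.E\<^esub> d 0 Y"
          unfolding x(2) y(2) Z.coset_add[OF x(1) y(1)] d0[OF x(1)] d0[OF y(1)]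
            P.coset_add[OF x(1) y(1)] by (rule d0[OF Z.S.a_closed[OF x(1) y(1)]])
      next
        fix r X assume r: "r \<in> carrier R" and "X \<in> carrier Z.E"
        then obtain x where x: "x \<in> carrier B" "X = {\<zero>\<^bsub>B\<^esub>} +>\<^bsub>B\<^esub> x" by (metis Z.coset_module_cases)
        show "d 0 (r \<odot>\<^bsub>Z.E\<^esub> X) = r \<odot>\<^bsub>P.E\<^esub> d 0 X"
          unfolding x(2) Z.coset_smult[OF r x(1)] d0[OF x(1)] P.coset_smult[OF r x(1)]
          by (rule d0[OF Z.S.m_closed[OF emb_closed[OF r] x(1)]])
      qed
      then show ?thesis using True unfolding I_def by simp
    next
      case False
      then show ?thesis
        unfolding linear_maps_def I_def d_def using CE Csmult Cadd by auto
    qed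
    show "\<epsilon> ` carrier (self_module R) = a_kernel (I 0) (I 1) (d 0)"
    proof -
      have "a_kernel (I 0) (I 1) (d 0) = {X \<in> carrier Z.E. d 0 X = emb ` carrier R}"
        unfolding a_kernel_def' I_def using P.coset_zero(1) by simp
      also have "\<dots> = {{\<zero>\<^bsub>B\<^esub>} +>\<^bsub>B\<^esub> x | x. x \<in> emb ` carrier R}"
      proof (intro equalityI subsetI)
        fix X assume "X \<in> {X \<in> carrier Z.E. d 0 X = emb ` carrier R}"
        then have X: "X \<in> carrier Z.E" "d 0 X = emb ` carrier R" by blast+
        obtain x where x: "x \<in> carrier B" "X = {\<zero>\<^bsub>B\<^esub>} +>\<^bsub>B\<^esub> x"
          using Z.coset_module_cases[OF X(1)] .
        have "emb ` carrier R +>\<^bsub>B\<^esub> x = emb ` carrier R" using X(2) d0[OF x(1)] x(2) by simp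
        then have "x \<in> emb ` carrier R" using P.a_rcos_self[OF x(1)] by simp
        then show "X \<in> {{\<zero>\<^bsub>B\<^esub>} +>\<^bsub>B\<^esub> x | x. x \<in> emb ` carrier R}" using x(2) by blast
      next
        fix X assume "X \<in> {{\<zero>\<^bsub>B\<^esub>} +>\<^bsub>B\<^esub> x | x. x \<in> emb ` carrier R}"
        then obtain x where x: "x \<in> emb ` carrier R" "X = {\<zero>\<^bsub>B\<^esub>} +>\<^bsub>B\<^esub> x" by blast
        have xc: "x \<in> carrier B" using x(1) emb_closed by blast
        have "d 0 X = emb ` carrier R" unfolding x(2) d0[OF xc] by (rule P.a_rcos_const[OF x(1)])
        then show "X \<in> {X \<in> carrier Z.E. d 0 X = emb ` carrier R}"
          using Z.coset_closed[OF xc] x(2) by blast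
      qed
      also have "\<dots> = \<epsilon> ` carrier (self_module R)"
        unfolding self_module_def \<epsilon>_def by auto
      finally show ?thesis ..
    qed
    show "d i ` carrier (I i) = a_kernel (I (Suc i)) (I (Suc (Suc i))) (d (Suc i))" for i
    proof -
      have k: "a_kernel (I (Suc i)) (I (Suc (Suc i))) (d (Suc i)) = carrier (I (Suc i))"
        unfolding a_kernel_def' I_def d_def using C.coset_zero(1) by simp
      show ?thesis
      proof (cases "i = 0")
        case True
        have "d 0 ` carrier Z.E = (\<lambda>x. d 0 ({\<zero>\<^bsub>B\<^esub>} +>\<^bsub>B\<^esub> x)) ` carrier B"
          unfolding Z.carrier_coset_module by blast
        also have "\<dots> = (\<lambda>x. emb ` carrier R +>\<^bsub>B\<^esub> x) ` carrier B"
          by (rule image_cong[OF refl d0])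
        also have "\<dots> = carrier P.E"
          unfolding P.carrier_coset_module by blast
        finally have "d 0 ` carrier Z.E = carrier P.E" .
        then show ?thesis using True k unfolding I_def by simp
      next
        case False
        have "carrier (I i) \<noteq> {}"
          unfolding I_def using P.coset_closed[of "\<zero>\<^bsub>B\<^esub>"] CE False by auto
        then have "d i ` carrier (I i) = {carrier B}" unfolding d_def using False by auto
        then show ?thesis using False k CE unfolding I_def by simp
      qed
    qed
  qed
  moreover have "\<forall>i>1. carrier (I i) = {\<zero>\<^bsub>I i\<^esub>}"
    unfolding I_def using CE C.coset_zero(1) by simp
  ultimately show ?thesis unfolding finite_self_injective_dimension_def by blast
qed

end

section \<open>Linear forms and orthogonal complements\<close>

text \<open>
  A linear form on the K-subalgebra C of R defines the symmetric bilinear form that sends (x, y)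
  to the value at x y. Except where dimensions are counted, the duality lemmas refer to finite lists of
  vectors only, so C may have infinite dimension over K, as is needed for algebras of polynomials.
\<close>

locale linear_form = cring R for R (structure) +
  fixes K C \<phi>
  assumes K: "subfield K R"
    and C: "subring C R"
    and KC: "K \<subseteq> C"
    and form_closed: "x \<in> C \<Longrightarrow> \<phi> x \<in> K"
    and form_add: "\<lbrakk>x \<in> C; y \<in> C\<rbrakk> \<Longrightarrow> \<phi> (x \<oplus> y) = \<phi> x \<oplus> \<phi> y"
    and form_smult: "\<lbrakk>k \<in> K; x \<in> C\<rbrakk> \<Longrightarrow> \<phi> (k \<otimes> x) = k \<otimes> \<phi> x"
begin

definition perp where "perp us = {c \<in> C. \<forall>v\<in>set us. \<phi> (c \<otimes> v) = \<zero>}"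

lemma C_carrier: "x \<in> C \<Longrightarrow> x \<in> carrier R"
  using subringE(1)[OF C] by blast

lemma K_carrier: "k \<in> K \<Longrightarrow> k \<in> carrier R"
  using KC C_carrier by blast

lemma K_closed:
  "\<zero> \<in> K" "\<one> \<in> K" "\<lbrakk>k \<in> K; l \<in> K\<rbrakk> \<Longrightarrow> k \<oplus> l \<in> K" "\<lbrakk>k \<in> K; l \<in> K\<rbrakk> \<Longrightarrow> k \<otimes> l \<in> K"
  "k \<in> K \<Longrightarrow> \<ominus> k \<in> K" "\<lbrakk>k \<in> K; l \<in> K\<rbrakk> \<Longrightarrow> k \<ominus> l \<in> K"
  using subringE[OF subfieldE(1)[OF K]] by (auto simp: a_minus_def)

lemma C_closed:
  "\<zero> \<in> C" "\<one> \<in> C" "\<lbrakk>k \<in> C; l \<in> C\<rbrakk> \<Longrightarrow> k \<oplus> l \<in> C" "\<lbrakk>k \<in> C; l \<in> C\<rbrakk> \<Longrightarrow> k \<otimes> l \<in> C"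
  "k \<in> C \<Longrightarrow> \<ominus> k \<in> C" "\<lbrakk>k \<in> C; l \<in> C\<rbrakk> \<Longrightarrow> k \<ominus> l \<in> C" "\<lbrakk>k \<in> K; l \<in> C\<rbrakk> \<Longrightarrow> k \<otimes> l \<in> C"
  using subringE[OF C] KC by (auto simp: a_minus_def)

lemma K_inverse:
  assumes "k \<in> K" "k \<noteq> \<zero>"
  shows "inv k \<in> K" "inv k \<otimes> k = \<one>" "k \<otimes> inv k = \<one>"
  using subfield_m_inv[OF K] assms by auto

lemma subalgebra_C: "subalgebra K C R"
  using C_closed C_carrier by unfold_locales (auto simp: a_inv_def[symmetric])

lemma form_zero: "\<phi> \<zero> = \<zero>"
  using form_smult[OF K_closed(1) C_closed(1)] K_carrier[OF form_closed[OF C_closed(1)]] by simp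

lemma form_minus:
  assumes "x \<in> C" "y \<in> C"
  shows "\<phi> (x \<ominus> y) = \<phi> x \<ominus> \<phi> y"
proof -
  have "\<ominus> y = (\<ominus> \<one>) \<otimes> y" using assms C_carrier by (simp add: l_minus)
  then have "\<phi> (\<ominus> y) = (\<ominus> \<one>) \<otimes> \<phi> y"
    using form_smult[of "\<ominus> \<one>" y] K_closed assms by simp
  then have "\<phi> (\<ominus> y) = \<ominus> \<phi> y"
    using K_carrier[OF form_closed[OF assms(2)]] by (simp add: l_minus)
  then show ?thesis using form_add[OF assms(1) C_closed(5)[OF assms(2)]] by (simp add: minus_eq)
qed

lemma Span_in_C: "set us \<subseteq> C \<Longrightarrow> Span K us \<subseteq> C"
  by (rule subalgebra_Span_incl[OF K subalgebra_C])

lemma subalgebra_perp: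
  assumes "set us \<subseteq> C"
  shows "subalgebra K (perp us) R"
proof (intro subalgebra.intro subalgebra_axioms.intro)
  show "subgroup (perp us) (add_monoid R)"
  proof (rule add.subgroupI)
    show "perp us \<subseteq> carrier R" unfolding perp_def using C_carrier by blast
    have "\<phi> (\<zero> \<otimes> v) = \<zero>" if "v \<in> set us" for v
      using that assms C_carrier form_zero by auto
    then have "\<zero> \<in> perp us" unfolding perp_def using C_closed(1) by blast
    then show "perp us \<noteq> {}" by blast
    fix x assume x: "x \<in> perp us"
    have "\<phi> ((\<ominus> x) \<otimes> v) = \<zero>" if v: "v \<in> set us" for v
    proof -
      have xC: "x \<in> C" "v \<in> C" "\<phi> (x \<otimes> v) = \<zero>" using x v assms unfolding perp_def by auto
      have "(\<ominus> x) \<otimes> v = \<zero> \<ominus> x \<otimes> v" using xC C_carrier by (simp add: l_minus minus_eq)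
      then show ?thesis
        using form_minus[OF C_closed(1) C_closed(4)[OF xC(1,2)]] form_zero xC(3) by (simp add: minus_eq)
    qed
    then show "\<ominus> x \<in> perp us" using x C_closed(5) unfolding perp_def by blast
    fix y assume y: "y \<in> perp us"
    have "\<phi> ((x \<oplus> y) \<otimes> v) = \<zero>" if v: "v \<in> set us" for v
    proof -
      have xC: "x \<in> C" "y \<in> C" "v \<in> C" "\<phi> (x \<otimes> v) = \<zero>" "\<phi> (y \<otimes> v) = \<zero>"
        using x y v assms unfolding perp_def by auto
      have "(x \<oplus> y) \<otimes> v = x \<otimes> v \<oplus> y \<otimes> v" using xC C_carrier by (simp add: l_distr)
      then show ?thesis using form_add[OF C_closed(4)[OF xC(1,3)] C_closed(4)[OF xC(2,3)]] xC(4,5) by simp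
    qed
    then show "x \<oplus> y \<in> perp us" using x y C_closed(3) unfolding perp_def by blast
  qed
  fix k x assume k: "k \<in> K" and x: "x \<in> perp us"
  have "\<phi> ((k \<otimes> x) \<otimes> v) = \<zero>" if v: "v \<in> set us" for v
  proof -
    have xC: "x \<in> C" "v \<in> C" "\<phi> (x \<otimes> v) = \<zero>" using x v assms unfolding perp_def by auto
    have "(k \<otimes> x) \<otimes> v = k \<otimes> (x \<otimes> v)" using xC k C_carrier K_carrier by (simp add: m_assoc)
    then show ?thesis using form_smult[OF k C_closed(4)[OF xC(1,2)]] xC(3) K_carrier[OF k] by simp
  qed
  then show "k \<otimes> x \<in> perp us" using x k C_closed(7) unfolding perp_def by blast
qed

lemma perp_Span:
  assumes "set us \<subseteq> C" "c \<in> perp us" "x \<in> Span K us"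
  shows "\<phi> (c \<otimes> x) = \<zero>"
  using assms
proof (induction us arbitrary: x)
  case Nil
  then have "x = \<zero>" "c \<in> C" by (auto simp: perp_def)
  then show ?case using C_carrier form_zero by simp
next
  case (Cons u us)
  obtain k w where x: "k \<in> K" "w \<in> Span K us" "x = k \<otimes> u \<oplus> w"
    using Cons.prems(3) line_extension_mem_iff by auto
  have c: "c \<in> C" "u \<in> C" "w \<in> C" "\<phi> (c \<otimes> u) = \<zero>"
    using Cons.prems Span_in_C x(2) unfolding perp_def by auto
  have "c \<in> perp us" using Cons.prems(2) unfolding perp_def by auto
  then have w: "\<phi> (c \<otimes> w) = \<zero>" using Cons x(2) by auto
  have "c \<otimes> x = k \<otimes> (c \<otimes> u) \<oplus> c \<otimes> w"
    unfolding x(3) using c x(1) C_carrier K_carrier by (simp add: r_distr m_lcomm)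
  then show ?case
    using form_add[OF C_closed(7)[OF x(1) C_closed(4)[OF c(1,2)]] C_closed(4)[OF c(1,3)]]
      form_smult[OF x(1) C_closed(4)[OF c(1,2)]] c(4) w K_carrier[OF x(1)] by simp
qed

lemma perp_normalize:
  assumes "set us \<subseteq> C" "c \<in> perp us" "u \<in> C" "\<phi> (c \<otimes> u) \<noteq> \<zero>"
  obtains c0 where "c0 \<in> perp us" "\<phi> (c0 \<otimes> u) = \<one>"
proof
  have c: "c \<in> C" using assms(2) unfolding perp_def by blast
  have k: "inv (\<phi> (c \<otimes> u)) \<in> K" "inv (\<phi> (c \<otimes> u)) \<otimes> \<phi> (c \<otimes> u) = \<one>"
    using K_inverse[OF form_closed[OF C_closed(4)[OF c assms(3)]] assms(4)] by auto
  show "inv (\<phi> (c \<otimes> u)) \<otimes> c \<in> perp us"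
    using subalgebra.smult_closed[OF subalgebra_perp[OF assms(1)] k(1) assms(2)] .
  have "(inv (\<phi> (c \<otimes> u)) \<otimes> c) \<otimes> u = inv (\<phi> (c \<otimes> u)) \<otimes> (c \<otimes> u)"
    using C_carrier c assms(3) K_carrier[OF k(1)] by (simp add: m_assoc)
  then show "\<phi> ((inv (\<phi> (c \<otimes> u)) \<otimes> c) \<otimes> u) = \<one>"
    using form_smult[OF k(1) C_closed(4)[OF c assms(3)]] k(2) by simp
qed

text \<open>
  A functional that vanishes on the common kernel of finitely many functionals is a combination
  of them. The induction removes one vector w at a time: if w imposes a new condition, some c0
  orthogonal to the remaining vectors pairs to one with w, and u is replaced by its component
  orthogonal to c0.
\<close>

lemma double_annihilator:
  assumes "set us \<subseteq> C" "u \<in> C" "\<And>c. c \<in> perp us \<Longrightarrow> \<phi> (c \<otimes> u) = \<zero>"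
  shows "\<exists>v\<in>Span K us. \<forall>c\<in>C. \<phi> (c \<otimes> (u \<ominus> v)) = \<zero>"
  using assms
proof (induction us arbitrary: u)
  case Nil
  have "\<phi> (c \<otimes> (u \<ominus> \<zero>)) = \<zero>" if "c \<in> C" for c
    using Nil.prems(2,3) that C_carrier unfolding perp_def by (simp add: minus_eq)
  then show ?case by simp
next
  case (Cons w us)
  have us: "set us \<subseteq> C" "w \<in> C" using Cons.prems(1) by auto
  have Span: "Span K us \<subseteq> Span K (w # us)"
    by (rule mono_Span[OF K]) (use us C_carrier in auto)
  show ?case
  proof (cases "\<forall>c\<in>perp us. \<phi> (c \<otimes> w) = \<zero>")
    case True
    then have "perp us \<subseteq> perp (w # us)" unfolding perp_def by auto
    then have "\<exists>v\<in>Span K us. \<forall>c\<in>C. \<phi> (c \<otimes> (u \<ominus> v)) = \<zero>"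
      by (intro Cons.IH us Cons.prems(2,3)) blast
    then show ?thesis using Span by blast
  next
    case False
    then obtain c' where "c' \<in> perp us" "\<phi> (c' \<otimes> w) \<noteq> \<zero>" by blast
    then obtain c0 where c0: "c0 \<in> perp us" "\<phi> (c0 \<otimes> w) = \<one>"
      using perp_normalize[OF us(1) _ us(2)] by blast
    have c0C: "c0 \<in> C" using c0(1) unfolding perp_def by blast
    define k where "k = \<phi> (c0 \<otimes> u)"
    have k: "k \<in> K" unfolding k_def by (intro form_closed C_closed c0C Cons.prems(2))
    have u': "u \<ominus> k \<otimes> w \<in> C" using k us Cons.prems(2) C_closed by simp
    have "\<phi> (c \<otimes> (u \<ominus> k \<otimes> w)) = \<zero>" if c: "c \<in> perp us" for c
    proof -
      have cC: "c \<in> C" using c unfolding perp_def by blast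
      define l where "l = \<phi> (c \<otimes> w)"
      have l: "l \<in> K" unfolding l_def by (intro form_closed C_closed cC us)
      have "c \<ominus> l \<otimes> c0 \<in> perp us"
      proof -
        interpret P: subalgebra K "perp us" R by (rule subalgebra_perp[OF us(1)])
        have "\<ominus> (l \<otimes> c0) \<in> perp us"
          using P.m_inv_closed[OF P.smult_closed[OF l c0(1)]] by (simp add: a_inv_def[symmetric])
        then show ?thesis using P.m_closed[OF c] by (simp add: minus_eq)
      qed
      moreover have lw: "\<phi> ((c \<ominus> l \<otimes> c0) \<otimes> v) = \<phi> (c \<otimes> v) \<ominus> l \<otimes> \<phi> (c0 \<otimes> v)" if "v \<in> C" for v
      proof -
        have "(c \<ominus> l \<otimes> c0) \<otimes> v = c \<otimes> v \<ominus> l \<otimes> (c0 \<otimes> v)"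
          using that cC c0C K_carrier[OF l] C_carrier by (simp add: minus_eq l_distr l_minus m_assoc)
        then show ?thesis using form_minus form_smult l C_closed(4,7) that cC c0C by simp
      qed
      moreover have "\<phi> ((c \<ominus> l \<otimes> c0) \<otimes> w) = \<zero>"
        using lw[OF us(2)] c0(2) K_carrier[OF l] unfolding l_def by (simp add: minus_eq r_neg)
      ultimately have "c \<ominus> l \<otimes> c0 \<in> perp (w # us)" unfolding perp_def by simp
      then have "\<phi> (c \<otimes> u) \<ominus> l \<otimes> k = \<zero>"
        using Cons.prems(3) lw[OF Cons.prems(2)] unfolding k_def by simp
      moreover have "\<phi> (c \<otimes> (u \<ominus> k \<otimes> w)) = \<phi> (c \<otimes> u) \<ominus> k \<otimes> l"
      proof -
        have "c \<otimes> (u \<ominus> k \<otimes> w) = c \<otimes> u \<ominus> k \<otimes> (c \<otimes> w)"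
          using cC us(2) Cons.prems(2) K_carrier[OF k] C_carrier by (simp add: minus_eq r_distr r_minus m_lcomm)
        then show ?thesis
          using form_minus form_smult k C_closed(4,7) cC us(2) Cons.prems(2) unfolding l_def by simp
      qed
      ultimately show ?thesis using k l K_carrier by (simp add: m_comm)
    qed
    then obtain v where v: "v \<in> Span K us" "\<forall>c\<in>C. \<phi> (c \<otimes> ((u \<ominus> k \<otimes> w) \<ominus> v)) = \<zero>"
      using Cons.IH[OF us(1) u'] by blast
    have vC: "v \<in> C" using Span_in_C[OF us(1)] v(1) by blast
    have "(u \<ominus> k \<otimes> w) \<ominus> v = u \<ominus> (k \<otimes> w \<oplus> v)"
      using Cons.prems(2) us(2) vC K_carrier[OF k] C_carrier by (simp add: minus_eq minus_add a_assoc)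
    moreover have "k \<otimes> w \<oplus> v \<in> Span K (w # us)"
      using line_extension_mem_iff k v(1) by auto
    ultimately show ?thesis using v(2) by metis
  qed
qed

text \<open>
  On a finitely spanned subspace, every functional that vanishes on the radical is represented by
  pairing with an element of C. The representing element is corrected for each new vector u, either
  by a vector orthogonal to the earlier ones, or, when there is none, by the observation that u lies in
  their span modulo the radical.
\<close>

lemma represent_functional:
  assumes I: "subalgebra K I R" "I \<subseteq> C" and us: "set us \<subseteq> I"
    and \<psi>K: "\<And>x. x \<in> I \<Longrightarrow> \<psi> x \<in> K"
    and \<psi>_add: "\<And>x y. \<lbrakk>x \<in> I; y \<in> I\<rbrakk> \<Longrightarrow> \<psi> (x \<oplus> y) = \<psi> x \<oplus> \<psi> y"
    and \<psi>_smult: "\<And>k x. \<lbrakk>k \<in> K; x \<in> I\<rbrakk> \<Longrightarrow> \<psi> (k \<otimes> x) = k \<otimes> \<psi> x"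
    and \<psi>_radical: "\<And>x. \<lbrakk>x \<in> I; \<forall>c\<in>C. \<phi> (c \<otimes> x) = \<zero>\<rbrakk> \<Longrightarrow> \<psi> x = \<zero>"
  shows "\<exists>c\<in>C. \<forall>x\<in>Span K us. \<phi> (c \<otimes> x) = \<psi> x"
  using us
proof (induction us)
  case Nil
  interpret I: subalgebra K I R by (rule I(1))
  have z: "\<zero> \<in> I" using I.one_closed by simp
  have "\<psi> \<zero> = \<zero>" using \<psi>_smult[OF K_closed(1) z] K_carrier[OF \<psi>K[OF z]] by simp
  then show ?case using C_closed(1) form_zero by (intro bexI[OF _ C_closed(1)]) simp
next
  case (Cons u us)
  interpret I: subalgebra K I R by (rule I(1))
  have us: "set us \<subseteq> I" "u \<in> I" "set us \<subseteq> C" "u \<in> C" using Cons.prems I(2) by auto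
  have SI: "Span K us \<subseteq> I" by (rule subalgebra_Span_incl[OF K I(1) us(1)])
  obtain c1 where c1: "c1 \<in> C" "\<And>x. x \<in> Span K us \<Longrightarrow> \<phi> (c1 \<otimes> x) = \<psi> x"
    using Cons.IH us(1) by blast
  have "\<exists>c\<in>C. \<phi> (c \<otimes> u) = \<psi> u \<and> (\<forall>x\<in>Span K us. \<phi> (c \<otimes> x) = \<psi> x)"
  proof (cases "\<forall>c\<in>perp us. \<phi> (c \<otimes> u) = \<zero>")
    case True
    then obtain v where v: "v \<in> Span K us" "\<forall>c\<in>C. \<phi> (c \<otimes> (u \<ominus> v)) = \<zero>"
      using double_annihilator[OF us(3,4)] by blast
    have vI: "v \<in> I" "v \<in> C" using v SI I(2) by auto
    have uvI: "u \<ominus> v \<in> I"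
      using I.m_closed[OF us(2) I.m_inv_closed[OF vI(1)]] by (simp add: minus_eq a_inv_def)
    have "u = (u \<ominus> v) \<oplus> v" using us(4) vI(2) C_carrier by (simp add: minus_eq a_assoc l_neg)
    then have "\<psi> u = \<psi> v"
      using \<psi>_add[OF uvI vI(1)] \<psi>_radical[OF uvI v(2)] K_carrier[OF \<psi>K[OF vI(1)]] by simp
    moreover have "\<phi> (c1 \<otimes> u) = \<phi> (c1 \<otimes> v)"
    proof -
      have "c1 \<otimes> (u \<ominus> v) = c1 \<otimes> u \<ominus> c1 \<otimes> v"
        using us(4) vI(2) c1(1) C_carrier by (simp add: minus_eq r_distr r_minus)
      moreover have "\<phi> (c1 \<otimes> (u \<ominus> v)) = \<zero>" using v(2) c1(1) by blast
      ultimately have "\<phi> (c1 \<otimes> u) \<ominus> \<phi> (c1 \<otimes> v) = \<zero>"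
        using c1(1) form_minus[of "c1 \<otimes> u" "c1 \<otimes> v"] C_closed(4) us(4) vI(2) by simp
      then show ?thesis
        using K_carrier form_closed C_closed(4) us(4) vI(2) c1(1) by simp
    qed
    ultimately show ?thesis using c1 v(1) by auto
  next
    case False
    then obtain c' where "c' \<in> perp us" "\<phi> (c' \<otimes> u) \<noteq> \<zero>" by blast
    then obtain c0 where c0: "c0 \<in> perp us" "\<phi> (c0 \<otimes> u) = \<one>"
      using perp_normalize[OF us(3) _ us(4)] by blast
    have c0C: "c0 \<in> C" using c0(1) unfolding perp_def by blast
    define k where "k = \<psi> u \<ominus> \<phi> (c1 \<otimes> u)"
    have k: "k \<in> K" unfolding k_def by (intro K_closed(6) form_closed C_closed(4) c1(1) \<psi>K us)
    have e: "\<phi> ((c1 \<oplus> k \<otimes> c0) \<otimes> x) = \<phi> (c1 \<otimes> x) \<oplus> k \<otimes> \<phi> (c0 \<otimes> x)" if x: "x \<in> C" for x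
    proof -
      have "(c1 \<oplus> k \<otimes> c0) \<otimes> x = c1 \<otimes> x \<oplus> k \<otimes> (c0 \<otimes> x)"
        using x c1(1) c0C K_carrier[OF k] C_carrier by (simp add: l_distr m_assoc)
      then show ?thesis using form_add form_smult k C_closed(4,7) x c1(1) c0C by simp
    qed
    have "\<phi> ((c1 \<oplus> k \<otimes> c0) \<otimes> u) = \<psi> u"
    proof -
      obtain p q where pq: "p = \<phi> (c1 \<otimes> u)" "q = \<psi> u" by blast
      have c: "p \<in> carrier R" "q \<in> carrier R"
        unfolding pq using K_carrier form_closed C_closed(4) c1(1) us \<psi>K by auto
      have "p \<oplus> (q \<ominus> p) \<otimes> \<one> = q" 
        using c by (simp add: minus_eq a_lcomm[of p q "\<ominus> p"] r_neg)
      then show ?thesis using e[OF us(4)] c0(2) unfolding k_def pq by simp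
    qed
    moreover have "\<phi> ((c1 \<oplus> k \<otimes> c0) \<otimes> x) = \<psi> x" if x: "x \<in> Span K us" for x
    proof -
      have xC: "x \<in> C" using x Span_in_C[OF us(3)] by blast
      show ?thesis
        using e[OF xC] perp_Span[OF us(3) c0(1) x] c1(2)[OF x] K_carrier[OF k]
          K_carrier[OF \<psi>K] x SI by auto
    qed
    moreover have "c1 \<oplus> k \<otimes> c0 \<in> C" using C_closed c1(1) c0C k by simp
    ultimately show ?thesis by blast
  qed
  then obtain c where c: "c \<in> C" "\<phi> (c \<otimes> u) = \<psi> u" "\<And>x. x \<in> Span K us \<Longrightarrow> \<phi> (c \<otimes> x) = \<psi> x"
    by blast
  have "\<phi> (c \<otimes> x) = \<psi> x" if x: "x \<in> Span K (u # us)" for x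
  proof -
    obtain k w where kw: "k \<in> K" "w \<in> Span K us" "x = k \<otimes> u \<oplus> w"
      using x line_extension_mem_iff by auto
    have w: "w \<in> I" "w \<in> C" using kw(2) SI I(2) by auto
    have "c \<otimes> x = k \<otimes> (c \<otimes> u) \<oplus> c \<otimes> w"
      unfolding kw(3) using c(1) us(4) w(2) kw(1) C_carrier K_carrier by (simp add: r_distr m_lcomm)
    then have "\<phi> (c \<otimes> x) = k \<otimes> \<phi> (c \<otimes> u) \<oplus> \<phi> (c \<otimes> w)"
      using form_add form_smult kw(1) C_closed(4,7) c(1) us(4) w(2) by simp
    then show ?thesis
      using \<psi>_add[OF I.smult_closed[OF kw(1) us(2)] w(1)] \<psi>_smult[OF kw(1) us(2)] c(2) c(3)[OF kw(2)] kw(3)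
      by simp
  qed
  then show ?case using c(1) by blast
qed

text \<open>
  Each independent vector lowers the dimension of the orthogonal complement by exactly one.
\<close>

lemma dimension_perp:
  assumes nondeg: "\<And>x. \<lbrakk>x \<in> C; \<forall>c\<in>C. \<phi> (c \<otimes> x) = \<zero>\<rbrakk> \<Longrightarrow> x = \<zero>"
    and dim: "dimension n K C" and "independent K us" "set us \<subseteq> C"
  shows "\<exists>d. dimension d K (perp us) \<and> d + length us = n"
  using assms(3,4)
proof (induction us rule: list.induct)
  case Nil
  then show ?case using dim unfolding perp_def by simp
next
  case (Cons u us)
  have us: "set us \<subseteq> C" "u \<in> C" using Cons.prems by auto
  have ind: "independent K us" "u \<notin> Span K us"
    using Cons.prems(1) independent_backwards by blast+
  obtain d where d: "dimension d K (perp us)" "d + length us = n"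
    using Cons.IH ind us by blast
  have sub: "perp (u # us) \<subseteq> perp us" unfolding perp_def by auto
  have sa: "subalgebra K (perp (u # us)) R" by (rule subalgebra_perp) (use us in auto)
  obtain d' where d': "dimension d' K (perp (u # us))"
    using subalbegra_incl_imp_finite_dimension[OF K finite_dimensionI[OF d(1)] sa sub] by blast
  have "\<exists>c\<in>perp us. \<phi> (c \<otimes> u) \<noteq> \<zero>"
  proof (rule ccontr)
    assume "\<not> (\<exists>c\<in>perp us. \<phi> (c \<otimes> u) \<noteq> \<zero>)"
    then obtain v where v: "v \<in> Span K us" "\<forall>c\<in>C. \<phi> (c \<otimes> (u \<ominus> v)) = \<zero>"
      using double_annihilator[OF us] by blast
    have vC: "v \<in> C" using v Span_in_C us by blast
    then have "u \<ominus> v = \<zero>" using nondeg[OF _ v(2)] C_closed(6) us(2) by blast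
    then have "u = v" using vC us(2) C_carrier by simp
    then show False using v(1) ind(2) by simp
  qed
  then obtain c0 where c0: "c0 \<in> perp us" "\<phi> (c0 \<otimes> u) = \<one>"
    using perp_normalize[OF us(1) _ us(2)] by blast
  have c0C: "c0 \<in> C" using c0(1) unfolding perp_def by blast
  interpret P: subalgebra K "perp us" R by (rule subalgebra_perp[OF us(1)])
  have "perp us = line_extension K c0 (perp (u # us))"
  proof (intro equalityI subsetI)
    fix c assume c: "c \<in> perp us"
    have cC: "c \<in> C" using c unfolding perp_def by blast
    define k where "k = \<phi> (c \<otimes> u)"
    have k: "k \<in> K" unfolding k_def by (intro form_closed C_closed(4) cC us)
    have "\<ominus> (k \<otimes> c0) \<in> perp us"
      using P.m_inv_closed[OF P.smult_closed[OF k c0(1)]] by (simp add: a_inv_def[symmetric])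
    then have m: "c \<ominus> k \<otimes> c0 \<in> perp us" using P.m_closed[OF c] by (simp add: minus_eq)
    have "(c \<ominus> k \<otimes> c0) \<otimes> u = c \<otimes> u \<ominus> k \<otimes> (c0 \<otimes> u)"
      using us(2) cC c0C K_carrier[OF k] C_carrier by (simp add: minus_eq l_distr l_minus m_assoc)
    then have "\<phi> ((c \<ominus> k \<otimes> c0) \<otimes> u) = k \<ominus> k \<otimes> \<one>"
      using form_minus form_smult k C_closed(4,7) us(2) cC c0C c0(2) unfolding k_def by simp
    then have "c \<ominus> k \<otimes> c0 \<in> perp (u # us)"
      using m K_carrier[OF k] unfolding perp_def by (simp add: minus_eq r_neg)
    moreover have "c = k \<otimes> c0 \<oplus> (c \<ominus> k \<otimes> c0)"
      using cC c0C K_carrier[OF k] C_carrier by (simp add: minus_eq a_lcomm r_neg)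
    ultimately show "c \<in> line_extension K c0 (perp (u # us))"
      using line_extension_mem_iff k by blast
  next
    fix c assume "c \<in> line_extension K c0 (perp (u # us))"
    then obtain k v where "k \<in> K" "v \<in> perp (u # us)" "c = k \<otimes> c0 \<oplus> v"
      using line_extension_mem_iff by auto
    then show "c \<in> perp us" using P.m_closed[OF P.smult_closed[OF _ c0(1)]] sub by auto
  qed
  moreover have "c0 \<notin> perp (u # us)"
    using c0(2) subfieldE(6)[OF K] unfolding perp_def by simp
  ultimately have "dimension (Suc d') K (perp us)"
    using Suc_dim[OF C_carrier[OF c0C] _ d'] by simp
  then have "d = Suc d'" using dimension_is_inj[OF K d(1)] by blast
  then show ?case using d' d(2) by auto
qed

end

section \<open>Duality on the field extension\<close>

locale codim_one = field L for L (structure) +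
  fixes K H n
  assumes K: "subfield K L"
    and dim_L: "dimension n K (carrier L)"
    and H: "subalgebra K H L"
    and KH: "K \<subseteq> H"
    and dim_H: "dimension (n - 1) K H"
    and n_pos: "n > 0"
begin

lemma H_closed:
  "h \<in> H \<Longrightarrow> h \<in> carrier L" "\<zero> \<in> H" "\<lbrakk>h \<in> H; h' \<in> H\<rbrakk> \<Longrightarrow> h \<oplus> h' \<in> H"
  "\<lbrakk>h \<in> H; h' \<in> H\<rbrakk> \<Longrightarrow> h \<ominus> h' \<in> H" "\<lbrakk>k \<in> K; h \<in> H\<rbrakk> \<Longrightarrow> k \<otimes> h \<in> H"
proof -
  interpret H: subalgebra K H L by (rule H)
  show "h \<in> H \<Longrightarrow> h \<in> carrier L" using subalgebra_in_carrier[OF H] by blast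
  show "\<zero> \<in> H" using H.one_closed by simp
  show "\<lbrakk>h \<in> H; h' \<in> H\<rbrakk> \<Longrightarrow> h \<oplus> h' \<in> H" using H.m_closed by simp
  show "\<lbrakk>h \<in> H; h' \<in> H\<rbrakk> \<Longrightarrow> h \<ominus> h' \<in> H"
    using H.m_closed[OF _ H.m_inv_closed, of h h'] by (simp add: minus_eq a_inv_def)
  show "\<lbrakk>k \<in> K; h \<in> H\<rbrakk> \<Longrightarrow> k \<otimes> h \<in> H" by (rule H.smult_closed)
qed

lemma K_carrier: "k \<in> K \<Longrightarrow> k \<in> carrier L"
  using subfieldE(3)[OF K] by blast

lemma proper: "\<exists>e\<in>carrier L. e \<notin> H"
proof (rule ccontr)
  assume "\<not> ?thesis"
  then have "H = carrier L" using H_closed(1) by blast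
  then have "n = n - 1" using dimension_is_inj[OF K dim_L, of "n - 1"] dim_H by simp
  then show False using n_pos by simp
qed

text \<open>
  Here dim H = n - 1 enters: any e outside H spans a complement of H.
\<close>

lemma complement:
  assumes e: "e \<in> carrier L" "e \<notin> H" and x: "x \<in> carrier L"
  shows "\<exists>k\<in>K. x \<ominus> k \<otimes> e \<in> H"
proof -
  have d: "dimension n K (line_extension K e H)"
    using Suc_dim[OF e dim_H] n_pos by simp
  obtain Vs where Vs: "set Vs \<subseteq> carrier L" "independent K Vs" "length Vs = n" "Span K Vs = line_extension K e H"
    using exists_base[OF K d] by blast
  then have "line_extension K e H = carrier L"
    using independent_length_eq_dimension[OF K dim_L Vs(2,1)] by simp
  then obtain k h where k: "k \<in> K" "h \<in> H" "x = k \<otimes> e \<oplus> h"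
    using x line_extension_mem_iff by blast
  have "x \<ominus> k \<otimes> e = h"
    unfolding k(3) using k(1,2) K_carrier H_closed(1) e(1) by (simp add: minus_eq a_ac r_neg r_neg2)
  then show ?thesis using k by blast
qed

text \<open>
  The coordinate along a complement of H is a K-linear form with kernel H.
\<close>

lemma form_with_kernel:
  "\<exists>\<phi>. linear_form L K (carrier L) \<phi> \<and> (\<forall>x\<in>carrier L. \<phi> x = \<zero> \<longleftrightarrow> x \<in> H)"
proof -
  obtain e where e: "e \<in> carrier L" "e \<notin> H" using proper by blast
  define \<phi> where "\<phi> x = (SOME k. k \<in> K \<and> x \<ominus> k \<otimes> e \<in> H)" for x
  have \<phi>: "\<phi> x \<in> K" "x \<ominus> \<phi> x \<otimes> e \<in> H" if "x \<in> carrier L" for x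
    using complement[OF e that] someI_ex[of "\<lambda>k. k \<in> K \<and> x \<ominus> k \<otimes> e \<in> H"]
    unfolding \<phi>_def by blast+
  have uniq: "k = l" if k: "k \<in> K" "l \<in> K" "x \<in> carrier L" "x \<ominus> k \<otimes> e \<in> H" "x \<ominus> l \<otimes> e \<in> H" for x k l
  proof (rule ccontr)
    assume "k \<noteq> l"
    have c: "k \<in> carrier L" "l \<in> carrier L" using k K_carrier by auto
    have sub: "subring K L" using subfieldE(1)[OF K] .
    have kl: "k \<ominus> l \<in> K" using subringE(5,7)[OF sub] k by (simp add: a_minus_def)
    have kl0: "k \<ominus> l \<noteq> \<zero>" using \<open>k \<noteq> l\<close> c by simp
    have "(x \<ominus> l \<otimes> e) \<ominus> (x \<ominus> k \<otimes> e) = (k \<ominus> l) \<otimes> e"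
      using c e k by algebra
    then have "(k \<ominus> l) \<otimes> e \<in> H" using H_closed(4)[OF k(5,4)] by simp
    moreover have i: "inv (k \<ominus> l) \<in> K" "inv (k \<ominus> l) \<otimes> (k \<ominus> l) = \<one>"
      using subfield_m_inv[OF K, of "k \<ominus> l"] kl kl0 by auto
    ultimately have "inv (k \<ominus> l) \<otimes> ((k \<ominus> l) \<otimes> e) \<in> H" using H_closed(5) by blast
    then have "e \<in> H"
      using i(2) K_carrier[OF i(1)] c e(1) by (simp add: m_assoc[symmetric])
    then show False using e(2) by simp
  qed
  have sub: "subring K L" using subfieldE(1)[OF K] .
  have "linear_form L K (carrier L) \<phi>"
  proof (intro linear_form.intro linear_form_axioms.intro is_cring K carrier_is_subring)
    show "K \<subseteq> carrier L" using K_carrier by blast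
    fix x assume x: "x \<in> carrier L"
    show "\<phi> x \<in> K" by (rule \<phi>(1)[OF x])
    have px: "\<phi> x \<in> carrier L" using \<phi>(1)[OF x] K_carrier by blast
    {
      fix y assume y: "y \<in> carrier L"
      have py: "\<phi> y \<in> carrier L" using \<phi>(1)[OF y] K_carrier by blast
      obtain p q where pq: "p = \<phi> x" "q = \<phi> y" by blast
      have c: "p \<in> carrier L" "q \<in> carrier L" unfolding pq using px py by auto
      have "(x \<ominus> p \<otimes> e) \<oplus> (y \<ominus> q \<otimes> e) = (x \<oplus> y) \<ominus> (p \<oplus> q) \<otimes> e"
        using c e x y by algebra
      then have "(x \<oplus> y) \<ominus> (p \<oplus> q) \<otimes> e \<in> H"
        using H_closed(3)[OF \<phi>(2)[OF x] \<phi>(2)[OF y]] unfolding pq by simp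
      moreover have "p \<oplus> q \<in> K" using subringE(7)[OF sub] \<phi>(1) x y unfolding pq by simp
      ultimately show "\<phi> (x \<oplus> y) = \<phi> x \<oplus> \<phi> y"
        using uniq[OF \<phi>(1) _ _ \<phi>(2), of "x \<oplus> y"] x y unfolding pq by simp
    }
    fix k assume k: "k \<in> K"
    have kc: "k \<in> carrier L" using k K_carrier by blast
    have "k \<otimes> (x \<ominus> \<phi> x \<otimes> e) = k \<otimes> x \<ominus> (k \<otimes> \<phi> x) \<otimes> e"
      using px x e(1) kc by (simp add: minus_eq r_distr r_minus m_assoc)
    then have "k \<otimes> x \<ominus> (k \<otimes> \<phi> x) \<otimes> e \<in> H" using H_closed(5)[OF k \<phi>(2)[OF x]] by simp
    moreover have "k \<otimes> \<phi> x \<in> K" using subringE(6)[OF sub] k \<phi>(1)[OF x] by simp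
    ultimately show "\<phi> (k \<otimes> x) = k \<otimes> \<phi> x"
      using uniq[OF \<phi>(1) _ _ \<phi>(2), of "k \<otimes> x"] x kc by simp
  qed
  moreover have "\<phi> x = \<zero> \<longleftrightarrow> x \<in> H" if x: "x \<in> carrier L" for x
  proof
    assume "\<phi> x = \<zero>"
    then show "x \<in> H" using \<phi>(2)[OF x] x e(1) by (simp add: minus_eq)
  next
    assume "x \<in> H"
    then have "x \<ominus> \<zero> \<otimes> e \<in> H" using x e(1) by (simp add: minus_eq)
    then show "\<phi> x = \<zero>" using uniq[OF \<phi>(1)[OF x] _ x \<phi>(2)[OF x], of \<zero>] subringE(2)[OF sub] by blast
  qed
  ultimately show ?thesis by blast
qed

end

text \<open>
  From here on, one K-linear form with kernel H is fixed; W W being contained in H says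
  that W is isotropic for the pairing of x and y through the form at x y.
\<close>

locale KWH_form = codim_one L K H n + linear_form L K "carrier L" \<phi> 
  for L (structure) and K H n \<phi> +
  fixes W
  assumes ker_form: "x \<in> carrier L \<Longrightarrow> \<phi> x = \<zero> \<longleftrightarrow> x \<in> H"
    and even_n: "even n"
    and W: "subalgebra K W L" and WH: "W \<subseteq> H" and KW: "K \<subset> W"
    and dim_W: "dimension (n div 2) K W"
    and W_prod: "\<lbrakk>v \<in> W; w \<in> W\<rbrakk> \<Longrightarrow> v \<otimes> w \<in> H"
begin

lemma form_nondegenerate:
  assumes "x \<in> carrier L" "\<And>l. l \<in> carrier L \<Longrightarrow> \<phi> (x \<otimes> l) = \<zero>"
  shows "x = \<zero>"
proof (rule ccontr)
  assume x0: "x \<noteq> \<zero>"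
  obtain e where e: "e \<in> carrier L" "e \<notin> H" using proper by blast
  have i: "inv x \<in> carrier L" "x \<otimes> inv x = \<one>"
    using x0 assms(1) field_Units by auto
  have "x \<otimes> (inv x \<otimes> e) = e" using i e(1) assms(1) by (simp add: m_assoc[symmetric])
  then have "\<phi> e = \<zero>" using assms(2)[of "inv x \<otimes> e"] i(1) e(1) by simp
  then show False using ker_form e by blast
qed

text \<open>
  H is the orthogonal complement of K, so the complement of H is K again.
\<close>

lemma form_H_perp:
  assumes x: "x \<in> carrier L" and perp: "\<And>h. h \<in> H \<Longrightarrow> \<phi> (x \<otimes> h) = \<zero>"
  shows "x \<in> K"
proof -
  have "\<phi> (c \<otimes> x) = \<zero>" if "c \<in> perp [\<one>]" for c
  proof -
    have c: "c \<in> carrier L" "\<phi> c = \<zero>" using that unfolding perp_def by auto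
    then have "c \<in> H" using ker_form by blast
    then show ?thesis using perp x c(1) m_comm by metis
  qed
  then obtain v where v: "v \<in> Span K [\<one>]" "\<forall>c\<in>carrier L. \<phi> (c \<otimes> (x \<ominus> v)) = \<zero>"
    using double_annihilator[of "[\<one>]" x] x by auto
  have vK: "v \<in> K" using v(1) line_extension_mem_iff K_carrier by auto
  have "x \<ominus> v = \<zero>"
    by (rule form_nondegenerate) (use v(2) x vK K_carrier m_comm in auto)
  then show ?thesis using vK x K_carrier by simp
qed

text \<open>
  W is isotropic and has half the dimension of L, hence is its own orthogonal complement: one
  more vector would give n/2 + 1 independent vectors in a space of dimension n/2.
\<close>

lemma form_W_perp:
  assumes x: "x \<in> carrier L" and perpx: "\<And>w. w \<in> W \<Longrightarrow> \<phi> (x \<otimes> w) = \<zero>"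
  shows "x \<in> W"
proof (rule ccontr)
  assume xW: "x \<notin> W"
  obtain ws where ws: "set ws \<subseteq> carrier L" "independent K ws" "length ws = n div 2" "Span K ws = W"
    using exists_base[OF K dim_W] by blast
  have wsW: "set ws \<subseteq> W" using Span_base_incl[OF K ws(1)] ws(4) by simp
  obtain d where d: "dimension d K (perp ws)" "d + length ws = n"
    using dimension_perp[OF _ dim_L ws(2,1)] form_nondegenerate m_comm by metis
  have "independent K (x # ws)"
    using li_Cons[OF x _ ws(2)] ws(4) xW by simp
  moreover have "set (x # ws) \<subseteq> perp ws"
  proof -
    have "\<phi> (w \<otimes> v) = \<zero>" if "w \<in> set ws" "v \<in> set ws" for v w
      using W_prod[of w v] wsW that ker_form[of "w \<otimes> v"] H_closed(1) by blast
    then show ?thesis unfolding perp_def using x perpx wsW ws(1) by auto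
  qed
  ultimately have "length (x # ws) \<le> d"
    by (rule independent_length_le_dimension[OF K d(1)])
  then show False using d(2) ws(3) even_n by auto
qed

lemma W_closed:
  "w \<in> W \<Longrightarrow> w \<in> H" "w \<in> W \<Longrightarrow> w \<in> carrier L" "\<zero> \<in> W" "\<one> \<in> W" "\<lbrakk>w \<in> W; w' \<in> W\<rbrakk> \<Longrightarrow> w \<oplus> w' \<in> W"
  "\<lbrakk>k \<in> K; w \<in> W\<rbrakk> \<Longrightarrow> k \<otimes> w \<in> W"
proof -
  interpret W: subalgebra K W L by (rule W)
  show "w \<in> W \<Longrightarrow> w \<in> H" "w \<in> W \<Longrightarrow> w \<in> carrier L" using WH H_closed(1) by auto
  show "\<zero> \<in> W" using W.one_closed by simp
  show "\<one> \<in> W" using KW subringE(3)[OF subfieldE(1)[OF K]] by blast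
  show "\<lbrakk>w \<in> W; w' \<in> W\<rbrakk> \<Longrightarrow> w \<oplus> w' \<in> W" using W.m_closed by simp
  show "\<lbrakk>k \<in> K; w \<in> W\<rbrakk> \<Longrightarrow> k \<otimes> w \<in> W" by (rule W.smult_closed)
qed

text \<open>
  An element w of W outside K is not orthogonal to H, so some product w h lies outside H and
  spans a complement of H.
\<close>

lemma WH_spans:
  obtains w h where "w \<in> W" "h \<in> H"
    "\<And>x. x \<in> carrier L \<Longrightarrow> \<exists>k\<in>K. \<exists>h'\<in>H. x = k \<otimes> (w \<otimes> h) \<oplus> h'"
proof -
  obtain w where w: "w \<in> W" "w \<notin> K" using KW by blast
  then obtain h where h: "h \<in> H" "\<phi> (w \<otimes> h) \<noteq> \<zero>"
    using form_H_perp[OF W_closed(2)] by blast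
  have c: "w \<otimes> h \<in> carrier L" using w h W_closed(2) H_closed(1) by simp
  have nH: "w \<otimes> h \<notin> H" using ker_form[OF c] h(2) by simp
  show thesis
  proof (rule that[OF w(1) h(1)])
    fix x assume x: "x \<in> carrier L"
    obtain k where k: "k \<in> K" "x \<ominus> k \<otimes> (w \<otimes> h) \<in> H" using complement[OF c nH x] by blast
    have "x = k \<otimes> (w \<otimes> h) \<oplus> (x \<ominus> k \<otimes> (w \<otimes> h))"
      using x c K_carrier[OF k(1)] by (simp add: minus_eq a_lcomm[of "k \<otimes> (w \<otimes> h)" x] r_neg)
    then show "\<exists>k\<in>K. \<exists>h'\<in>H. x = k \<otimes> (w \<otimes> h) \<oplus> h'" using k by blast
  qed
qed

end

section \<open>The algebra and its residue forms\<close>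

sublocale KWH_form \<subseteq> U: UP_domain L "UP L"
  by (intro UP_domain.intro domain_axioms) simp

context KWH_form begin

abbreviation P where "P \<equiv> UP L"
abbreviation times_P (infixl "*\<^sub>P" 70) where "p *\<^sub>P q \<equiv> p \<otimes>\<^bsub>P\<^esub> q"
abbreviation plus_P (infixl "+\<^sub>P" 65) where "p +\<^sub>P q \<equiv> p \<oplus>\<^bsub>P\<^esub> q"
abbreviation minus_P (infixl "-\<^sub>P" 65) where "p -\<^sub>P q \<equiv> p \<ominus>\<^bsub>P\<^esub> q"
abbreviation A where "A \<equiv> KWH_algebra L K W H"
abbreviation times_A (infixl "*\<^sub>A" 70) where "p *\<^sub>A q \<equiv> p \<otimes>\<^bsub>A\<^esub> q"
abbreviation plus_A (infixl "+\<^sub>A" 65) where "p +\<^sub>A q \<equiv> p \<oplus>\<^bsub>A\<^esub> q"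
abbreviation minus_A (infixl "-\<^sub>A" 65) where "p -\<^sub>A q \<equiv> p \<ominus>\<^bsub>A\<^esub> q"
abbreviation co where "co \<equiv> coeff (UP L)"
abbreviation mon where "mon \<equiv> monom (UP L)"
abbreviation V where "V \<equiv> coeff_space L K W H"

lemma P_domain: "domain P"
  by (rule U.UP_domain)

lemma V_subalgebra: "subalgebra K (V i) L"
  using W H carrier_is_subalgebra[of K] K_carrier
    ideal_is_subalgebra subalgebra_Span_incl K
  unfolding coeff_space_def
  by (auto intro!: subalgebra.intro subalgebra_axioms.intro subring.axioms(1) subfieldE(1)
      simp: subringE(6)[OF subfieldE(1)[OF K]])

lemma V_closed:
  "x \<in> V i \<Longrightarrow> x \<in> carrier L" "\<zero> \<in> V i" "\<lbrakk>x \<in> V i; y \<in> V i\<rbrakk> \<Longrightarrow> x \<oplus> y \<in> V i"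
  "x \<in> V i \<Longrightarrow> \<ominus> x \<in> V i"
proof -
  interpret V: subalgebra K "V i" L by (rule V_subalgebra)
  show "x \<in> V i \<Longrightarrow> x \<in> carrier L" using subalgebra_in_carrier[OF V_subalgebra] by blast
  show "\<zero> \<in> V i" using V.one_closed by simp
  show "\<lbrakk>x \<in> V i; y \<in> V i\<rbrakk> \<Longrightarrow> x \<oplus> y \<in> V i" using V.m_closed by simp
  show "x \<in> V i \<Longrightarrow> \<ominus> x \<in> V i" using V.m_inv_closed by (simp add: a_inv_def)
qed

lemma V_simps: "V 0 = K" "V 1 = W" "V (Suc 0) = W" "V 2 = H" "i \<ge> 3 \<Longrightarrow> V i = carrier L"
  unfolding coeff_space_def by auto

lemma V_mult:
  assumes "x \<in> V i" "y \<in> V j"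
  shows "x \<otimes> y \<in> V (i + j)"
proof -
  have c: "x \<in> carrier L" "y \<in> carrier L" using assms V_closed(1) by auto
  consider "i = 0" | "j = 0" | "i = 1" "j = 1" | "i + j \<ge> 3" by linarith
  then show ?thesis
  proof cases
    case 1
    then show ?thesis using subalgebra.smult_closed[OF V_subalgebra, of x y j] assms V_simps(1) by simp
  next
    case 2
    then show ?thesis
      using subalgebra.smult_closed[OF V_subalgebra, of y x i] assms V_simps(1) c by (simp add: m_comm)
  next
    case 3
    then have "x \<in> W" "y \<in> W" using assms V_simps(2) by auto
    then show ?thesis using W_prod V_simps(4) 3 by (simp add: numeral_2_eq_2)
  next
    case 4
    then show ?thesis using V_simps(5) c by simp
  qed
qed

lemma V_finsum:
  assumes "finite S" "\<And>i. i \<in> S \<Longrightarrow> f i \<in> V m"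
  shows "finsum L f S \<in> V m"
  using assms
proof (induction S rule: finite_induct)
  case empty
  then show ?case using V_closed(2) by simp
next
  case (insert i S)
  then have "finsum L f (insert i S) = f i \<oplus> finsum L f S"
    using V_closed(1) by (intro finsum_insert) auto
  then show ?case using insert V_closed(3) by simp
qed

lemma mem_A: "p \<in> carrier A \<longleftrightarrow> p \<in> carrier P \<and> (\<forall>i. co p i \<in> V i)"
  unfolding KWH_algebra_def by simp

lemma A_ops [simp]:
  "monoid.mult A = monoid.mult P" "ring.add A = ring.add P" "\<one>\<^bsub>A\<^esub> = \<one>\<^bsub>P\<^esub>" "\<zero>\<^bsub>A\<^esub> = \<zero>\<^bsub>P\<^esub>"
  unfolding KWH_algebra_def by simp_all

lemma mon_mem_A: "l \<in> V i \<Longrightarrow> mon l i \<in> carrier A"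
  unfolding mem_A using V_closed(1,2) U.monom_closed by auto

lemma A_subring: "subring (carrier A) P"
proof (rule ring.subringI[OF U.UP_ring])
  show "carrier A \<subseteq> carrier P" using mem_A by blast
  show "\<one>\<^bsub>P\<^esub> \<in> carrier A"
    using mon_mem_A[of \<one> 0] V_simps(1) K_closed(2) by simp
  fix p q assume p: "p \<in> carrier A"
  then show "\<ominus>\<^bsub>P\<^esub> p \<in> carrier A" unfolding mem_A using V_closed(4) by simp
  assume q: "q \<in> carrier A"
  show "p +\<^sub>P q \<in> carrier A" using p q unfolding mem_A using V_closed(3) by simp
  have "(\<Oplus>i\<in>{..n}. co p i \<otimes> co q (n - i)) \<in> V n" for n
  proof (rule V_finsum)
    fix i assume "i \<in> {..n}"
    then show "co p i \<otimes> co q (n - i) \<in> V n" using V_mult[of "co p i" i "co q (n - i)" "n - i"] p q mem_A by simp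
  qed simp
  then show "p *\<^sub>P q \<in> carrier A" using p q unfolding mem_A by simp
qed

lemma A_domain: "domain A"
  using domain.subring_is_domain[OF P_domain A_subring] unfolding KWH_algebra_def by simp

lemma A_carrier: "p \<in> carrier A \<Longrightarrow> p \<in> carrier P"
  using mem_A by blast

lemma A_a_inv [simp]: "p \<in> carrier A \<Longrightarrow> \<ominus>\<^bsub>A\<^esub> p = \<ominus>\<^bsub>P\<^esub> p"
proof -
  interpret A: domain A by (rule A_domain)
  assume p: "p \<in> carrier A"
  have m: "\<ominus>\<^bsub>P\<^esub> p \<in> carrier A" using subringE(5)[OF A_subring p] .
  have "\<ominus>\<^bsub>P\<^esub> p +\<^sub>A p = \<zero>\<^bsub>A\<^esub>" using A_carrier[OF p] by (simp add: U.P.l_neg)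
  then show ?thesis using A.minus_equality[OF _ p m] by simp
qed

lemma A_minus [simp]: "\<lbrakk>p \<in> carrier A; q \<in> carrier A\<rbrakk> \<Longrightarrow> p -\<^sub>A q = p -\<^sub>P q"
  unfolding a_minus_def by simp

lemma co_mon_mult:
  assumes "l \<in> carrier L" "p \<in> carrier P"
  shows "co (mon l j *\<^sub>P p) m = (if j \<le> m then l \<otimes> co p (m - j) else \<zero>)"
proof (cases "j \<le> m")
  case True
  then show ?thesis using U.coeff_monom_mult[OF assms, of j "m - j"] by simp
next
  case False
  have "co (mon l j *\<^sub>P p) m = (\<Oplus>i\<in>{..m}. co (mon l j) i \<otimes> co p (m - i))"
    using assms by simp
  also have "\<dots> = (\<Oplus>i\<in>{..m}. \<zero>)"
    by (rule add.finprod_cong) (use False assms in \<open>auto simp: simp_implies_def\<close>)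
  finally show ?thesis using False by simp
qed

lemma lead_coeff_mult:
  assumes "a \<in> carrier P" "a \<noteq> \<zero>\<^bsub>P\<^esub>" "s \<in> carrier P" "s \<noteq> \<zero>\<^bsub>P\<^esub>"
  shows "co (a *\<^sub>P s) (deg L a + deg L s) \<noteq> \<zero>"
proof -
  have "a *\<^sub>P s \<noteq> \<zero>\<^bsub>P\<^esub>" using U.UP_integral assms by blast
  then show ?thesis using U.lcoeff_nonzero[of "a *\<^sub>P s"] U.deg_mult[OF assms(2,4,1,3)] assms by simp
qed

lemma division_exists:
  assumes a: "a \<in> carrier P" "a \<noteq> \<zero>\<^bsub>P\<^esub>" and f: "f \<in> carrier P"
  shows "\<exists>q\<in>carrier P. \<forall>m\<ge>deg L a. co (f -\<^sub>P a *\<^sub>P q) m = \<zero>"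
proof -
  obtain q r and k :: nat where qr: "q \<in> carrier P" "r \<in> carrier P"
    "co a (deg L a) [^] k \<odot>\<^bsub>P\<^esub> f = a *\<^sub>P q +\<^sub>P r" "r = \<zero>\<^bsub>P\<^esub> \<or> deg L r < deg L a"
    using U.long_div_theorem[OF a(1) f a(2)] by blast
  define l where "l = co a (deg L a) [^] k"
  have l: "l \<in> carrier L" "l \<noteq> \<zero>"
  proof -
    have "co a (deg L a) \<in> Units L"
      using U.lcoeff_nonzero[OF a(2,1)] a(1) field_Units by auto
    then have "l \<in> Units L" unfolding l_def by (rule Units_pow_closed)
    then show "l \<in> carrier L" "l \<noteq> \<zero>" using field_Units by auto
  qed
  have i: "inv l \<in> carrier L" "inv l \<otimes> l = \<one>" using l field_Units by auto
  obtain c lp where c: "c = mon (inv l) 0" "lp = mon l 0" by blast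
  have cc: "c \<in> carrier P" "lp \<in> carrier P" unfolding c using i l by simp_all
  have cl: "c *\<^sub>P lp = \<one>\<^bsub>P\<^esub>"
    unfolding c using U.monom_mult[OF i(1) l(1), of 0 0, symmetric] i(2) by simp
  have e: "lp *\<^sub>P f = a *\<^sub>P q +\<^sub>P r"
    using qr(3) U.monom_mult_is_smult[OF l(1) f] unfolding l_def c by simp
  have "f = (c *\<^sub>P lp) *\<^sub>P f" using cl f by simp
  also have "\<dots> = c *\<^sub>P (a *\<^sub>P q +\<^sub>P r)" using e cc f by (simp add: U.P.m_assoc)
  finally have "f = c *\<^sub>P (a *\<^sub>P q +\<^sub>P r)" .
  moreover have "c *\<^sub>P (a *\<^sub>P q +\<^sub>P r) -\<^sub>P a *\<^sub>P (c *\<^sub>P q) = c *\<^sub>P r"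
  proof -
    have h: "c \<in> carrier P" "a \<in> carrier P" "q \<in> carrier P" "r \<in> carrier P" using cc a qr by auto
    show ?thesis using h by algebra
  qed
  ultimately have fe: "f -\<^sub>P a *\<^sub>P (c *\<^sub>P q) = c *\<^sub>P r" by simp
  have "co (c *\<^sub>P r) m = \<zero>" if "m \<ge> deg L a" for m
  proof -
    have "co r m = \<zero>" using qr(4) U.deg_aboveD[OF _ qr(2), of m] that by auto
    then show ?thesis unfolding c(1) co_mon_mult[OF i(1) qr(2)] using i(1) by simp
  qed
  then show ?thesis using fe cc(1) qr(1) by (intro bexI[of _ "c *\<^sub>P q"]) simp_all
qed

text \<open>
  Division is characterised by the vanishing of the coefficients of the remainder from degree
  deg a on. Unlike an inequality between degrees, this also covers a zero remainder when a is
  constant, and it is visibly a linear condition.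
\<close>

definition quo where
  "quo a f = (SOME q. q \<in> carrier P \<and> (\<forall>m\<ge>deg L a. co (f -\<^sub>P a *\<^sub>P q) m = \<zero>))"

lemma quo:
  assumes "a \<in> carrier P" "a \<noteq> \<zero>\<^bsub>P\<^esub>" "f \<in> carrier P"
  shows "quo a f \<in> carrier P" "m \<ge> deg L a \<Longrightarrow> co (f -\<^sub>P a *\<^sub>P quo a f) m = \<zero>"
  using someI_ex[of "\<lambda>q. q \<in> carrier P \<and> (\<forall>m\<ge>deg L a. co (f -\<^sub>P a *\<^sub>P q) m = \<zero>)"]
    division_exists[OF assms] unfolding quo_def[symmetric] by blast+

lemma quo_unique:
  assumes a: "a \<in> carrier P" "a \<noteq> \<zero>\<^bsub>P\<^esub>" and f: "f \<in> carrier P" and q: "q \<in> carrier P"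
    and rem: "\<And>m. m \<ge> deg L a \<Longrightarrow> co (f -\<^sub>P a *\<^sub>P q) m = \<zero>"
  shows "quo a f = q"
proof (rule ccontr)
  assume ne: "quo a f \<noteq> q"
  obtain s where s: "s = quo a f" "s \<in> carrier P" using quo(1)[OF a f] by blast
  have d: "q -\<^sub>P s \<in> carrier P" "q -\<^sub>P s \<noteq> \<zero>\<^bsub>P\<^esub>" using ne q s by auto
  define m where "m = deg L a + deg L (q -\<^sub>P s)"
  have "(f -\<^sub>P a *\<^sub>P s) -\<^sub>P (f -\<^sub>P a *\<^sub>P q) = a *\<^sub>P (q -\<^sub>P s)"
    using f a q s(2) by algebra
  then have "co (a *\<^sub>P (q -\<^sub>P s)) m
      = co (f -\<^sub>P a *\<^sub>P s) m \<ominus> co (f -\<^sub>P a *\<^sub>P q) m"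
    using U.coeff_minus[of "f -\<^sub>P a *\<^sub>P s" "f -\<^sub>P a *\<^sub>P q" m] f a(1) q s(2) by simp
  then have "co (a *\<^sub>P (q -\<^sub>P s)) m = \<zero>"
    using rem[of m] quo(2)[OF a f, of m] unfolding s(1) m_def by (simp add: minus_eq)
  then show False using lead_coeff_mult[OF a d] unfolding m_def by simp
qed

lemma quo_add:
  assumes a: "a \<in> carrier P" "a \<noteq> \<zero>\<^bsub>P\<^esub>" and f: "f \<in> carrier P" and g: "g \<in> carrier P"
  shows "quo a (f +\<^sub>P g) = quo a f +\<^sub>P quo a g"
proof (rule quo_unique[OF a])
  obtain s u where s: "s = quo a f" "s \<in> carrier P" "u = quo a g" "u \<in> carrier P"
    using quo(1)[OF a] f g by blast
  show "f +\<^sub>P g \<in> carrier P" "quo a f +\<^sub>P quo a g \<in> carrier P" using s f g by auto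
  fix m assume m: "m \<ge> deg L a"
  have "(f +\<^sub>P g) -\<^sub>P a *\<^sub>P (s +\<^sub>P u) = (f -\<^sub>P a *\<^sub>P s) +\<^sub>P (g -\<^sub>P a *\<^sub>P u)"
    using f a g s(2,4) by algebra
  then show "co ((f +\<^sub>P g) -\<^sub>P a *\<^sub>P (quo a f +\<^sub>P quo a g)) m = \<zero>"
    using quo(2)[OF a f m] quo(2)[OF a g m] s f g a
      U.coeff_add[of "f -\<^sub>P a *\<^sub>P s" "g -\<^sub>P a *\<^sub>P u" m]
    by (simp del: U.coeff_mult U.coeff_minus)
qed

lemma quo_scale:
  assumes a: "a \<in> carrier P" "a \<noteq> \<zero>\<^bsub>P\<^esub>" and f: "f \<in> carrier P" and l: "l \<in> carrier L"
  shows "quo a (mon l 0 *\<^sub>P f) = mon l 0 *\<^sub>P quo a f"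
proof (rule quo_unique[OF a])
  obtain s c where s: "s = quo a f" "s \<in> carrier P" "c = mon l 0" "c \<in> carrier P"
    using quo(1)[OF a f] l by simp
  show "mon l 0 *\<^sub>P f \<in> carrier P" "mon l 0 *\<^sub>P quo a f \<in> carrier P" using s f l by auto
  fix m assume m: "m \<ge> deg L a"
  have "c *\<^sub>P f -\<^sub>P a *\<^sub>P (c *\<^sub>P s) = c *\<^sub>P (f -\<^sub>P a *\<^sub>P s)"
    using f a s(2,4) by algebra
  then show "co (mon l 0 *\<^sub>P f -\<^sub>P a *\<^sub>P (mon l 0 *\<^sub>P quo a f)) m = \<zero>"
    using quo(2)[OF a f m] s f a(1) l co_mon_mult[OF l, of "f -\<^sub>P a *\<^sub>P s" 0 m] by simp
qed

lemma quo_mult: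
  assumes a: "a \<in> carrier P" "a \<noteq> \<zero>\<^bsub>P\<^esub>" and q: "q \<in> carrier P"
  shows "quo a (a *\<^sub>P q) = q"
proof (rule quo_unique[OF a _ q])
  show "a *\<^sub>P q \<in> carrier P" using a q by simp
  have "a *\<^sub>P q -\<^sub>P a *\<^sub>P q = \<zero>\<^bsub>P\<^esub>" using a q by (simp add: U.P.minus_eq U.P.r_neg)
  then show "co (a *\<^sub>P q -\<^sub>P a *\<^sub>P q) m = \<zero>" for m by simp
qed

text \<open>
  Expanding p/a in powers of 1/t, the polynomial quotient is its part of nonnegative degree; so
  this is the form applied to the coefficient of degree two in p/a.
\<close>

definition residue where "residue a p = \<phi> (co (quo a p) 2)"

lemma residue_add:
  assumes a: "a \<in> carrier P" "a \<noteq> \<zero>\<^bsub>P\<^esub>" and f: "f \<in> carrier P" and g: "g \<in> carrier P"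
  shows "residue a (f +\<^sub>P g) = residue a f \<oplus> residue a g"
  unfolding residue_def quo_add[OF assms] using quo(1)[OF a f] quo(1)[OF a g] form_add by simp

lemma residue_scale:
  assumes a: "a \<in> carrier P" "a \<noteq> \<zero>\<^bsub>P\<^esub>" and f: "f \<in> carrier P" and k: "k \<in> K"
  shows "residue a (mon k 0 *\<^sub>P f) = k \<otimes> residue a f"
  unfolding residue_def quo_scale[OF a f K_carrier[OF k]]
  using co_mon_mult[OF K_carrier[OF k] quo(1)[OF a f], of 0 2] form_smult[OF k] quo(1)[OF a f] by simp

lemma residue_closed: "\<lbrakk>a \<in> carrier P; a \<noteq> \<zero>\<^bsub>P\<^esub>; f \<in> carrier P\<rbrakk> \<Longrightarrow> residue a f \<in> K"
  unfolding residue_def using quo(1) form_closed by simp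

text \<open>
  If p = a z with z in A, the coefficient of degree two of p/a = z lies in H.
\<close>

lemma residue_principal:
  assumes "a \<in> carrier P" "a \<noteq> \<zero>\<^bsub>P\<^esub>" "z \<in> carrier A"
  shows "residue a (a *\<^sub>P z) = \<zero>"
proof -
  have "co z 2 \<in> H" using assms(3) V_simps(4) mem_A by metis
  then have "\<phi> (co z 2) = \<zero>" using ker_form H_closed(1) by blast
  then show ?thesis unfolding residue_def quo_mult[OF assms(1,2) A_carrier[OF assms(3)]] .
qed

text \<open>
  The heart of the duality: if the residue form at a vanishes on A p, then p is a multiple of a in A.
  Pairing with l t^j evaluates the form at l times the coefficient of degree 2 - j of p/a. For j at
  least three, l is arbitrary, so p/a has no part of negative degree and a divides p in L[t]. For
  j = 0, 1, 2, the coefficients of the quotient in degrees 2, 1, 0 are orthogonal to K, W, H, so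
  they lie in H, W, K, which is membership in A.
\<close>

lemma residue_radical:
  assumes a: "a \<in> carrier P" "a \<noteq> \<zero>\<^bsub>P\<^esub>" and p: "p \<in> carrier A"
    and rad: "\<And>c. c \<in> carrier A \<Longrightarrow> residue a (c *\<^sub>P p) = \<zero>"
  shows "\<exists>q\<in>carrier A. p = a *\<^sub>P q"
proof -
  have pP: "p \<in> carrier P" using A_carrier p .
  define q where "q = quo a p"
  define r where "r = p -\<^sub>P a *\<^sub>P q"
  have q: "q \<in> carrier P" unfolding q_def using quo(1)[OF a pP] .
  have r: "r \<in> carrier P" unfolding r_def using pP a q by simp
  have pqr: "p = a *\<^sub>P q +\<^sub>P r"
    unfolding r_def using pP a q by (simp add: U.P.minus_eq U.P.a_lcomm[of "a *\<^sub>P q"] U.P.r_neg)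
  have rm: "co r m = \<zero>" if "m \<ge> deg L a" for m
    unfolding r_def q_def by (rule quo(2)[OF a pP that])
  have "r = \<zero>\<^bsub>P\<^esub>"
  proof (rule ccontr)
    assume r0: "r \<noteq> \<zero>\<^bsub>P\<^esub>"
    have er: "co r (deg L r) \<noteq> \<zero>" by (rule U.lcoeff_nonzero[OF r0 r])
    then have lt: "deg L r < deg L a" using rm[of "deg L r"] by linarith
    \<comment> \<open>With this j the leading term of t^j r meets that of a in degree two of the quotient.\<close>
    define j where "j = deg L a + 2 - deg L r"
    have j: "j \<ge> 3" "j + deg L r = deg L a + 2" using lt unfolding j_def by auto
    define g where "g = mon \<one> j *\<^sub>P r"
    have g: "g \<in> carrier P" unfolding g_def using r by simp
    have gco: "co g m = (if j \<le> m then co r (m - j) else \<zero>)" for m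
      unfolding g_def using co_mon_mult[OF one_closed r] r by simp
    have gtop: "co g (deg L a + 2) \<noteq> \<zero>" using gco[of "deg L a + 2"] er j by (metis add_diff_cancel_left' le_add1)
    define s where "s = quo a g"
    have s: "s \<in> carrier P" unfolding s_def using quo(1)[OF a g] .
    have sg: "co (a *\<^sub>P s) m = co g m" if "m \<ge> deg L a" for m
      using quo(2)[OF a g that] U.coeff_minus[OF g, of "a *\<^sub>P s" m] a(1) s g
      unfolding s_def[symmetric] by simp
    have s0: "s \<noteq> \<zero>\<^bsub>P\<^esub>" using sg[of "deg L a + 2"] gtop a(1) by auto
    have "co g (deg L a + deg L s) \<noteq> \<zero>"
      using lead_coeff_mult[OF a s s0] sg[of "deg L a + deg L s"] by simp
    then have "deg L a + deg L s - j \<le> deg L r"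
      using gco[of "deg L a + deg L s"] U.deg_aboveD[OF _ r, of "deg L a + deg L s - j"] by (metis not_le)
    then have "deg L s \<le> 2" using j by linarith
    moreover have "deg L a + 2 \<le> deg L a + deg L s"
      using U.deg_aboveD[of "a *\<^sub>P s" "deg L a + 2"] sg[of "deg L a + 2"] gtop
        U.deg_mult[OF a(2) s0 a(1) s] a(1) s by (metis U.UP_mult_closed le_add1 not_le)
    ultimately have "deg L s = 2" by linarith
    then have s2: "co s 2 \<noteq> \<zero>" using U.lcoeff_nonzero[OF s0 s] by simp
    have "\<phi> (co s 2 \<otimes> l) = \<zero>" if l: "l \<in> carrier L" for l
    proof -
      have m: "mon l j \<in> carrier A" using mon_mem_A V_simps(5) j(1) l by simp
      have mj: "mon l j = mon l 0 *\<^sub>P mon \<one> j" using U.monom_mult[OF l one_closed, of 0 j] l by simp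
      have "mon l j *\<^sub>P p = a *\<^sub>P (mon l j *\<^sub>P q) +\<^sub>P mon l 0 *\<^sub>P g"
        unfolding pqr g_def using a(1) q r l by (simp add: mj U.P.r_distr U.P.m_assoc U.P.m_lcomm)
      then have "quo a (mon l j *\<^sub>P p) = mon l j *\<^sub>P q +\<^sub>P mon l 0 *\<^sub>P s"
        using quo_add[OF a, of "a *\<^sub>P (mon l j *\<^sub>P q)" "mon l 0 *\<^sub>P g"]
          quo_mult[OF a, of "mon l j *\<^sub>P q"] quo_scale[OF a g l] a(1) q g l unfolding s_def by simp
      then have "co (quo a (mon l j *\<^sub>P p)) 2 = l \<otimes> co s 2"
        using co_mon_mult[OF l q, of j 2] co_mon_mult[OF l s, of 0 2] l q s j(1) by simp
      then show ?thesis using rad[OF m] l s unfolding residue_def by (simp add: m_comm)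
    qed
    then show False using form_nondegenerate[of "co s 2"] s s2 by simp
  qed
  then have pq: "p = a *\<^sub>P q" using pqr a q by simp
  have form: "\<phi> (co q (2 - j) \<otimes> x) = \<zero>" if x: "x \<in> V j" and j: "j \<le> 2" for x j
  proof -
    have xc: "x \<in> carrier L" using x V_closed(1) by blast
    have "mon x j *\<^sub>P p = a *\<^sub>P (mon x j *\<^sub>P q)"
      unfolding pq using a(1) q xc by (simp add: U.P.m_lcomm)
    then have "quo a (mon x j *\<^sub>P p) = mon x j *\<^sub>P q"
      using quo_mult[OF a, of "mon x j *\<^sub>P q"] xc q by simp
    then show ?thesis
      using rad[OF mon_mem_A[OF x]] co_mon_mult[OF xc q, of j 2] j xc q unfolding residue_def by (simp add: m_comm)
  qed
  have "co q 2 \<in> H"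
    using form[of \<one> 0] V_simps(1) K_closed(2) ker_form q by simp
  moreover have "co q 1 \<in> W"
    by (rule form_W_perp) (use form[of _ 1] V_simps(2) q in simp_all)
  moreover have "co q 0 \<in> K"
    by (rule form_H_perp) (use form[of _ 2] V_simps(4) q in simp_all)
  ultimately have "co q i \<in> V i" for i
    using q unfolding coeff_space_def by (auto simp: numeral_2_eq_2)
  then show ?thesis using pq q mem_A by blast
qed

end

section \<open>Finiteness modulo a nonzero element, and Frobenius duality\<close>

context KWH_form begin

text \<open>
  The constants K inside the algebra are the scalars for all linear algebra on polynomials.
\<close>

definition cons where "cons = constants L K"

definition below where "below N = {p \<in> carrier P. \<forall>m\<ge>N. co p m = \<zero>}"

lemma cons_subfield: "subfield cons P"
proof -
  have hom: "ring_hom_ring L P (\<lambda>a. mon a 0)"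
    by (rule ring_hom_ringI2[OF ring_axioms U.P.ring_axioms U.const_ring_hom])
  have "subfield ((\<lambda>a. mon a 0) ` K) P"
    by (rule ring_hom_ring.img_is_subfield(2)[OF hom K U.UP_one_not_zero])
  then show ?thesis unfolding cons_def constants_def .
qed

lemma cons_A: "cons \<subseteq> carrier A"
  unfolding cons_def constants_def using mon_mem_A V_simps(1) by auto

lemma consE: assumes "c \<in> cons" obtains k where "k \<in> K" "c = mon k 0"
  using assms unfolding cons_def constants_def by auto

lemma consI: "k \<in> K \<Longrightarrow> mon k 0 \<in> cons"
  unfolding cons_def constants_def by auto

lemma below_subalgebra: "subalgebra cons (below N) P"
proof (intro subalgebra.intro subalgebra_axioms.intro)
  show "subgroup (below N) (add_monoid P)"
    by (rule U.P.add.subgroupI) (auto simp: below_def intro!: exI[of _ "\<zero>\<^bsub>P\<^esub>"])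
  fix c p assume "c \<in> cons" and p: "p \<in> below N"
  then obtain k where k: "k \<in> K" "c = mon k 0" by (rule_tac consE)
  then show "c *\<^sub>P p \<in> below N"
    using p K_carrier[OF k(1)] co_mon_mult[of k p 0] unfolding below_def by auto
qed

lemma monomials_finite_dimension:
  "\<exists>us. set us \<subseteq> carrier P \<and> (\<forall>l\<in>carrier L. mon l N \<in> U.P.Span cons us)"
proof -
  obtain ls where ls: "set ls \<subseteq> carrier L" "Span K ls = carrier L"
    using exists_base[OF K dim_L] by blast
  have "mon l N \<in> U.P.Span cons (map (\<lambda>l. mon l N) ls)" if "l \<in> Span K ls" for l
    using ls(1) that
  proof (induction ls arbitrary: l)
    case Nil
    then show ?case by simp
  next
    case (Cons u ls)
    obtain k w where kw: "k \<in> K" "w \<in> Span K ls" "l = k \<otimes> u \<oplus> w"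
      using Cons.prems(2) line_extension_mem_iff by auto
    have c: "u \<in> carrier L" "w \<in> carrier L" "k \<in> carrier L"
      using Cons.prems(1) kw(1,2) K_carrier Span_in_carrier[of K ls] by auto
    have "mon l N = mon k 0 *\<^sub>P mon u N +\<^sub>P mon w N"
      unfolding kw(3) using c U.monom_mult[of k u 0 N] by simp
    moreover have "mon w N \<in> U.P.Span cons (map (\<lambda>l. mon l N) ls)"
      using Cons kw(2) by auto
    ultimately show ?case
      using U.P.line_extension_mem_iff[of "mon l N" cons "mon u N"] consI[OF kw(1)] by auto
  qed
  then show ?thesis using ls by (intro exI[of _ "map (\<lambda>l. mon l N) ls"]) auto
qed

lemma below_finite_dimension: "U.P.finite_dimension cons (below N)"
proof (induction N)
  case 0
  have "below 0 = {\<zero>\<^bsub>P\<^esub>}"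
    unfolding below_def using U.up_eqI[of _ "\<zero>\<^bsub>P\<^esub>"] by auto
  then show ?case
    using U.P.finite_dimensionI[of 0 cons] ring.dimension.zero_dim[OF U.UP_ring, of cons] by simp
next
  case (Suc N)
  obtain us where us: "set us \<subseteq> carrier P" "\<And>l. l \<in> carrier L \<Longrightarrow> mon l N \<in> U.P.Span cons us"
    using monomials_finite_dimension by blast
  have fd: "U.P.finite_dimension cons (below N <+>\<^bsub>P\<^esub> U.P.Span cons us)"
    by (rule U.P.sum_space_dim(1)[OF cons_subfield Suc.IH
          U.P.Span_finite_dimension[OF cons_subfield us(1)]])
  have "below (Suc N) \<subseteq> below N <+>\<^bsub>P\<^esub> U.P.Span cons us"
  proof
    fix p assume p: "p \<in> below (Suc N)"
    have pc: "p \<in> carrier P" using p unfolding below_def by blast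
    define r where "r = p -\<^sub>P mon (co p N) N"
    have "co r m = \<zero>" if "m \<ge> N" for m
      unfolding r_def using p pc that unfolding below_def by (cases "m = N") (auto simp: minus_eq r_neg)
    moreover have "r \<in> carrier P" unfolding r_def using pc by simp
    ultimately have "r \<in> below N" unfolding below_def by blast
    moreover have "p = r +\<^sub>P mon (co p N) N"
      unfolding r_def using pc by (simp add: U.P.minus_eq U.P.a_assoc U.P.l_neg)
    ultimately show "p \<in> below N <+>\<^bsub>P\<^esub> U.P.Span cons us"
      unfolding set_add_def' using us(2)[of "co p N"] pc by auto
  qed
  then show ?case
    by (rule U.P.subalbegra_incl_imp_finite_dimension[OF cons_subfield fd below_subalgebra])
qed

lemma A_ideal_subalgebra:
  assumes "ideal I A"
  shows "subalgebra cons I P" "I \<subseteq> carrier A"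
proof -
  interpret A: domain A by (rule A_domain)
  interpret I: ideal I A by (rule assms)
  show sub: "I \<subseteq> carrier A" using I.a_subset .
  show "subalgebra cons I P"
  proof (intro subalgebra.intro subalgebra_axioms.intro)
    show "subgroup I (add_monoid P)"
    proof (rule U.P.add.subgroupI)
      show "I \<subseteq> carrier P" using sub A_carrier by blast
      show "I \<noteq> {}" using I.zero_closed by blast
      fix x assume x: "x \<in> I"
      show "\<ominus>\<^bsub>P\<^esub> x \<in> I" using I.a_inv_closed[OF x] sub x by auto
      fix y assume y: "y \<in> I"
      show "x +\<^sub>P y \<in> I" using I.a_closed[OF x y] by simp
    qed
    show "c *\<^sub>P x \<in> I" if "c \<in> cons" "x \<in> I" for c x
      using I.I_l_closed[of x c] that cons_A by auto
  qed
qed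

text \<open>
  Division by a in L[t] gives a quotient q in L[t]. All of q but its terms of degree at most two
  lies in A, so dividing within A leaves a remainder of degree less than deg a + 3.
\<close>

lemma reduce_mod:
  assumes a: "a \<in> carrier A" "a \<noteq> \<zero>\<^bsub>P\<^esub>" and f: "f \<in> carrier A"
  shows "\<exists>r\<in>carrier A. f -\<^sub>P a *\<^sub>P r \<in> below (deg L a + 3)"
proof -
  have P: "a \<in> carrier P" "f \<in> carrier P" using a f A_carrier by auto
  define q where "q = quo a f"
  have q: "q \<in> carrier P" unfolding q_def using quo(1)[OF P(1) a(2) P(2)] .
  \<comment> \<open>The part of q that may fail to lie in A.\<close>
  define t where "t = mon (co q 0) 0 +\<^sub>P (mon (co q 1) 1 +\<^sub>P mon (co q 2) 2)"
  have t: "t \<in> carrier P" unfolding t_def using q by simp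
  have t_co: "co t i = (if i < 3 then co q i else \<zero>)" for i
  proof -
    have "i = 0 \<or> i = 1 \<or> i = 2 \<or> i \<ge> 3" by linarith
    then show ?thesis unfolding t_def using q by auto
  qed
  have "co (q -\<^sub>P t) i \<in> V i" for i
    using t_co[of i] q t V_closed(2)[of i] V_simps(5)[of i] by (simp add: minus_eq r_neg)
  then have r: "q -\<^sub>P t \<in> carrier A" unfolding mem_A using q t by simp
  have e: "f -\<^sub>P a *\<^sub>P (q -\<^sub>P t) = (f -\<^sub>P a *\<^sub>P q) +\<^sub>P a *\<^sub>P t"
    using P q t by algebra
  have "co (f -\<^sub>P a *\<^sub>P (q -\<^sub>P t)) m = \<zero>" if m: "m \<ge> deg L a + 3" for m
  proof -
    have "deg L t \<le> 2" by (rule U.deg_aboveI) (use t t_co in auto)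
    then have "deg L (a *\<^sub>P t) < m" using U.deg_mult_ring[OF P(1) t] m by linarith
    then have "co (a *\<^sub>P t) m = \<zero>" using U.deg_aboveD P t by blast
    moreover have "co (f -\<^sub>P a *\<^sub>P q) m = \<zero>" unfolding q_def by (rule quo(2)[OF P(1) a(2) P(2)]) (use m in simp)
    ultimately show ?thesis
      unfolding e using U.coeff_add[of "f -\<^sub>P a *\<^sub>P q" "a *\<^sub>P t" m] P q t
      by (simp del: U.coeff_mult U.coeff_minus)
  qed
  then show ?thesis using r P q t unfolding below_def by (intro bexI[of _ "q -\<^sub>P t"]) auto
qed

text \<open>
  An ideal is aA plus its elements of degree less than deg a + 3, and the latter form a
  finite-dimensional space.
\<close>

lemma ideal_finite_mod:
  assumes I: "ideal I A" and a: "a \<in> I" "a \<noteq> \<zero>\<^bsub>P\<^esub>"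
  obtains us where "set us \<subseteq> I"
    "\<And>x. x \<in> I \<Longrightarrow> \<exists>r\<in>carrier A. x -\<^sub>P a *\<^sub>P r \<in> U.P.Span cons us"
proof -
  interpret A: domain A by (rule A_domain)
  interpret I: ideal I A by (rule I)
  have sub: "subalgebra cons I P" "I \<subseteq> carrier A" using A_ideal_subalgebra[OF I] by auto
  define D where "D = I \<inter> below (deg L a + 3)"
  have D: "subalgebra cons D P"
    unfolding D_def by (rule U.P.subalgebra_inter[OF sub(1) below_subalgebra])
  have "U.P.finite_dimension cons D"
    by (rule U.P.subalbegra_incl_imp_finite_dimension[OF cons_subfield below_finite_dimension[of "deg L a + 3"] D])
      (simp add: D_def)
  then obtain m where "U.P.dimension m cons D" by blast
  then obtain us where us: "set us \<subseteq> carrier P" "U.P.Span cons us = D"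
    using U.P.exists_base[OF cons_subfield] by blast
  show thesis
  proof (rule that)
    show "set us \<subseteq> I" using U.P.Span_base_incl[OF cons_subfield us(1)] us(2) D_def by blast
    fix x assume x: "x \<in> I"
    have ac: "a \<in> carrier A" "x \<in> carrier A" using a x sub by auto
    obtain r where r: "r \<in> carrier A" "x -\<^sub>P a *\<^sub>P r \<in> below (deg L a + 3)"
      using reduce_mod[OF ac(1) a(2) ac(2)] by blast
    have ar: "a *\<^sub>A r \<in> I" using I.I_r_closed[OF a(1) r(1)] .
    then have arA: "a *\<^sub>P r \<in> carrier A" using sub(2) by auto
    have "x -\<^sub>A (a *\<^sub>A r) \<in> I" using I.a_closed[OF x I.a_inv_closed[OF ar]] by (simp add: a_minus_def)
    then have "x -\<^sub>P a *\<^sub>P r \<in> I" using A_minus[OF ac(2) arA] by simp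
    then show "\<exists>r\<in>carrier A. x -\<^sub>P a *\<^sub>P r \<in> U.P.Span cons us"
      using r unfolding us(2) D_def by blast
  qed
qed

lemma A_PIdl: "PIdl\<^bsub>A\<^esub> a = {z *\<^sub>P a | z. z \<in> carrier A}"
  unfolding cgenideal_def by simp

lemma A_noetherian: "noetherian_ring A"
proof -
  interpret A: domain A by (rule A_domain)
  show ?thesis
  proof (rule A.noetherian_ringI)
    fix I assume I: "ideal I A"
    interpret I: ideal I A by (rule I)
    show "\<exists>G\<subseteq>carrier A. finite G \<and> I = Idl\<^bsub>A\<^esub> G"
    proof (cases "I = {\<zero>\<^bsub>P\<^esub>}")
      case True
      then have "I = Idl\<^bsub>A\<^esub> {\<zero>\<^bsub>A\<^esub>}" using A.genideal_zero by simp
      then show ?thesis using A.zero_closed by blast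
    next
      case False
      then obtain a where a: "a \<in> I" "a \<noteq> \<zero>\<^bsub>P\<^esub>" using I.zero_closed by auto
      obtain us where us: "set us \<subseteq> I"
        "\<And>x. x \<in> I \<Longrightarrow> \<exists>r\<in>carrier A. x -\<^sub>P a *\<^sub>P r \<in> U.P.Span cons us"
        using ideal_finite_mod[OF I a] by blast
      define G where "G = insert a (set us)"
      have GI: "G \<subseteq> I" "G \<subseteq> carrier A" unfolding G_def using a us(1) I.a_subset by auto
      have J: "ideal (Idl\<^bsub>A\<^esub> G) A" by (rule A.genideal_ideal[OF GI(2)])
      interpret J: ideal "Idl\<^bsub>A\<^esub> G" A by (rule J)
      have GJ: "G \<subseteq> Idl\<^bsub>A\<^esub> G" by (rule A.genideal_self[OF GI(2)])
      have SJ: "U.P.Span cons us \<subseteq> Idl\<^bsub>A\<^esub> G"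
        by (rule U.P.subalgebra_Span_incl[OF cons_subfield A_ideal_subalgebra(1)[OF J]])
          (use GJ G_def in auto)
      have "I \<subseteq> Idl\<^bsub>A\<^esub> G"
      proof
        fix x assume x: "x \<in> I"
        obtain r where r: "r \<in> carrier A" "x -\<^sub>P a *\<^sub>P r \<in> U.P.Span cons us" using us(2)[OF x] by blast
        have aJ: "a *\<^sub>A r \<in> Idl\<^bsub>A\<^esub> G" using J.I_r_closed[OF _ r(1)] GJ G_def by blast
        have c: "a \<in> carrier P" "r \<in> carrier P" "x \<in> carrier P" using a x r I.a_subset A_carrier by blast+
        have "(x -\<^sub>P a *\<^sub>P r) +\<^sub>A (a *\<^sub>A r) \<in> Idl\<^bsub>A\<^esub> G"
          using J.a_closed[OF _ aJ] r(2) SJ by blast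
        moreover have "(x -\<^sub>P a *\<^sub>P r) +\<^sub>A (a *\<^sub>A r) = x"
          using c by (simp add: U.P.minus_eq U.P.a_assoc U.P.l_neg)
        ultimately show "x \<in> Idl\<^bsub>A\<^esub> G" by simp
      qed
      moreover have "Idl\<^bsub>A\<^esub> G \<subseteq> I" by (rule A.genideal_minimal[OF I GI(1)])
      ultimately show ?thesis using GI(2) G_def by (intro exI[of _ G]) auto
    qed
  qed
qed

text \<open>
  The residue form takes values in K; composing with the embedding of K as constants makes it a
  linear form in the sense of the general duality lemmas.
\<close>

lemma residue_linear_form:
  assumes a: "a \<in> carrier P" "a \<noteq> \<zero>\<^bsub>P\<^esub>"
  shows "linear_form P cons (carrier A) (\<lambda>p. mon (residue a p) 0)"
proof (intro linear_form.intro linear_form_axioms.intro U.UP_cring cons_subfield A_subring cons_A)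
  fix x assume x: "x \<in> carrier A"
  have xP: "x \<in> carrier P" using x A_carrier by blast
  show "mon (residue a x) 0 \<in> cons" using residue_closed[OF a xP] consI by blast
  show "mon (residue a (x +\<^sub>P y)) 0 = mon (residue a x) 0 +\<^sub>P mon (residue a y) 0" if y: "y \<in> carrier A" for y
    using residue_add[OF a xP A_carrier[OF y]] residue_closed[OF a] xP A_carrier[OF y] K_carrier by simp
  show "mon (residue a (c *\<^sub>P x)) 0 = c *\<^sub>P mon (residue a x) 0" if c: "c \<in> cons" for c
  proof -
    obtain k where k: "k \<in> K" "c = mon k 0" using c by (rule consE)
    show ?thesis
      unfolding k(2) residue_scale[OF a xP k(1)]
      using U.monom_mult[OF K_carrier[OF k(1)] K_carrier[OF residue_closed[OF a xP]], of 0 0] by simp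
  qed
qed

text \<open>
  Composing h with the residue form at a gives a functional on I that vanishes on aA. Since I is
  finite-dimensional modulo aA, and aA is the radical of the pairing, some c in A represents
  this functional. Then h(x) and c x pair in the same way with every b in A, because b h(x) and
  h(b x) agree modulo aA; hence they differ by an element of aA.
\<close>

theorem A_principal_quotients_self_injective: "principal_quotients_self_injective A"
  unfolding principal_quotients_self_injective_def
proof (intro allI impI)
  interpret A: domain A by (rule A_domain)
  fix I a h
  assume I: "ideal I A" and aI: "a \<in> I" and a0': "a \<noteq> \<zero>\<^bsub>A\<^esub>" and h: "h \<in> I \<rightarrow> carrier A"
    and hadd: "\<forall>x\<in>I. \<forall>y\<in>I. h (x +\<^sub>A y) -\<^sub>A (h x +\<^sub>A h y) \<in> PIdl\<^bsub>A\<^esub> a"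
    and hmult: "\<forall>r\<in>carrier A. \<forall>x\<in>I. h (r *\<^sub>A x) -\<^sub>A r *\<^sub>A h x \<in> PIdl\<^bsub>A\<^esub> a"
    and ha: "h a \<in> PIdl\<^bsub>A\<^esub> a"
  interpret I: ideal I A by (rule I)
  have a0: "a \<noteq> \<zero>\<^bsub>P\<^esub>" using a0' by simp
  have aA: "a \<in> carrier A" and aP: "a \<in> carrier P" using aI I.a_subset A_carrier by auto
  have IA: "x \<in> carrier A" "x \<in> carrier P" if "x \<in> I" for x using that I.a_subset A_carrier by auto
  have hA: "h x \<in> carrier A" "h x \<in> carrier P" if "x \<in> I" for x using that h A_carrier by auto
  note AP = A_carrier
  have A_mult: "p *\<^sub>P q \<in> carrier A" "p +\<^sub>P q \<in> carrier A" if "p \<in> carrier A" "q \<in> carrier A" for p q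
    using subringE(6,7)[OF A_subring] that by auto
  have residue_cong: "residue a x = residue a y" if xy: "x \<in> carrier A" "y \<in> carrier A" "x -\<^sub>A y \<in> PIdl\<^bsub>A\<^esub> a" for x y
  proof -
    have c: "x \<in> carrier P" "y \<in> carrier P" using xy AP by auto
    obtain z where z: "z \<in> carrier A" "x -\<^sub>P y = z *\<^sub>P a"
      using xy(3) A_minus[OF xy(1,2)] unfolding A_PIdl by auto
    have "x = a *\<^sub>P z +\<^sub>P y"
    proof -
      have "x = (x -\<^sub>P y) +\<^sub>P y" using c by (simp add: U.P.minus_eq U.P.a_assoc U.P.l_neg)
      then show ?thesis unfolding z(2) using U.P.m_comm[OF AP[OF z(1)] aP] by simp
    qed
    then have "residue a x = residue a (a *\<^sub>P z) \<oplus> residue a y"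
      using residue_add[OF aP a0, of "a *\<^sub>P z" y] aP AP[OF z(1)] c by simp
    then show ?thesis using residue_principal[OF aP a0 z(1)] K_carrier[OF residue_closed[OF aP a0 c(2)]] by simp
  qed
  interpret F: linear_form P cons "carrier A" "\<lambda>p. mon (residue a p) 0" by (rule residue_linear_form[OF aP a0])
  have mon_inj: "x = y" if "mon x 0 = mon y 0" "x \<in> carrier L" "y \<in> carrier L" for x y
    using U.monom_inj[of 0] that by (auto dest: inj_onD)
  have lamL: "residue a x \<in> carrier L" if "x \<in> carrier P" for x
    using residue_closed[OF aP a0 that] K_carrier by blast
  obtain us where us: "set us \<subseteq> I"
    "\<And>x. x \<in> I \<Longrightarrow> \<exists>r\<in>carrier A. x -\<^sub>P a *\<^sub>P r \<in> U.P.Span cons us"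
    using ideal_finite_mod[OF I aI a0] by blast
  have h_lam_add: "residue a (h (x +\<^sub>P y)) = residue a (h x) \<oplus> residue a (h y)" if "x \<in> I" "y \<in> I" for x y
  proof -
    have xyI: "x +\<^sub>P y \<in> I" using I.a_closed[OF that] by simp
    have "h (x +\<^sub>P y) -\<^sub>A (h x +\<^sub>P h y) \<in> PIdl\<^bsub>A\<^esub> a"
      using hadd[rule_format, OF that] unfolding A_ops .
    then have "residue a (h (x +\<^sub>P y)) = residue a (h x +\<^sub>P h y)"
      by (rule residue_cong[OF hA(1)[OF xyI] A_mult(2)[OF hA(1)[OF that(1)] hA(1)[OF that(2)]]])
    then show ?thesis using residue_add[OF aP a0] hA that by simp
  qed
  have h_lam_mult: "residue a (h (c *\<^sub>P x)) = residue a (c *\<^sub>P h x)" if "c \<in> carrier A" "x \<in> I" for c x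
  proof -
    have cxI: "c *\<^sub>P x \<in> I" using I.I_l_closed[OF that(2,1)] by simp
    have "h (c *\<^sub>P x) -\<^sub>A c *\<^sub>P h x \<in> PIdl\<^bsub>A\<^esub> a"
      using hmult[rule_format, OF that] unfolding A_ops .
    then show ?thesis
      by (rule residue_cong[OF hA(1)[OF cxI] A_mult(1)[OF that(1) hA(1)[OF that(2)]]])
  qed
  have h_principal: "residue a (h (a *\<^sub>P r)) = \<zero>" if r: "r \<in> carrier A" for r
  proof -
    obtain z where z: "z \<in> carrier A" "h a = z *\<^sub>P a" using ha unfolding A_PIdl by auto
    have "a *\<^sub>P r = r *\<^sub>P a" using aP AP[OF r] by (simp add: U.P.m_comm)
    moreover have "r *\<^sub>P h a = a *\<^sub>P (r *\<^sub>P z)"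
      unfolding z(2) using aP AP[OF r] AP[OF z(1)] by (simp add: U.P.m_ac)
    ultimately show ?thesis
      using h_lam_mult[OF r aI] residue_principal[OF aP a0 A_mult(1)[OF r z(1)]] by simp
  qed
  have "\<exists>c\<in>carrier A. \<forall>x\<in>U.P.Span cons us. mon (residue a (c *\<^sub>P x)) 0 = mon (residue a (h x)) 0"
  proof (rule F.represent_functional[OF A_ideal_subalgebra[OF I] us(1)])
    fix x assume x: "x \<in> I"
    show "mon (residue a (h x)) 0 \<in> cons" using consI residue_closed[OF aP a0] hA x by blast
    show "mon (residue a (h (x +\<^sub>P y))) 0 = mon (residue a (h x)) 0 +\<^sub>P mon (residue a (h y)) 0" if "y \<in> I" for y
      using h_lam_add[OF x that] lamL hA x that by simp
    show "mon (residue a (h (c *\<^sub>P x))) 0 = c *\<^sub>P mon (residue a (h x)) 0" if c: "c \<in> cons" for c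
      using h_lam_mult[OF _ x, of c] F.form_smult[OF c, of "h x"] c cons_A hA x by auto
    assume rad: "\<forall>c\<in>carrier A. mon (residue a (c *\<^sub>P x)) 0 = \<zero>\<^bsub>P\<^esub>"
    have "residue a (c *\<^sub>P x) = \<zero>" if c: "c \<in> carrier A" for c
      using mon_inj[of "residue a (c *\<^sub>P x)" \<zero>] rad c lamL AP IA x by simp
    then obtain q where "q \<in> carrier A" "x = a *\<^sub>P q"
      using residue_radical[OF aP a0 IA(1)[OF x]] by blast
    then show "mon (residue a (h x)) 0 = \<zero>\<^bsub>P\<^esub>" using h_principal by simp
  qed
  then obtain c where c: "c \<in> carrier A"
    "\<And>x. x \<in> U.P.Span cons us \<Longrightarrow> mon (residue a (c *\<^sub>P x)) 0 = mon (residue a (h x)) 0" by blast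
  have SI: "U.P.Span cons us \<subseteq> I"
    by (rule U.P.subalgebra_Span_incl[OF cons_subfield A_ideal_subalgebra(1)[OF I] us(1)])
  have rep: "residue a (c *\<^sub>P x) = residue a (h x)" if x: "x \<in> I" for x
  proof -
    obtain r where r: "r \<in> carrier A" "x -\<^sub>P a *\<^sub>P r \<in> U.P.Span cons us" using us(2)[OF x] by blast
    define y where "y = x -\<^sub>P a *\<^sub>P r"
    have y: "y \<in> I" "y \<in> U.P.Span cons us" using r SI unfolding y_def by auto
    have cc: "x \<in> carrier P" "y \<in> carrier P" "r \<in> carrier P" "c \<in> carrier P" using IA x y r c AP by auto
    have xe: "x = a *\<^sub>P r +\<^sub>P y"
      unfolding y_def using cc aP by (simp add: U.P.minus_eq U.P.a_lcomm[of "a *\<^sub>P r" x] U.P.r_neg)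
    have arI: "a *\<^sub>P r \<in> I" using I.I_r_closed[OF aI r(1)] by simp
    have "residue a (c *\<^sub>P y) = residue a (h y)"
      by (rule mon_inj[OF c(2)[OF y(2)]]) (use lamL cc hA y in auto)
    moreover have "c *\<^sub>P x = a *\<^sub>P (c *\<^sub>P r) +\<^sub>P c *\<^sub>P y"
      unfolding xe using cc aP by (simp add: U.P.r_distr U.P.m_lcomm)
    ultimately have "residue a (c *\<^sub>P x) = residue a (h y)"
      using residue_add[OF aP a0, of "a *\<^sub>P (c *\<^sub>P r)" "c *\<^sub>P y"] residue_principal[OF aP a0 A_mult(1)[OF c(1) r(1)]]
        cc aP lamL[of "h y"] hA(2)[OF y(1)] by simp
    moreover have "residue a (h x) = residue a (h y)"
      using h_lam_add[OF arI y(1)] h_principal[OF r(1)] lamL[of "h y"] hA(2)[OF y(1)] unfolding xe[symmetric] by simp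
    ultimately show ?thesis by simp
  qed
  show "\<exists>c\<in>carrier A. \<forall>x\<in>I. h x -\<^sub>A c *\<^sub>A x \<in> PIdl\<^bsub>A\<^esub> a"
  proof (intro bexI[OF _ c(1)] ballI)
    fix x assume x: "x \<in> I"
    have cx: "c *\<^sub>P x \<in> carrier A" using A_mult(1)[OF c(1) IA(1)[OF x]] .
    have d: "h x -\<^sub>P c *\<^sub>P x \<in> carrier A"
      using A.minus_closed[OF hA(1)[OF x] cx] A_minus[OF hA(1)[OF x] cx] by simp
    have "residue a (b *\<^sub>P (h x -\<^sub>P c *\<^sub>P x)) = \<zero>" if b: "b \<in> carrier A" for b
    proof -
      have cc: "b \<in> carrier P" "h x \<in> carrier P" "c \<in> carrier P" "x \<in> carrier P"
        using b hA x c IA AP by auto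
      have bx: "b *\<^sub>P x \<in> I" using I.I_l_closed[OF x b] by simp
      have "residue a (b *\<^sub>P h x) = residue a (c *\<^sub>P (b *\<^sub>P x))"
        using h_lam_mult[OF b x] rep[OF bx] by simp
      also have "c *\<^sub>P (b *\<^sub>P x) = b *\<^sub>P (c *\<^sub>P x)" using cc by (simp add: U.P.m_lcomm)
      finally have e: "residue a (b *\<^sub>P h x) = residue a (b *\<^sub>P (c *\<^sub>P x))" .
      have "b *\<^sub>P h x = b *\<^sub>P (h x -\<^sub>P c *\<^sub>P x) +\<^sub>P b *\<^sub>P (c *\<^sub>P x)"
        using cc by (simp add: U.P.minus_eq U.P.r_distr[symmetric] U.P.a_assoc U.P.l_neg)
      then have "residue a (b *\<^sub>P h x) = residue a (b *\<^sub>P (h x -\<^sub>P c *\<^sub>P x)) \<oplus> residue a (b *\<^sub>P (c *\<^sub>P x))"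
        using residue_add[OF aP a0, of "b *\<^sub>P (h x -\<^sub>P c *\<^sub>P x)" "b *\<^sub>P (c *\<^sub>P x)"] cc by simp
      then show ?thesis
        using e lamL[of "b *\<^sub>P (h x -\<^sub>P c *\<^sub>P x)"] lamL[of "b *\<^sub>P (c *\<^sub>P x)"] cc
        by (metis U.P.m_closed U.P.minus_closed add.r_cancel_one')
    qed
    then obtain q where q: "q \<in> carrier A" "h x -\<^sub>P c *\<^sub>P x = a *\<^sub>P q"
      using residue_radical[OF aP a0 d] by blast
    then have "h x -\<^sub>P c *\<^sub>P x = q *\<^sub>P a" using U.P.m_comm[OF aP AP[OF q(1)]] by simp
    then show "h x -\<^sub>A c *\<^sub>A x \<in> PIdl\<^bsub>A\<^esub> a"
      unfolding A_PIdl using A_minus[OF hA(1)[OF x] cx] q(1) by auto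
  qed
qed

end

section \<open>Krull dimension\<close>

text \<open>
  The direction matters: the chosen element depends on later ones only. For a list of powers of
  x this means that a power of x is a combination of higher powers.
\<close>

lemma (in ring) dependent_list_element:
  assumes "set us \<subseteq> carrier R" "dependent K us"
  shows "\<exists>i<length us. us ! i \<in> Span K (drop (Suc i) us)"
  using assms
proof (induction us rule: list.induct)
  case Nil
  then show ?case by simp
next
  case (Cons u us)
  show ?case
  proof (cases "u \<in> Span K us")
    case True
    then show ?thesis by (intro exI[of _ 0]) simp
  next
    case False
    then have "dependent K us" using Cons.prems li_Cons by auto
    then obtain i where "i < length us" "us ! i \<in> Span K (drop (Suc i) us)"
      using Cons.IH Cons.prems(1) by auto
    then show ?thesis by (intro exI[of _ "Suc i"]) simp
  qed
qed

context KWH_form begin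

text \<open>
  Let a be a nonzero element of the prime I, and x in J outside I. The remainders of the powers of x modulo
  a lie in a finite-dimensional space, so x^i is congruent to g x^(i + 1) modulo I
  for some i and g. As I is prime and does not contain x, it contains 1 - g x, and
  therefore 1 lies in J.
\<close>

lemma nonzero_prime_maximal:
  assumes I: "primeideal I A" "I \<noteq> {\<zero>\<^bsub>P\<^esub>}" and J: "ideal J A" "I \<subset> J"
  shows "J = carrier A"
proof -
  interpret A: domain A by (rule A_domain)
  interpret I: primeideal I A by (rule I(1))
  interpret J: ideal J A by (rule J(1))
  obtain a where a: "a \<in> I" "a \<noteq> \<zero>\<^bsub>P\<^esub>" using I(2) I.zero_closed by auto
  obtain x where x: "x \<in> J" "x \<notin> I" using J(2) by blast
  have aA: "a \<in> carrier A" and xA: "x \<in> carrier A" using a x I.a_subset J.a_subset by auto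
  have xp: "x [^]\<^bsub>A\<^esub> i \<in> carrier A" for i :: nat using xA by simp
  have "\<exists>r. r \<in> carrier A \<and> x [^]\<^bsub>A\<^esub> i -\<^sub>P a *\<^sub>P r \<in> below (deg L a + 3)" for i :: nat
    using reduce_mod[OF aA a(2) xp] by blast
  then obtain r where r: "\<And>i::nat. r i \<in> carrier A"
    "\<And>i::nat. x [^]\<^bsub>A\<^esub> i -\<^sub>P a *\<^sub>P r i \<in> below (deg L a + 3)" by metis
  define y where "y i = x [^]\<^bsub>A\<^esub> i -\<^sub>P a *\<^sub>P r i" for i :: nat
  have arA: "a *\<^sub>A r i \<in> I" "a *\<^sub>P r i \<in> carrier A" for i
    using I.I_r_closed[OF a(1) r(1)] A.m_closed[OF aA r(1)] by auto
  have yA: "y i = x [^]\<^bsub>A\<^esub> i -\<^sub>A a *\<^sub>A r i" for i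
    unfolding y_def using A_minus[OF xp arA(2)] by simp
  have yc: "y i \<in> carrier A" for i unfolding yA using A.minus_closed[OF xp A.m_closed[OF aA r(1)]] .
  obtain D where D: "U.P.dimension D cons (below (deg L a + 3))"
    using below_finite_dimension by blast
  define ys where "ys = map y [0..<Suc D]"
  have ys: "set ys \<subseteq> below (deg L a + 3)" "set ys \<subseteq> carrier P" "length ys = Suc D"
    unfolding ys_def using r(2) yc A_carrier unfolding y_def by (auto simp del: upt_Suc)
  have "\<not> U.P.independent cons ys"
    using U.P.independent_length_le_dimension[OF cons_subfield D _ ys(1)] ys(3) by auto
  then obtain i where i: "i < length ys" "ys ! i \<in> U.P.Span cons (drop (Suc i) ys)"
    using U.P.dependent_list_element[OF ys(2)] by blast
  \<comment> \<open>Modulo I, the ideal Q is generated by the power of x with exponent i + 1; it contains all later remainders.\<close>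
  define Q where "Q = PIdl\<^bsub>A\<^esub> (x [^]\<^bsub>A\<^esub> Suc i) <+>\<^bsub>A\<^esub> I"
  have Q: "ideal Q A"
    unfolding Q_def by (rule A.add_ideals[OF A.cgenideal_ideal[OF xp] I.ideal_axioms])
  interpret Q: ideal Q A by (rule Q)
  have QI: "p \<in> Q" if "p \<in> I" for p
  proof -
    have pc: "p \<in> carrier A" using that I.a_subset by blast
    have "p = \<zero>\<^bsub>A\<^esub> *\<^sub>A x [^]\<^bsub>A\<^esub> Suc i +\<^sub>A p"
      by (simp only: A.l_null[OF xp] A.l_zero[OF pc])
    moreover have "\<zero>\<^bsub>A\<^esub> *\<^sub>A x [^]\<^bsub>A\<^esub> Suc i \<in> PIdl\<^bsub>A\<^esub> (x [^]\<^bsub>A\<^esub> Suc i)"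
      unfolding cgenideal_def using A.zero_closed by blast
    ultimately show ?thesis unfolding Q_def set_add_def' using that by blast
  qed
  have Qx: "x [^]\<^bsub>A\<^esub> j \<in> Q" if "j \<ge> Suc i" for j
  proof -
    have "x [^]\<^bsub>A\<^esub> Suc i \<in> Q"
    proof -
      have "x [^]\<^bsub>A\<^esub> Suc i = x [^]\<^bsub>A\<^esub> Suc i +\<^sub>A \<zero>\<^bsub>A\<^esub>" using A.r_zero[OF xp] ..
      then show ?thesis unfolding Q_def set_add_def'
        using A.cgenideal_self[OF xp[of "Suc i"]] I.zero_closed by blast
    qed
    then have "x [^]\<^bsub>A\<^esub> (j - Suc i) *\<^sub>A x [^]\<^bsub>A\<^esub> Suc i \<in> Q"
      using Q.I_l_closed[OF _ xp] by blast
    then show ?thesis using A.nat_pow_mult[OF xA, of "j - Suc i" "Suc i"] that by simp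
  qed
  have Qm: "p -\<^sub>A q \<in> Q" if "p \<in> Q" "q \<in> Q" for p q
    unfolding a_minus_def by (rule Q.a_closed[OF that(1) Q.a_inv_closed[OF that(2)]])
  have "set (drop (Suc i) ys) \<subseteq> Q"
  proof
    fix v assume "v \<in> set (drop (Suc i) ys)"
    then obtain j where "j < length (drop (Suc i) ys)" "v = drop (Suc i) ys ! j"
      by (metis in_set_conv_nth)
    then have "v = y (Suc i + j)" unfolding ys_def by (auto simp del: upt_Suc)
    then show "v \<in> Q" unfolding yA using Qm[OF Qx[of "Suc i + j"] QI[OF arA(1)[of "Suc i + j"]]] by simp
  qed
  then have "y i \<in> Q"
    using U.P.subalgebra_Span_incl[OF cons_subfield A_ideal_subalgebra(1)[OF Q]] i ys(3)
    unfolding ys_def by (auto simp del: upt_Suc)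
  then have "y i +\<^sub>A a *\<^sub>A r i \<in> Q" using Q.a_closed QI[OF arA(1)] by blast
  moreover have "y i +\<^sub>A a *\<^sub>A r i = x [^]\<^bsub>A\<^esub> i"
    unfolding yA using xp[of i] A.m_closed[OF aA r(1)] by (simp add: A.minus_eq A.a_assoc A.l_neg del: A_ops A_a_inv)
  ultimately have "x [^]\<^bsub>A\<^esub> i \<in> Q" by simp
  then obtain g p where g: "g \<in> carrier A" "p \<in> I" "x [^]\<^bsub>A\<^esub> i = g *\<^sub>A x [^]\<^bsub>A\<^esub> Suc i +\<^sub>A p"
    unfolding Q_def set_add_def' cgenideal_def by blast
  define z where "z = x [^]\<^bsub>A\<^esub> i"
  have z: "z \<in> carrier A" "x [^]\<^bsub>A\<^esub> Suc i = z *\<^sub>A x" unfolding z_def using xp by simp_all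
  have pA: "p \<in> carrier A" using g(2) I.a_subset by blast
  have ze: "z = g *\<^sub>A (z *\<^sub>A x) +\<^sub>A p" using g(3) z(2) unfolding z_def[symmetric] by simp
  have "z *\<^sub>A (\<one>\<^bsub>A\<^esub> -\<^sub>A g *\<^sub>A x) = z -\<^sub>A g *\<^sub>A (z *\<^sub>A x)"
    using z(1) g(1) xA by algebra
  also have "\<dots> = (g *\<^sub>A (z *\<^sub>A x) +\<^sub>A p) -\<^sub>A g *\<^sub>A (z *\<^sub>A x)"
    using arg_cong[OF ze, of "\<lambda>u. u -\<^sub>A g *\<^sub>A (z *\<^sub>A x)"] .
  also have "\<dots> = p"
    using z(1) g(1) xA pA by algebra
  finally have "z *\<^sub>A (\<one>\<^bsub>A\<^esub> -\<^sub>A g *\<^sub>A x) \<in> I" using g(2) by simp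
  moreover have c1: "\<one>\<^bsub>A\<^esub> -\<^sub>A g *\<^sub>A x \<in> carrier A"
    by (rule A.minus_closed[OF A.one_closed A.m_closed[OF g(1) xA]])
  moreover have "x [^]\<^bsub>A\<^esub> j \<notin> I" for j :: nat
  proof (induction j)
    case 0
    have "\<one>\<^bsub>A\<^esub> \<notin> I" using I.one_imp_carrier I.I_notcarr by blast
    then show ?case by simp
  next
    case (Suc j)
    then show ?case using I.I_prime[OF xp[of j] xA] x(2) by auto
  qed
  ultimately have "\<one>\<^bsub>A\<^esub> -\<^sub>A g *\<^sub>A x \<in> J"
    using I.I_prime[OF z(1) c1] J(2) unfolding z_def by blast
  then have "(\<one>\<^bsub>A\<^esub> -\<^sub>A g *\<^sub>A x) +\<^sub>A g *\<^sub>A x \<in> J"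
    using J.a_closed J.I_l_closed[OF x(1) g(1)] by blast
  moreover have "(\<one>\<^bsub>A\<^esub> -\<^sub>A g *\<^sub>A x) +\<^sub>A g *\<^sub>A x = \<one>\<^bsub>A\<^esub>"
    using g(1) xA by algebra
  ultimately show ?thesis using J.one_imp_carrier by simp
qed

lemma augmentation_primeideal:
  "primeideal {p \<in> carrier A. co p 0 = \<zero>} A"
proof -
  interpret A: domain A by (rule A_domain)
  have prod: "co (p *\<^sub>A q) 0 = co p 0 \<otimes> co q 0" if "p \<in> carrier A" "q \<in> carrier A" for p q
    using A_carrier that by simp
  show ?thesis
  proof (rule primeidealI)
    show "ideal {p \<in> carrier A. co p 0 = \<zero>} A"
    proof (rule idealI)
      show "ring A" by (rule A.ring_axioms)
      show "subgroup {p \<in> carrier A. co p 0 = \<zero>} (add_monoid A)"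
      proof (rule A.add.subgroupI)
        have "\<zero>\<^bsub>A\<^esub> \<in> {p \<in> carrier A. co p 0 = \<zero>}" using A.zero_closed by simp
        then show "{p \<in> carrier A. co p 0 = \<zero>} \<noteq> {}" by blast
        fix p assume p: "p \<in> {p \<in> carrier A. co p 0 = \<zero>}"
        then show "\<ominus>\<^bsub>A\<^esub> p \<in> {p \<in> carrier A. co p 0 = \<zero>}"
          using A.a_inv_closed[of p] A_carrier by auto
        fix q assume "q \<in> {p \<in> carrier A. co p 0 = \<zero>}"
        then show "p +\<^sub>A q \<in> {p \<in> carrier A. co p 0 = \<zero>}"
          using p A.a_closed[of p q] A_carrier by auto
      qed blast
      fix a x assume a: "a \<in> {p \<in> carrier A. co p 0 = \<zero>}" "x \<in> carrier A"
      then have "co a 0 = \<zero>" "co x 0 \<in> carrier L" "a \<in> carrier A" using A_carrier by auto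
      then show "x *\<^sub>A a \<in> {p \<in> carrier A. co p 0 = \<zero>}" "a *\<^sub>A x \<in> {p \<in> carrier A. co p 0 = \<zero>}"
        using prod[of x a] prod[of a x] a(2) A.m_closed[of x a] A.m_closed[of a x] by simp_all
    qed
    show "cring A" by (rule A.is_cring)
    have "\<one>\<^bsub>A\<^esub> \<notin> {p \<in> carrier A. co p 0 = \<zero>}" by simp
    then show "carrier A \<noteq> {p \<in> carrier A. co p 0 = \<zero>}" using A.one_closed by blast
    fix p q assume p: "p \<in> carrier A" "q \<in> carrier A" "p *\<^sub>A q \<in> {p \<in> carrier A. co p 0 = \<zero>}"
    then have "co p 0 \<otimes> co q 0 = \<zero>" using prod by auto
    then show "p \<in> {p \<in> carrier A. co p 0 = \<zero>} \<or> q \<in> {p \<in> carrier A. co p 0 = \<zero>}"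
      using p(1,2) integral[of "co p 0" "co q 0"] A_carrier by auto
  qed
qed

theorem A_krull_dim: "krull_dim A = 1"
proof -
  interpret A: domain A by (rule A_domain)
  let ?X = "{enat m | m. \<exists>I :: nat \<Rightarrow> (nat \<Rightarrow> 'a) set.
     (\<forall>i\<le>m. primeideal (I i) A) \<and> (\<forall>i<m. I i \<subset> I (Suc i))}"
  have "Sup ?X = 1"
  proof (rule antisym)
    show "Sup ?X \<le> 1"
    proof (rule Sup_least)
      fix e assume "e \<in> ?X"
      then obtain m and I :: "nat \<Rightarrow> (nat \<Rightarrow> 'a) set" where m: "e = enat m"
        "\<forall>i\<le>m. primeideal (I i) A" "\<forall>i<m. I i \<subset> I (Suc i)" by blast
      have "m \<le> 1"
      proof (rule ccontr)
        assume "\<not> m \<le> 1"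
        then have i: "primeideal (I 0) A" "primeideal (I 1) A" "primeideal (I 2) A" "I 0 \<subset> I 1" "I 1 \<subset> I 2"
          using m(2,3) by (auto simp: numeral_2_eq_2)
        interpret I0: primeideal "I 0" A by (rule i(1))
        interpret I2: primeideal "I 2" A by (rule i(3))
        have "I 1 \<noteq> {\<zero>\<^bsub>P\<^esub>}" using I0.zero_closed i(4) by auto
        then have "I 2 = carrier A" using nonzero_prime_maximal[OF i(2) _ I2.ideal_axioms i(5)] by blast
        then show False using I2.I_notcarr by blast
      qed
      then show "e \<le> 1" unfolding m(1) one_enat_def by simp
    qed
    let ?M = "{p \<in> carrier A. co p 0 = \<zero>}"
    have t3: "mon \<one> 3 \<in> ?M" using mon_mem_A[of \<one> 3] V_simps(5)[of 3] by simp
    have "mon \<one> 3 \<noteq> \<zero>\<^bsub>P\<^esub>"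
      using U.coeff_monom[OF one_closed, of 3 3] U.coeff_zero[of 3] one_not_zero by metis
    then have "mon \<one> 3 \<noteq> \<zero>\<^bsub>A\<^esub>" by simp
    moreover have "\<zero>\<^bsub>A\<^esub> \<in> ?M" using A.zero_closed by simp
    ultimately have "{\<zero>\<^bsub>A\<^esub>} \<subset> ?M" using t3 by blast
    then have "enat 1 \<in> ?X"
      using A.zeroprimeideal augmentation_primeideal
      by (intro CollectI exI[of _ 1] conjI exI[of _ "\<lambda>i. if i = 0 then {\<zero>\<^bsub>A\<^esub>} else ?M"]) auto
    then show "1 \<le> Sup ?X" unfolding one_enat_def by (rule Sup_upper)
  qed
  then show ?thesis unfolding krull_dim_def .
qed

section \<open>Grading and generators\<close>

abbreviation comp where "comp \<equiv> KWH_component L K W H"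

lemma compE: assumes "p \<in> comp i" obtains l where "l \<in> V i" "p = mon l i"
  using assms unfolding KWH_component_def by auto

lemma compI: "l \<in> V i \<Longrightarrow> mon l i \<in> comp i"
  unfolding KWH_component_def by auto

lemma comp_0: "comp 0 = cons"
  unfolding KWH_component_def cons_def constants_def V_simps ..

lemma comp_A: "comp i \<subseteq> carrier A"
  using mon_mem_A unfolding KWH_component_def by blast

lemma comp_subalgebra: "subalgebra cons (comp i) A"
proof (intro subalgebra.intro subalgebra_axioms.intro)
  interpret A: domain A by (rule A_domain)
  show "subgroup (comp i) (add_monoid A)"
  proof (rule A.add.subgroupI)
    show "comp i \<subseteq> carrier A" by (rule comp_A)
    show "comp i \<noteq> {}" using compI[OF V_closed(2)] by blast
    fix p assume p: "p \<in> comp i"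
    then obtain l where l: "l \<in> V i" "p = mon l i" by (rule compE)
    have lc: "l \<in> carrier L" using l V_closed(1) by blast
    show "\<ominus>\<^bsub>A\<^esub> p \<in> comp i"
    proof -
      have "p \<in> carrier A" using comp_A p by blast
      then have "\<ominus>\<^bsub>A\<^esub> p = mon (\<ominus> l) i" using U.monom_a_inv[OF lc] l(2) by simp
      then show ?thesis using compI[OF V_closed(4)[OF l(1)]] by simp
    qed
    fix q assume "q \<in> comp i"
    then obtain m where m: "m \<in> V i" "q = mon m i" by (rule compE)
    have mc: "m \<in> carrier L" using m V_closed(1) by blast
    show "p +\<^sub>A q \<in> comp i"
      using compI[OF V_closed(3)[OF l(1) m(1)]] lc mc unfolding l(2) m(2) by simp
  qed
  fix c p assume c: "c \<in> cons" and p: "p \<in> comp i"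
  obtain k where k: "k \<in> K" "c = mon k 0" using c by (rule consE)
  obtain l where l: "l \<in> V i" "p = mon l i" using p by (rule compE)
  have "k \<otimes> l \<in> V i" using subalgebra.smult_closed[OF V_subalgebra k(1) l(1)] .
  then show "c *\<^sub>A p \<in> comp i"
    using compI[of "k \<otimes> l" i] U.monom_mult[of k l 0 i] K_carrier[OF k(1)] V_closed(1)[OF l(1)]
    unfolding k(2) l(2) by simp
qed

lemma comp_co:
  assumes "p \<in> comp i"
  shows "co p m = (if m = i then co p i else \<zero>)" "p = mon (co p i) i"
proof -
  obtain l where l: "l \<in> V i" "p = mon l i" using assms by (rule compE)
  show "co p m = (if m = i then co p i else \<zero>)" "p = mon (co p i) i"
    unfolding l(2) using V_closed(1)[OF l(1)] by auto
qed

lemma finsum_homogeneous: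
  assumes "finite S" "\<And>i. i \<in> S \<Longrightarrow> f i \<in> comp i"
  shows "finsum A f S \<in> carrier A" "co (finsum A f S) m = (if m \<in> S then co (f m) m else \<zero>)"
proof -
  interpret A: domain A by (rule A_domain)
  show c: "finsum A f S \<in> carrier A" using assms(2) comp_A by (intro A.finsum_closed) blast
  show "co (finsum A f S) m = (if m \<in> S then co (f m) m else \<zero>)"
    using assms
  proof (induction S rule: finite_induct)
    case empty
    then show ?case by simp
  next
    case (insert i S)
    have f: "f i \<in> carrier A" "f \<in> S \<rightarrow> carrier A" using insert.prems comp_A by auto
    have "finsum A f (insert i S) = f i +\<^sub>P finsum A f S"
      using A.finsum_insert[OF insert.hyps(1,2) f(2,1)] by simp
    moreover have fi: "f i \<in> comp i" using insert.prems by simp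
    moreover have "finsum A f S \<in> carrier P" using A.finsum_closed[OF f(2)] A_carrier by blast
    moreover have "co (f m) m \<in> carrier L" if "m \<in> S"
      using that insert.prems[of m] comp_A A_carrier U.coeff_closed by blast
    ultimately show ?case
      using insert A_carrier[OF f(1)] comp_co(1)[OF fi, of m] by auto
  qed
qed

lemma homogeneous_decomposition:
  assumes x: "x \<in> carrier A"
  shows "\<exists>!f. (\<forall>i. f i \<in> comp i) \<and> finite {i. f i \<noteq> \<zero>\<^bsub>A\<^esub>} \<and> x = finsum A f {i. f i \<noteq> \<zero>\<^bsub>A\<^esub>}"
proof
  let ?f = "\<lambda>i. mon (co x i) i"
  have xP: "x \<in> carrier P" using x A_carrier by blast
  have fc: "?f i \<in> comp i" for i using x mem_A compI by blast
  have fin: "finite {i. ?f i \<noteq> \<zero>\<^bsub>A\<^esub>}"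
  proof (rule finite_subset)
    show "{i. ?f i \<noteq> \<zero>\<^bsub>A\<^esub>} \<subseteq> {..deg L x}"
    proof (rule ccontr)
      assume "\<not> ?thesis"
      then obtain i where i: "?f i \<noteq> \<zero>\<^bsub>A\<^esub>" "\<not> i \<le> deg L x" by blast
      then have "co x i = \<zero>" using U.deg_aboveD[OF _ xP] by simp
      then show False using i(1) by simp
    qed
  qed simp
  have "co x m = co (finsum A ?f {i. ?f i \<noteq> \<zero>\<^bsub>A\<^esub>}) m" for m
  proof (cases "?f m = \<zero>\<^bsub>A\<^esub>")
    case True
    then have "co x m = \<zero>" using U.coeff_monom[of "co x m" m m] xP by simp
    then show ?thesis using finsum_homogeneous(2)[OF fin fc, of m] True by simp
  next
    case False
    then show ?thesis using finsum_homogeneous(2)[OF fin fc, of m] xP by simp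
  qed
  then have "x = finsum A ?f {i. ?f i \<noteq> \<zero>\<^bsub>A\<^esub>}"
    using U.up_eqI xP finsum_homogeneous(1)[OF fin fc] A_carrier by blast
  then show "(\<forall>i. ?f i \<in> comp i) \<and> finite {i. ?f i \<noteq> \<zero>\<^bsub>A\<^esub>} \<and> x = finsum A ?f {i. ?f i \<noteq> \<zero>\<^bsub>A\<^esub>}"
    using fc fin by blast
  fix f assume f: "(\<forall>i. f i \<in> comp i) \<and> finite {i. f i \<noteq> \<zero>\<^bsub>A\<^esub>} \<and> x = finsum A f {i. f i \<noteq> \<zero>\<^bsub>A\<^esub>}"
  show "f = ?f"
  proof
    fix m
    have "co x m = (if m \<in> {i. f i \<noteq> \<zero>\<^bsub>A\<^esub>} then co (f m) m else \<zero>)"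
      using f finsum_homogeneous(2)[of "{i. f i \<noteq> \<zero>\<^bsub>A\<^esub>}" f m] by metis
    then have "co x m = co (f m) m" by auto
    then show "f m = ?f m" using comp_co(2)[of "f m" m] f by simp
  qed
qed

lemma cons_subfield_A: "subfield cons A"
proof -
  interpret A: domain A by (rule A_domain)
  have "A\<lparr>carrier := cons\<rparr> = P\<lparr>carrier := cons\<rparr>" unfolding KWH_algebra_def by simp
  moreover have "field (P\<lparr>carrier := cons\<rparr>)"
    using U.P.subfield_iff(2)[OF cons_subfield] .
  ultimately show ?thesis using A.subfield_iff(1) cons_A by simp
qed

lemma A_graded: "graded_algebra cons A comp"
  unfolding graded_algebra_def
proof (intro conjI allI ballI)
  show "cring A" using A_domain by (simp add: domain_def)
  show "subfield cons A" by (rule cons_subfield_A)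
  show "subalgebra cons (comp i) A" for i by (rule comp_subalgebra)
  fix i j p q assume p: "p \<in> comp i" and q: "q \<in> comp j"
  obtain l where l: "l \<in> V i" "p = mon l i" using p by (rule compE)
  obtain m where m: "m \<in> V j" "q = mon m j" using q by (rule compE)
  show "p *\<^sub>A q \<in> comp (i + j)"
    using compI[OF V_mult[OF l(1) m(1)]] U.monom_mult[of l m i j] V_closed(1)[OF l(1)] V_closed(1)[OF m(1)]
    unfolding l(2) m(2) by simp
next
  fix x assume "x \<in> carrier A"
  then show "\<exists>!f. (\<forall>i. f i \<in> comp i) \<and> finite {i. f i \<noteq> \<zero>\<^bsub>A\<^esub>} \<and> x = finsum A f {i. f i \<noteq> \<zero>\<^bsub>A\<^esub>}"
    by (rule homogeneous_decomposition)
qed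

lemma mon_mult:
  "\<lbrakk>a \<in> carrier L; b \<in> carrier L; k = i + j\<rbrakk> \<Longrightarrow> mon a i *\<^sub>P mon b j = mon (a \<otimes> b) k"
  using U.monom_mult by simp

text \<open>
  Since W H spans L, the component L t^3 is generated by the components below it. Multiplying by t,
  which is an element of W t because K is contained in W, yields all higher components.
\<close>

lemma subring_containing_degree_le_two:
  assumes G: "subring G A" and c: "cons \<subseteq> G" and one: "comp 1 \<subseteq> G" and two: "comp 2 \<subseteq> G"
  shows "carrier A \<subseteq> G"
proof
  interpret A: domain A by (rule A_domain)
  have Gm: "p *\<^sub>P q \<in> G" and Ga: "p +\<^sub>P q \<in> G" if "p \<in> G" "q \<in> G" for p q
    using subringE(6,7)[OF G that] by auto
  have t: "mon \<one> 1 \<in> G" using one compI[of \<one> 1] V_simps(2) W_closed(4) by auto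
  have m3: "mon l 3 \<in> G" if l: "l \<in> carrier L" for l
  proof -
    obtain w h where wh: "w \<in> W" "h \<in> H"
      "\<And>x. x \<in> carrier L \<Longrightarrow> \<exists>k\<in>K. \<exists>h'\<in>H. x = k \<otimes> (w \<otimes> h) \<oplus> h'" using WH_spans by blast
    obtain k h' where k: "k \<in> K" "h' \<in> H" "l = k \<otimes> (w \<otimes> h) \<oplus> h'" using wh(3)[OF l] by blast
    have cc: "w \<in> carrier L" "h \<in> carrier L" "k \<in> carrier L" "h' \<in> carrier L"
      using wh(1,2) k(1,2) W_closed(2) H_closed(1) K_carrier by auto
    have "mon l 3 = mon k 0 *\<^sub>P (mon w 1 *\<^sub>P mon h 2) +\<^sub>P mon \<one> 1 *\<^sub>P mon h' 2"
      unfolding k(3) using cc mon_mult[of w h 3 1 2] mon_mult[of \<one> h' 3 1 2]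
        mon_mult[of k "w \<otimes> h" 3 0 3] by simp
    moreover have "mon k 0 \<in> G" using c consI k(1) by blast
    moreover have "mon w 1 \<in> G" using one compI[of w 1] V_simps(2) wh(1) by auto
    moreover have "mon h 2 \<in> G" "mon h' 2 \<in> G" using two compI[of _ 2] V_simps(4) wh(2) k(2) by auto
    ultimately show ?thesis using Gm Ga t by simp
  qed
  have m: "mon l (3 + i) \<in> G" if l: "l \<in> carrier L" for l i
  proof (induction i)
    case 0
    then show ?case using m3[OF l] by simp
  next
    case (Suc i)
    then have "mon \<one> 1 *\<^sub>P mon l (3 + i) \<in> G" using Gm t by blast
    then show ?case using mon_mult[OF one_closed l, of "3 + Suc i" 1 "3 + i"] l by simp
  qed
  have compG: "comp i \<subseteq> G" for i
  proof -
    consider "i = 0" | "i = 1" | "i = 2" | "i \<ge> 3" by linarith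
    then show ?thesis
    proof cases
      case 4
      show ?thesis
      proof
        fix p assume "p \<in> comp i"
        then obtain l where l: "l \<in> V i" "p = mon l i" by (rule compE)
        then show "p \<in> G" using m[OF V_closed(1)[OF l(1)], of "i - 3"] 4 by simp
      qed
    qed (use c one two comp_0 in auto)
  qed
  fix x assume "x \<in> carrier A"
  then obtain f where f: "\<And>i. f i \<in> comp i" "finite {i. f i \<noteq> \<zero>\<^bsub>A\<^esub>}" "x = finsum A f {i. f i \<noteq> \<zero>\<^bsub>A\<^esub>}"
    using homogeneous_decomposition by blast
  have "finsum A f S \<in> G" if "finite S" for S
    using that
  proof (induction S rule: finite_induct)
    case empty
    then show ?case using subringE(2)[OF G] by simp
  next
    case (insert i S)
    have "f \<in> S \<rightarrow> carrier A" "f i \<in> carrier A" "f i \<in> G" using f(1) comp_A compG by blast+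
    then show ?case using A.finsum_insert[OF insert.hyps(1,2)] subringE(7)[OF G] f(1) compG insert.IH by auto
  qed
  then show "x \<in> G" using f(2,3) by simp
qed

lemma A_generated: "generate_ring A (cons \<union> comp 1 \<union> comp 2) = carrier A"
proof -
  interpret A: domain A by (rule A_domain)
  have sub: "cons \<union> comp 1 \<union> comp 2 \<subseteq> carrier A" using cons_A comp_A by blast
  have "carrier A \<subseteq> generate_ring A (cons \<union> comp 1 \<union> comp 2)"
    by (rule subring_containing_degree_le_two[OF A.generate_ring_is_subring[OF sub]])
      (auto intro: generate_ring.incl)
  then show ?thesis using A.generate_ring_incl[OF sub] by blast
qed

lemma mon_Span_mem:
  assumes G: "subring G A" "cons \<subseteq> G" and us: "set us \<subseteq> carrier L" "\<And>u. u \<in> set us \<Longrightarrow> mon u i \<in> G"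
    and x: "x \<in> Span K us"
  shows "mon x i \<in> G"
  using us x
proof (induction us arbitrary: x rule: list.induct)
  case Nil
  then have "mon x i = \<zero>\<^bsub>A\<^esub>" by simp
  then show ?case using subringE(2)[OF G(1)] by simp
next
  case (Cons u us)
  obtain k w where kw: "k \<in> K" "w \<in> Span K us" "x = k \<otimes> u \<oplus> w"
    using Cons.prems(3) line_extension_mem_iff by auto
  have c: "u \<in> carrier L" "w \<in> carrier L" "k \<in> carrier L"
    using Cons.prems(1) kw(1,2) K_carrier Span_in_carrier[of K us] by auto
  have "mon x i = mon k 0 *\<^sub>A mon u i +\<^sub>A mon w i"
    unfolding kw(3) using c U.monom_mult[of k u 0 i] by simp
  moreover have "mon w i \<in> G" using Cons kw(2) by simp
  moreover have "mon k 0 \<in> G" using G(2) consI[OF kw(1)] by blast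
  ultimately show ?case using subringE(6,7)[OF G(1)] Cons.prems(2)[of u] by simp
qed

text \<open>
  If W W = H, the monomials of degree two are combinations of products of monomials of degree one,
  and those are combinations of the finitely many w t with w in a basis of W.
\<close>

lemma A_standard_graded:
  assumes WW: "subspace_prod L K W W = H"
  shows "standard_graded cons A comp"
proof -
  interpret A: domain A by (rule A_domain)
  obtain ws where ws: "set ws \<subseteq> carrier L" "Span K ws = W"
    using exists_base[OF K dim_W] by blast
  have wsW: "set ws \<subseteq> W" using Span_base_incl[OF K ws(1)] ws(2) by simp
  define T where "T = (\<lambda>w. mon w 1) ` set ws"
  have T: "T \<subseteq> comp 1" "finite T" unfolding T_def using wsW compI[of _ 1] V_simps(2) by auto
  define G where "G = generate_ring A (cons \<union> T)"
  have sub: "cons \<union> T \<subseteq> carrier A" using cons_A T comp_A by blast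
  have G: "subring G A" unfolding G_def by (rule A.generate_ring_is_subring[OF sub])
  have incl: "cons \<subseteq> G" "T \<subseteq> G" unfolding G_def by (auto intro: generate_ring.incl)
  have one: "mon w 1 \<in> G" if "w \<in> W" for w
    by (rule mon_Span_mem[OF G incl(1) ws(1)]) (use incl(2) T_def ws(2) that in auto)
  have two: "mon h 2 \<in> G" if h: "h \<in> H" for h
  proof -
    obtain us where us: "h \<in> Span K us" "set us \<subseteq> {u \<otimes> v | u v. u \<in> W \<and> v \<in> W}"
      using h WW unfolding subspace_prod_def by blast
    show ?thesis
    proof (rule mon_Span_mem[OF G incl(1) _ _ us(1)])
      show "set us \<subseteq> carrier L" using us(2) W_closed(2) by blast
      fix u assume "u \<in> set us"
      then obtain v w where vw: "u = v \<otimes> w" "v \<in> W" "w \<in> W" using us(2) by blast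
      have "mon u 2 = mon v 1 *\<^sub>A mon w 1"
        unfolding vw(1) using mon_mult[of v w 2 1 1] W_closed(2) vw(2,3) by simp
      then show "mon u 2 \<in> G" using subringE(6)[OF G] one vw(2,3) by simp
    qed
  qed
  have "carrier A \<subseteq> G"
    by (rule subring_containing_degree_le_two[OF G incl(1)])
      (use one two V_simps(2,4) in \<open>auto elim!: compE\<close>)
  then have "generate_ring A (cons \<union> T) = carrier A"
    using A.generate_ring_incl[OF sub] unfolding G_def by blast
  then show ?thesis unfolding standard_graded_def using A_graded comp_0 T by blast
qed

section \<open>The Gorenstein property\<close>

text \<open>
  The local rings need not be distinguished: self-injectivity of the principal quotients holds for
  the algebra, passes to each localization, and produces an injective resolution there.
\<close>

theorem A_gorenstein: "gorenstein_ring TYPE('m) A"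
  unfolding gorenstein_ring_def
proof (intro conjI allI impI)
  interpret A: domain A by (rule A_domain)
  show "cring A" "noetherian_ring A" using A.is_cring A_noetherian by auto
  fix M assume "maximalideal M A"
  then interpret M: primeideal M A by (rule A.maximalideal_prime)
  interpret loc: domain_localization A "carrier A - M"
  proof (intro domain_localization.intro A_domain domain_localization_axioms.intro)
    show "carrier A - M \<subseteq> carrier A - {\<zero>\<^bsub>A\<^esub>}" using M.zero_closed by blast
    show "\<one>\<^bsub>A\<^esub> \<in> carrier A - M" using M.one_imp_carrier M.I_notcarr A.one_closed by blast
    show "s *\<^sub>A u \<in> carrier A - M" if "s \<in> carrier A - M" "u \<in> carrier A - M" for s u
      using that M.I_prime[of s u] A.m_closed[of s u] by blast
  qed
  show "finite_self_injective_dimension TYPE('m) (localization A (carrier A - M))"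
    by (rule fraction_field.finite_self_injective_dimension_domain[OF domain.fraction_field[OF loc.localization_is_domain]
          loc.localization_principal_quotients_self_injective[OF A_noetherian A_principal_quotients_self_injective]])
qed

end

theorem proposition2p2:
  fixes L :: "('a, 'b) ring_scheme" and K H W :: "'a set" and n :: nat
  defines "R \<equiv> KWH_algebra L K W H"
    and "A \<equiv> KWH_component L K W H"
    and "k \<equiv> constants L K"
  assumes "field L" and "subfield K L"
    and "ring.dimension L n K (carrier L)" and "even n"
    and "subalgebra K H L" and "K \<subseteq> H" and "ring.dimension L (n - 1) K H"
    and "subalgebra K W L" and "W \<subseteq> H" and "K \<subset> W" and "ring.dimension L (n div 2) K W"
    and "subspace_prod L K W W \<subseteq> H"
  shows "subring (carrier R) (UP L) \<and> graded_algebra k R A \<and> A 0 = k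
    \<and> gorenstein_ring TYPE('m) R \<and> noetherian_ring R \<and> domain R \<and> krull_dim R = 1
    \<and> generate_ring R (k \<union> A 1 \<union> A 2) = carrier R
    \<and> (subspace_prod L K W W = H \<longrightarrow> standard_graded k R A)"
proof -
  interpret L: field L by fact
  have n: "n > 0"
  proof (rule ccontr)
    assume "\<not> n > 0"
    then have "carrier L = {\<zero>\<^bsub>L\<^esub>}"
      using L.dimension_zero[OF \<open>subfield K L\<close>] \<open>ring.dimension L n K (carrier L)\<close> by simp
    then show False using L.one_closed L.one_not_zero by blast
  qed
  interpret codim_one L K H n
    by (intro codim_one.intro codim_one_axioms.intro \<open>field L\<close> n) (fact assms)+
  obtain \<phi> where \<phi>: "linear_form L K (carrier L) \<phi>"
    "\<forall>x\<in>carrier L. \<phi> x = \<zero>\<^bsub>L\<^esub> \<longleftrightarrow> x \<in> H"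
    using form_with_kernel by blast
  interpret \<phi>: linear_form L K "carrier L" \<phi> by (rule \<phi>(1))
  have "v \<otimes>\<^bsub>L\<^esub> w \<in> H" if vw: "v \<in> W" "w \<in> W" for v w
  proof -
    have c: "v \<otimes>\<^bsub>L\<^esub> w \<in> carrier L"
      using L.subalgebra_in_carrier[OF \<open>subalgebra K W L\<close>] vw by blast
    have "v \<otimes>\<^bsub>L\<^esub> w \<in> L.Span K [v \<otimes>\<^bsub>L\<^esub> w]"
      using L.Span_base_incl[OF \<open>subfield K L\<close>, of "[v \<otimes>\<^bsub>L\<^esub> w]"] c by simp
    moreover have "set [v \<otimes>\<^bsub>L\<^esub> w] \<subseteq> {u \<otimes>\<^bsub>L\<^esub> v | u v. u \<in> W \<and> v \<in> W}" using vw by auto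
    ultimately have "v \<otimes>\<^bsub>L\<^esub> w \<in> subspace_prod L K W W" unfolding subspace_prod_def by blast
    then show ?thesis using \<open>subspace_prod L K W W \<subseteq> H\<close> by blast
  qed
  then interpret KWH_form L K H n \<phi> W
    by (intro KWH_form.intro KWH_form_axioms.intro codim_one_axioms \<phi>(1))
      (use \<phi>(2) assms in blast)+
  show ?thesis
    unfolding R_def A_def k_def cons_def[symmetric]
    using A_subring A_graded comp_0 A_gorenstein A_noetherian A_domain A_krull_dim A_generated
      A_standard_graded by blast
qed


end
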